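(* Let $K=\mathbb{F}_q(t)$, where $\mathbb{F}_q$ is a finite field, and fix an integer $n\ge 3$. Let $(a_1,\dots,a_n)\in\mathbb{F}_q[t]^n$ be a coprime tuple. Suppose that there is a 1-factor $T=\{(x_{i1},\dots,x_{in})\in K^n\}_{i=1}^m$ with respect to $(a_1,\dots,a_n)$ of size $m$. Then there exist Galois conjugates $\gamma_1,\dots,\gamma_n$ over $K$ such that $\sum_{i=1}^n a_i\gamma_i=0$ and $\operatorname{Gal}(K(\gamma_1)/K)\cong S_m$.
   Context: A tuple in $\mathbb{F}_q[t]^n$ is coprime if its entries generate the unit ideal. Elements $\gamma_1,\dots,\gamma_n\in\overline K$ are Galois conjugates over $K$ if they are all roots of the same irreducible polynomial over $K$ (not necessarily distinct); Galois conjugates are assumed nonzero. A balanced multiset (of tuples) with respect to $(a_1,\dots,a_n)\in K^n$ is a nonempty finite collection (multiset) of nonzero solutions $\{(x_{i1},\dots,x_{in})\in K^n\}_{i=1}^N$ to the equation $\sum_{j=1}^n a_jx_j=0$ such that the multiset $\{x_{ij}\}_{i=1}^N$ is independent of $j\in\{1,\dots,n\}$. Its size is $N$. A balanced multiset is a 1-factor if the multiset $\{x_{i1}\}_{i=1}^N$ is a set, i.e. $x_{11},\dots,x_{N1}$ are pairwise distinct. $S_m$ is the symmetric group on $m$ letters. *)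

theory Defs
  imports
    "HOL-Algebra.Algebraic_Closure_Type"
    "HOL-Algebra.Generated_Fields"
    "HOL-Algebra.Bij"
    "HOL-Algebra.Sym_Groups"
    "HOL-Library.Multiset"
    "Jordan_Normal_Form.Matrix"
begin

text \<open>
  Tuples in \<open>R\<^sup>n\<close> are vectors in \<^term>\<open>carrier_vec n\<close>; they are indexed from \<open>0\<close>, so the
  first entry of \<open>x\<close> is \<open>x $ 0\<close>. The algebraic closure of a field \<open>'k\<close> is the type
  \<open>'k alg_closure\<close>, into which \<open>'k\<close> embeds by \<^term>\<open>to_ac\<close>. The function field over a
  finite field \<open>'q\<close> is the type \<open>'q poly fract\<close>.
\<close>

definition coprime_tuple :: "'r :: comm_ring_1 vec \<Rightarrow> bool" where
  "coprime_tuple a \<longleftrightarrow> Idl\<^bsub>ring_of_type_algebra\<^esub> (set\<^sub>v a) = UNIV"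

definition balanced_multiset :: "nat \<Rightarrow> 'k :: field vec \<Rightarrow> 'k vec multiset \<Rightarrow> bool" where
  "balanced_multiset n a T \<longleftrightarrow>
     T \<noteq> {#} \<and>
     (\<forall>x \<in># T. x \<in> carrier_vec n \<and> x \<noteq> 0\<^sub>v n \<and> a \<bullet> x = 0) \<and>
     (\<forall>j < n. \<forall>k < n. image_mset (\<lambda>x. x $ j) T = image_mset (\<lambda>x. x $ k) T)"

definition one_factor :: "nat \<Rightarrow> 'k :: field vec \<Rightarrow> 'k vec multiset \<Rightarrow> bool" where
  "one_factor n a T \<longleftrightarrow>
     balanced_multiset n a T \<and> (\<forall>c. count (image_mset (\<lambda>x. x $ 0) T) c \<le> 1)"

definition galois_conjugates :: "'k :: field alg_closure set \<Rightarrow> bool" where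
  "galois_conjugates S \<longleftrightarrow>
     (\<exists>f :: 'k poly. Factorial_Ring.irreducible f \<and>
        (\<forall>x \<in> S. x \<noteq> 0 \<and> poly (map_poly to_ac f) x = 0))"

definition field_adjoin :: "'k :: field alg_closure \<Rightarrow> 'k alg_closure set" where
  "field_adjoin \<gamma> = generate_field ring_of_type_algebra (insert \<gamma> (range to_ac))"

text \<open>
  The next three definitions concern intermediate fields \<open>L\<close> of \<open>'k alg_closure\<close> over \<open>'k\<close>.
  Algebraicity is automatic, and \<open>f\<close> splits over \<open>L\<close> iff \<open>L\<close> contains all its roots in the
  algebraic closure.
\<close>

definition normal_ext :: "'k :: field alg_closure set \<Rightarrow> bool" where
  "normal_ext L \<longleftrightarrow>
     (\<forall>f :: 'k poly. Factorial_Ring.irreducible f \<and> (\<exists>x \<in> L. poly (map_poly to_ac f) x = 0) \<longrightarrow>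
        {x. poly (map_poly to_ac f) x = 0} \<subseteq> L)"

definition separable_ext :: "'k :: field alg_closure set \<Rightarrow> bool" where
  "separable_ext L \<longleftrightarrow>
     (\<forall>f :: 'k poly. Factorial_Ring.irreducible f \<and> (\<exists>x \<in> L. poly (map_poly to_ac f) x = 0) \<longrightarrow>
        rsquarefree (map_poly to_ac f))"

definition galois_ext :: "'k :: field alg_closure set \<Rightarrow> bool" where
  "galois_ext L \<longleftrightarrow> normal_ext L \<and> separable_ext L"

text \<open>
  \<open>Gal(L/'k)\<close>: field automorphisms of \<open>L\<close> fixing \<open>'k\<close> pointwise, under composition; as in
  \<^term>\<open>BijGroup L\<close> they are taken to be extensional on \<open>L\<close>.
\<close>

definition Gal :: "'k :: field alg_closure set \<Rightarrow> ('k alg_closure \<Rightarrow> 'k alg_closure) monoid" where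
  "Gal L = (BijGroup L)\<lparr>carrier :=
     {\<sigma> \<in> Bij L.
        \<sigma> \<in> ring_iso (ring_of_type_algebra\<lparr>carrier := L\<rparr>) (ring_of_type_algebra\<lparr>carrier := L\<rparr>) \<and>
        (\<forall>c. \<sigma> (to_ac c) = to_ac c)}\<rparr>"

end

theory Submission
  imports
    Defs
    "HOL-Library.Cardinality"
    "HOL-Computational_Algebra.Formal_Laurent_Series"
    "HOL-Computational_Algebra.Polynomial_FPS"
    "HOL-Combinatorics.Cycles"
begin

text \<open>
  A one-factor is a matrix of solutions whose columns \<open>d 0, \<dots>, d (n - 1)\<close> are permutations of one list
  of \<open>m\<close> distinct entries. Suppose that a polynomial over \<open>K = F\<^sub>q(t)\<close> has degree \<open>m\<close>, distinct roots
  \<open>z\<close>, and the symmetric group on its roots as Galois group over \<open>K\<close>. Index the rows of the matrix by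
  the roots, choose a polynomial \<open>p\<close> over \<open>K\<close> and let \<open>\<gamma> j\<close> be the sum of \<open>d j z * p(z)\<close> over the roots.
  As each row solves the equation, so does \<open>\<gamma>\<close>. As permuting the roots is the same as permuting the
  coefficients, every \<open>\<gamma> j\<close> is a conjugate of \<open>\<gamma> 0\<close>. The entries of the first column being
  distinct, no permutation other than the identity fixes \<open>\<gamma> 0\<close>, provided that \<open>p\<close> avoids finitely many
  proper subspaces (\<open>generic_combination_exists\<close>); this is possible as \<open>K\<close> is infinite. Hence
  \<open>\<gamma> 0\<close> generates the splitting field.

  This last step is a dimension count. The splitting field is spanned by \<open>m!\<close> elements
  (\<open>splitting_field_dim\<close>) and \<open>\<gamma> 0\<close> has \<open>m!\<close> conjugates. So its minimal polynomial has degree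
  \<open>m!\<close> and simple roots, and its powers form a basis (\<open>primitive\<close>). Normality, separability
  (\<open>galois_ext_L\<close>) and the Galois group (\<open>Gal_iso_sym_group\<close>) can be read off from this.

  It remains to find a polynomial with symmetric Galois group (\<open>symmetric_galois_group_exists\<close>). It is
  obtained by prescribing its specialisations at \<open>t = 0\<close> and \<open>t = 1\<close>. Dedekind's theorem
  (\<open>frobenius_at_place\<close>) provides Galois elements that act on the roots as Frobenius acts on the
  roots of the specialisations. Here it is proved by expanding the roots into power series in \<open>t - c\<close>
  with Hensel's lemma and applying Frobenius to the coefficients. One specialisation gives a
  permutation that fixes one root and is transitive on the others, the other one a transposition. A
  constant coefficient of large degree in \<open>t\<close> excludes rational roots, so no root is fixed by all
  automorphisms. These permutations generate the symmetric group (\<open>transposition_and_cycle_generate\<close>).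
\<close>

no_notation fps_nth (infixl \<open>$\<close> 75)

section \<open>Subfields of a field type\<close>

text \<open>
  Subfields are sets inside a field type and are described by the operations of the type class, so
  that intermediate fields of one algebraic closure can be compared by inclusion.
\<close>

definition subfld :: "'a :: field set \<Rightarrow> bool" where
  "subfld F \<longleftrightarrow> 0 \<in> F \<and> 1 \<in> F \<and> (\<forall>x \<in> F. \<forall>y \<in> F. x + y \<in> F \<and> x * y \<in> F) \<and>
     (\<forall>x \<in> F. - x \<in> F \<and> inverse x \<in> F)"

lemma subfldD:
  assumes "subfld F"
  shows "0 \<in> F" "1 \<in> F" "x \<in> F \<Longrightarrow> y \<in> F \<Longrightarrow> x + y \<in> F" "x \<in> F \<Longrightarrow> y \<in> F \<Longrightarrow> x * y \<in> F"
    "x \<in> F \<Longrightarrow> - x \<in> F" "x \<in> F \<Longrightarrow> inverse x \<in> F"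
  using assms unfolding subfld_def by auto

lemma subfld_diff: "subfld F \<Longrightarrow> x \<in> F \<Longrightarrow> y \<in> F \<Longrightarrow> x - y \<in> F"
  using subfldD(3,5)[of F] by (metis add_uminus_conv_diff)

lemma subfld_sum: "subfld F \<Longrightarrow> (\<And>i. i \<in> I \<Longrightarrow> f i \<in> F) \<Longrightarrow> sum f I \<in> F"
  by (induction I rule: infinite_finite_induct) (auto intro: subfldD)

lemma subfld_power: "subfld F \<Longrightarrow> x \<in> F \<Longrightarrow> x ^ n \<in> F"
  by (induction n) (auto intro: subfldD)

definition polys_over :: "'a :: field set \<Rightarrow> 'a poly set" where
  "polys_over F = {p. \<forall>i. coeff p i \<in> F}"

lemma polys_over_coeff: "p \<in> polys_over F \<Longrightarrow> coeff p i \<in> F"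
  by (simp add: polys_over_def)

lemma polys_over_mono: "F \<subseteq> F' \<Longrightarrow> p \<in> polys_over F \<Longrightarrow> p \<in> polys_over F'"
  by (auto simp: polys_over_def)

lemma polys_over_closed:
  assumes "subfld F"
  shows "0 \<in> polys_over F" "1 \<in> polys_over F"
    "p \<in> polys_over F \<Longrightarrow> q \<in> polys_over F \<Longrightarrow> p + q \<in> polys_over F"
    "p \<in> polys_over F \<Longrightarrow> q \<in> polys_over F \<Longrightarrow> p - q \<in> polys_over F"
    "p \<in> polys_over F \<Longrightarrow> q \<in> polys_over F \<Longrightarrow> p * q \<in> polys_over F"
    "p \<in> polys_over F \<Longrightarrow> - p \<in> polys_over F"
    "p \<in> polys_over F \<Longrightarrow> c \<in> F \<Longrightarrow> smult c p \<in> polys_over F"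
    "c \<in> F \<Longrightarrow> monom c n \<in> polys_over F"
    "p \<in> polys_over F \<Longrightarrow> c \<in> F \<Longrightarrow> pCons c p \<in> polys_over F"
  using subfldD[OF assms]
  by (auto simp: polys_over_def coeff_mult coeff_pCons split: nat.split
      intro!: subfld_sum[OF assms] subfld_diff[OF assms])

lemma polys_over_prod:
  assumes "subfld F" "\<And>i. i \<in> I \<Longrightarrow> f i \<in> polys_over F"
  shows "prod f I \<in> polys_over F"
  using assms(2) by (induction I rule: infinite_finite_induct) (auto intro: polys_over_closed[OF assms(1)])

lemma poly_in_subfld:
  assumes "subfld F" "p \<in> polys_over F" "x \<in> F"
  shows "poly p x \<in> F"
  unfolding poly_altdef using assms
  by (auto intro!: subfld_sum[OF assms(1)] subfldD[OF assms(1)] subfld_power polys_over_coeff)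

text \<open>
  Long division only ever divides by the leading coefficient of \<open>b\<close>, so it does not leave \<open>F\<close>.
\<close>

lemma polys_over_division:
  assumes F: "subfld F" and b: "b \<in> polys_over F" "b \<noteq> 0"
  shows "a \<in> polys_over F \<Longrightarrow>
    \<exists>s \<in> polys_over F. \<exists>r \<in> polys_over F. a = b * s + r \<and> (r = 0 \<or> degree r < degree b)"
proof (induction "degree a" arbitrary: a rule: less_induct)
  case less
  note cl = polys_over_closed[OF F]
  show ?case
  proof (cases "a = 0 \<or> degree a < degree b")
    case True
    thus ?thesis using less.prems cl(1) by (intro bexI[of _ 0] bexI[of _ a]) auto
  next
    case False
    define c where "c = lead_coeff a / lead_coeff b"
    define u where "u = monom c (degree a - degree b)"
    have cF: "c \<in> F"
      unfolding c_def divide_inverse using less.prems b by (intro subfldD[OF F] polys_over_coeff)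
    have u: "u \<in> polys_over F" unfolding u_def using cF by (rule cl)
    define a' where "a' = a - b * u"
    have a': "a' \<in> polys_over F" unfolding a'_def using less.prems b u by (intro cl)
    have c0: "c \<noteq> 0" using False b by (auto simp: c_def)
    have dbu: "degree (b * u) = degree a"
      using False b c0 by (simp add: u_def degree_mult_eq degree_monom_eq)
    have lead: "coeff (b * u) (degree a) = lead_coeff a"
    proof -
      have "lead_coeff u = c" using c0 by (simp add: u_def degree_monom_eq)
      thus ?thesis using lead_coeff_mult[of b u] b unfolding dbu by (simp add: c_def)
    qed
    have "a' = 0 \<or> degree a' < degree a"
    proof (rule disjCI)
      assume nl: "\<not> degree a' < degree a"
      have "degree a' \<le> degree a" unfolding a'_def using dbu by (intro degree_diff_le) auto
      hence "degree a' = degree a" using nl by simp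
      moreover have "coeff a' (degree a) = 0" unfolding a'_def using lead by simp
      ultimately show "a' = 0" by (metis leading_coeff_0_iff)
    qed
    then consider "a' = 0" | "degree a' < degree a" by blast
    hence "\<exists>s \<in> polys_over F. \<exists>r \<in> polys_over F. a' = b * s + r \<and> (r = 0 \<or> degree r < degree b)"
    proof cases
      case 1
      thus ?thesis using cl(1) by (intro bexI[of _ 0] bexI[of _ 0]) auto
    next
      case 2
      thus ?thesis using less.hyps a' by blast
    qed
    then obtain s r where sr: "s \<in> polys_over F" "r \<in> polys_over F" "a' = b * s + r"
      "r = 0 \<or> degree r < degree b" by blast
    have "a = b * (s + u) + r" using sr(3) by (simp add: a'_def algebra_simps)
    thus ?thesis using sr u cl(3) by (intro bexI[of _ "s + u"] bexI[of _ r]) auto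
  qed
qed

text \<open>
  Dividing \<open>b * s\<close> by \<open>b\<close> over \<open>F\<close> yields a quotient with coefficients in \<open>F\<close>, and quotients are
  unique.
\<close>

lemma polys_over_cofactor:
  assumes F: "subfld F" and b: "b \<in> polys_over F" "b \<noteq> 0" and a: "b * s \<in> polys_over F"
  shows "s \<in> polys_over F"
proof -
  obtain s' r where sr: "s' \<in> polys_over F" "r \<in> polys_over F" "b * s = b * s' + r"
    "r = 0 \<or> degree r < degree b" using polys_over_division[OF F b a] by blast
  have r: "r = b * (s - s')" using sr(3) by (simp add: algebra_simps)
  have "s = s'"
  proof (rule ccontr)
    assume "s \<noteq> s'"
    hence "r \<noteq> 0" "degree r \<ge> degree b" using r b by (auto simp: degree_mult_eq)
    thus False using sr(4) by auto
  qed
  thus ?thesis using sr by simp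
qed

text \<open>
  Take \<open>d\<close> of least degree among the nonzero combinations of \<open>p\<close> and \<open>q\<close>. The remainder of a
  combination modulo \<open>d\<close> is again a combination, so it vanishes.
\<close>

lemma polys_over_bezout:
  assumes F: "subfld F" and p: "p \<in> polys_over F" and q: "q \<in> polys_over F" and ne: "q \<noteq> 0"
  obtains a b d e e' where "a \<in> polys_over F" "b \<in> polys_over F" "d = a * p + b * q" "d \<noteq> 0"
    "p = d * e" "q = d * e'" "e \<in> polys_over F" "e' \<in> polys_over F"
proof -
  note cl = polys_over_closed[OF F]
  define I where "I = {a * p + b * q |a b. a \<in> polys_over F \<and> b \<in> polys_over F}"
  have pI: "p \<in> I" unfolding I_def using cl(1,2) by (intro CollectI exI[of _ 1] exI[of _ 0]) auto
  have qI: "q \<in> I" unfolding I_def using cl(1,2) by (intro CollectI exI[of _ 0] exI[of _ 1]) auto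
  have "\<exists>d. (d \<in> I \<and> d \<noteq> 0) \<and> (\<forall>d'. d' \<in> I \<and> d' \<noteq> 0 \<longrightarrow> degree d \<le> degree d')"
    using ex_has_least_nat[of "\<lambda>d. d \<in> I \<and> d \<noteq> 0" q degree] qI ne by blast
  then obtain d where d: "d \<in> I" "d \<noteq> 0" and dmin: "\<And>d'. d' \<in> I \<Longrightarrow> d' \<noteq> 0 \<Longrightarrow> degree d \<le> degree d'"
    by blast
  obtain a b where ab: "a \<in> polys_over F" "b \<in> polys_over F" "d = a * p + b * q"
    using d(1) unfolding I_def by blast
  have dF: "d \<in> polys_over F" using ab p q by (auto intro: cl)
  have div: "\<exists>e \<in> polys_over F. u = d * e" if u: "u \<in> I" for u
  proof -
    obtain a' b' where u': "a' \<in> polys_over F" "b' \<in> polys_over F" "u = a' * p + b' * q"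
      using u unfolding I_def by blast
    hence uF: "u \<in> polys_over F" using p q by (auto intro: cl)
    obtain s r where sr: "s \<in> polys_over F" "r \<in> polys_over F" "u = d * s + r"
      "r = 0 \<or> degree r < degree d" using polys_over_division[OF F dF d(2) uF] by blast
    have "r = (a' - a * s) * p + (b' - b * s) * q" using sr(3) u'(3) ab(3) by (simp add: algebra_simps)
    hence "r \<in> I" unfolding I_def using ab u' sr(1) cl by blast
    hence "r = 0" using dmin[of r] sr(4) by (meson leD)
    thus ?thesis using sr by auto
  qed
  from div[OF pI] div[OF qI] obtain e e' where "e \<in> polys_over F" "p = d * e" "e' \<in> polys_over F" "q = d * e'"
    by blast
  thus ?thesis using that ab d(2) by blast
qed

text \<open>
  A nonzero annihilating polynomial of least degree, made monic. The remainder of another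
  annihilating polynomial has smaller degree and still annihilates \<open>x\<close>, so it vanishes.
\<close>

lemma min_poly_exists:
  assumes F: "subfld F" and p: "p \<in> polys_over F" "p \<noteq> 0" "poly p x = 0"
  obtains \<mu> where "\<mu> \<in> polys_over F" "lead_coeff \<mu> = 1" "poly \<mu> x = 0"
    "\<And>q. q \<in> polys_over F \<Longrightarrow> poly q x = 0 \<Longrightarrow> \<exists>s \<in> polys_over F. q = \<mu> * s"
proof -
  let ?P = "\<lambda>q. q \<in> polys_over F \<and> q \<noteq> 0 \<and> poly q x = 0"
  obtain \<nu> where \<nu>: "?P \<nu>" and min: "\<And>q. ?P q \<Longrightarrow> degree \<nu> \<le> degree q"
    using ex_has_least_nat[of ?P p degree] p by blast
  define \<mu> where "\<mu> = smult (inverse (lead_coeff \<nu>)) \<nu>"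
  have \<mu>: "\<mu> \<in> polys_over F" unfolding \<mu>_def
    using \<nu> by (intro polys_over_closed[OF F] subfldD[OF F]) (auto intro: polys_over_coeff)
  have lc: "lead_coeff \<mu> = 1" using \<nu> by (simp add: \<mu>_def)
  have dg: "degree \<mu> = degree \<nu>" using \<nu> by (simp add: \<mu>_def)
  have root: "poly \<mu> x = 0" using \<nu> by (simp add: \<mu>_def)
  have "\<exists>s \<in> polys_over F. q = \<mu> * s" if q: "q \<in> polys_over F" "poly q x = 0" for q
  proof -
    obtain s r where sr: "s \<in> polys_over F" "r \<in> polys_over F" "q = \<mu> * s + r"
      "r = 0 \<or> degree r < degree \<mu>" using polys_over_division[OF F \<mu> _ q(1)] lc by fastforce
    have "poly r x = 0" using q(2) sr(3) root by simp
    hence "r = 0" using min[of r] sr(2,4) unfolding dg by linarith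
    thus ?thesis using sr by auto
  qed
  thus ?thesis using that \<mu> lc root by blast
qed

definition adjoin :: "'a :: field set \<Rightarrow> 'a set \<Rightarrow> 'a set" where
  "adjoin F Z = \<Inter>{L. subfld L \<and> F \<subseteq> L \<and> Z \<subseteq> L}"

lemma subfld_adjoin: "subfld (adjoin F Z)"
  unfolding subfld_def adjoin_def by (auto intro: subfldD)

lemma adjoin_base: "F \<subseteq> adjoin F Z"
  and adjoin_gens: "Z \<subseteq> adjoin F Z"
  unfolding adjoin_def by auto

lemma adjoin_least: "subfld L \<Longrightarrow> F \<subseteq> L \<Longrightarrow> Z \<subseteq> L \<Longrightarrow> adjoin F Z \<subseteq> L"
  unfolding adjoin_def by auto

lemma adjoin_adjoin: "adjoin (adjoin F Z) Y = adjoin F (Z \<union> Y)"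
proof (rule antisym)
  have "Z \<union> Y \<subseteq> adjoin F (Z \<union> Y)" by (rule adjoin_gens)
  thus "adjoin (adjoin F Z) Y \<subseteq> adjoin F (Z \<union> Y)"
    by (intro adjoin_least subfld_adjoin) (use adjoin_base in auto)
  show "adjoin F (Z \<union> Y) \<subseteq> adjoin (adjoin F Z) Y"
    using adjoin_base[of F Z] adjoin_gens[of Z F] adjoin_base[of "adjoin F Z" Y] adjoin_gens[of Y "adjoin F Z"]
    by (intro adjoin_least subfld_adjoin) blast+
qed

lemma adjoin_empty: "subfld F \<Longrightarrow> adjoin F {} = F"
  by (simp add: adjoin_base adjoin_least subset_antisym)

text \<open>
  Only inverses need an argument. If \<open>poly q x \<noteq> 0\<close>, a common divisor \<open>d\<close> of \<open>q\<close> and the minimal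
  polynomial of \<open>x\<close> does not vanish at \<open>x\<close>, hence is constant, and its Bezout representation
  inverts \<open>poly q x\<close>.
\<close>

lemma adjoin_simple:
  assumes F: "subfld F" and p: "p \<in> polys_over F" "p \<noteq> 0" "poly p x = 0"
  shows "adjoin F {x} = {poly q x |q. q \<in> polys_over F}"
proof (rule antisym)
  note cl = polys_over_closed[OF F]
  let ?R = "{poly q x |q. q \<in> polys_over F}"
  show "?R \<subseteq> adjoin F {x}"
    using adjoin_base[of F "{x}"] adjoin_gens[of "{x}" F] polys_over_mono[OF adjoin_base]
    by (auto intro!: poly_in_subfld[OF subfld_adjoin])
  obtain \<mu> where \<mu>: "\<mu> \<in> polys_over F" "lead_coeff \<mu> = 1" "poly \<mu> x = 0"
    and min: "\<And>q. q \<in> polys_over F \<Longrightarrow> poly q x = 0 \<Longrightarrow> \<exists>s \<in> polys_over F. q = \<mu> * s"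
    using min_poly_exists[OF F p] by blast
  have \<mu>0: "\<mu> \<noteq> 0" using \<mu>(2) by auto
  have const: "c \<in> ?R" if "c \<in> F" for c
    using that cl(8)[of c 0] by (force simp: monom_0)
  have inv: "inverse y \<in> ?R" if y: "y \<in> ?R" for y
  proof (cases "y = 0")
    case True
    thus ?thesis using cl(1) by force
  next
    case False
    obtain q where q: "q \<in> polys_over F" "y = poly q x" using y by blast
    obtain a b d e e' where B: "a \<in> polys_over F" "b \<in> polys_over F" "d = a * q + b * \<mu>" "d \<noteq> 0"
      "q = d * e" "\<mu> = d * e'" "e \<in> polys_over F" "e' \<in> polys_over F"
      using polys_over_bezout[OF F q(1) \<mu>(1) \<mu>0] by metis
    have dx: "poly d x \<noteq> 0" using False q B(5) by auto
    hence "poly e' x = 0" using \<mu>(3) B(6) by simp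
    then obtain s where "e' = \<mu> * s" using min B(8) by blast
    hence "\<mu> = \<mu> * (d * s)" using B(6) by (simp add: ac_simps)
    hence "d * s = 1" using \<mu>0 by simp
    hence "degree d = 0" by (metis degree_mult_eq add_is_0 degree_1 mult_zero_left mult_zero_right one_neq_zero)
    then obtain c where c: "d = [:c:]" by (metis degree_eq_zeroE)
    have dF: "d \<in> polys_over F" unfolding B(3) using B(1,2) q \<mu> by (intro cl)
    have cF: "c \<in> F" using polys_over_coeff[OF dF, of 0] c by simp
    have "poly a x * y = c" using arg_cong[OF B(3), of "\<lambda>u. poly u x"] q \<mu> c by simp
    moreover have "c \<noteq> 0" using B(4) c by auto
    ultimately have "inverse y = poly (smult (inverse c) a) x"
      using False by (simp add: field_simps)
    thus ?thesis using cl(7)[OF B(1) subfldD(6)[OF F cF]] by blast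
  qed
  have "subfld ?R"
    unfolding subfld_def
  proof (intro conjI ballI)
    show "0 \<in> ?R" "1 \<in> ?R" using const subfldD[OF F] by blast+
    fix y z assume "y \<in> ?R" "z \<in> ?R"
    then obtain a b where ab: "a \<in> polys_over F" "b \<in> polys_over F" "y = poly a x" "z = poly b x" by blast
    show "y + z \<in> ?R" using ab cl(3)[of a b] by (auto intro!: exI[of _ "a + b"])
    show "y * z \<in> ?R" using ab cl(5)[of a b] by (auto intro!: exI[of _ "a * b"])
    show "- y \<in> ?R" using ab cl(6)[of a] by (auto intro!: exI[of _ "- a"])
    show "inverse y \<in> ?R" using \<open>y \<in> ?R\<close> by (rule inv)
  qed
  moreover have "x \<in> ?R"
    using cl(9)[OF cl(2) subfldD(1)[OF F]] by (auto intro!: exI[of _ "[:0, 1:]"] simp: one_pCons)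
  ultimately show "adjoin F {x} \<subseteq> ?R" using const by (intro adjoin_least) auto
qed


section \<open>Extending homomorphisms\<close>

text \<open>
  Values outside \<open>F\<close> are irrelevant. Compatibility with 0, negation and inverses follows, because
  \<open>F\<close> will be a subfield.
\<close>

definition fhom :: "'a :: field set \<Rightarrow> ('a \<Rightarrow> 'b :: field) \<Rightarrow> bool" where
  "fhom F \<phi> \<longleftrightarrow> \<phi> 1 = 1 \<and> (\<forall>x \<in> F. \<forall>y \<in> F. \<phi> (x + y) = \<phi> x + \<phi> y \<and> \<phi> (x * y) = \<phi> x * \<phi> y)"

lemma fhomD:
  assumes "fhom F \<phi>" "subfld F"
  shows "\<phi> 1 = 1" "x \<in> F \<Longrightarrow> y \<in> F \<Longrightarrow> \<phi> (x + y) = \<phi> x + \<phi> y"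
    "x \<in> F \<Longrightarrow> y \<in> F \<Longrightarrow> \<phi> (x * y) = \<phi> x * \<phi> y"
    "\<phi> 0 = 0" "x \<in> F \<Longrightarrow> \<phi> (- x) = - \<phi> x" "x \<in> F \<Longrightarrow> \<phi> (inverse x) = inverse (\<phi> x)"
    "x \<in> F \<Longrightarrow> y \<in> F \<Longrightarrow> \<phi> (x - y) = \<phi> x - \<phi> y"
proof -
  show 1: "\<phi> 1 = 1" and add: "\<And>x y. x \<in> F \<Longrightarrow> y \<in> F \<Longrightarrow> \<phi> (x + y) = \<phi> x + \<phi> y"
    and mult: "\<And>x y. x \<in> F \<Longrightarrow> y \<in> F \<Longrightarrow> \<phi> (x * y) = \<phi> x * \<phi> y"
    using assms(1) unfolding fhom_def by auto
  have "\<phi> 0 = \<phi> 0 + \<phi> 0" using add[of 0 0] subfldD(1)[OF assms(2)] by simp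
  thus 0: "\<phi> 0 = 0" by (metis add_cancel_right_right)
  show neg: "\<And>x. x \<in> F \<Longrightarrow> \<phi> (- x) = - \<phi> x"
    using add subfldD(5)[OF assms(2)] 0 by (metis add.right_inverse add_eq_0_iff)
  show "\<And>x y. x \<in> F \<Longrightarrow> y \<in> F \<Longrightarrow> \<phi> (x - y) = \<phi> x - \<phi> y"
    using add neg subfldD(5)[OF assms(2)] by (metis add_uminus_conv_diff)
  show "x \<in> F \<Longrightarrow> \<phi> (inverse x) = inverse (\<phi> x)"
  proof (cases "x = 0")
    case False
    assume x: "x \<in> F"
    have "\<phi> x * \<phi> (inverse x) = 1" using mult[OF x subfldD(6)[OF assms(2) x]] 1 False by simp
    thus ?thesis by (metis inverse_unique)
  qed (simp add: 0)
qed

lemma fhom_inj_on: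
  assumes "fhom F \<phi>" "subfld F"
  shows "inj_on \<phi> F"
proof (rule inj_onI)
  note h = fhomD[OF assms]
  fix x y assume xy: "x \<in> F" "y \<in> F" "\<phi> x = \<phi> y"
  show "x = y"
  proof (rule ccontr)
    assume ne: "x \<noteq> y"
    have d: "x - y \<in> F" using xy assms(2) by (intro subfld_diff)
    have "\<phi> ((x - y) * inverse (x - y)) = 0"
      using h(3)[OF d subfldD(6)[OF assms(2) d]] h(7) xy by simp
    thus False using ne h(1) by simp
  qed
qed

lemma fhom_sum:
  assumes "fhom F \<phi>" "subfld F" "\<And>i. i \<in> I \<Longrightarrow> f i \<in> F"
  shows "\<phi> (sum f I) = (\<Sum>i\<in>I. \<phi> (f i))"
  using assms(3)
  by (induction I rule: infinite_finite_induct)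
    (auto simp: fhomD[OF assms(1,2)] subfld_sum[OF assms(2)])

lemma fhom_power:
  assumes "fhom F \<phi>" "subfld F" "x \<in> F"
  shows "\<phi> (x ^ n) = \<phi> x ^ n"
  by (induction n) (auto simp: fhomD[OF assms(1,2)] subfld_power assms)

lemma fhom_poly:
  assumes "fhom F \<phi>" "subfld F" "p \<in> polys_over F" "x \<in> F"
  shows "\<phi> (poly p x) = poly (map_poly \<phi> p) (\<phi> x)"
proof -
  note h = fhomD[OF assms(1,2)]
  have "degree (map_poly \<phi> p) \<le> degree p"
    by (rule degree_le) (auto simp: coeff_map_poly h coeff_eq_0)
  hence "poly (map_poly \<phi> p) (\<phi> x) = (\<Sum>i\<le>degree p. coeff (map_poly \<phi> p) i * \<phi> x ^ i)"
    unfolding poly_altdef by (intro sum.mono_neutral_left) (auto simp: coeff_eq_0)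
  also have "\<dots> = \<phi> (poly p x)"
    unfolding poly_altdef using assms
    by (subst fhom_sum[OF assms(1,2)])
      (auto simp: coeff_map_poly h subfldD fhom_power subfld_power polys_over_coeff)
  finally show ?thesis by simp
qed

lemma map_poly_fhom:
  assumes "fhom F \<phi>" "subfld F" "p \<in> polys_over F" "q \<in> polys_over F"
  shows "map_poly \<phi> (p + q) = map_poly \<phi> p + map_poly \<phi> q"
    "map_poly \<phi> (p - q) = map_poly \<phi> p - map_poly \<phi> q"
    "map_poly \<phi> (p * q) = map_poly \<phi> p * map_poly \<phi> q"
proof -
  note h = fhomD[OF assms(1,2)]
  note c = polys_over_coeff[OF assms(3)] polys_over_coeff[OF assms(4)]
  show "map_poly \<phi> (p + q) = map_poly \<phi> p + map_poly \<phi> q"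
    "map_poly \<phi> (p - q) = map_poly \<phi> p - map_poly \<phi> q"
    by (rule poly_eqI, simp add: coeff_map_poly h c)+
  show "map_poly \<phi> (p * q) = map_poly \<phi> p * map_poly \<phi> q"
    by (rule poly_eqI, simp add: coeff_map_poly h c coeff_mult)
      (subst fhom_sum[OF assms(1,2)], auto simp: h c subfldD[OF assms(2)])
qed

lemma degree_map_poly_fhom:
  assumes "fhom F \<phi>" "subfld F" "p \<in> polys_over F"
  shows "degree (map_poly \<phi> p) = degree p"
proof (cases "p = 0")
  case False
  have "\<phi> (lead_coeff p) \<noteq> 0"
    using fhom_inj_on[OF assms(1,2)] fhomD(4)[OF assms(1,2)] subfldD(1)[OF assms(2)]
      polys_over_coeff[OF assms(3)] False by (metis inj_onD leading_coeff_0_iff)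
  hence "coeff (map_poly \<phi> p) (degree p) \<noteq> 0"
    by (simp add: coeff_map_poly fhomD(4)[OF assms(1,2)])
  moreover have "degree (map_poly \<phi> p) \<le> degree p"
    by (rule degree_le) (auto simp: coeff_map_poly fhomD(4)[OF assms(1,2)] coeff_eq_0)
  ultimately show ?thesis by (metis le_degree order_antisym)
qed auto

text \<open>
  The extension sends \<open>poly q x\<close> to \<open>poly (map_poly \<phi> q) y\<close>. Two polynomials with the same value at \<open>x\<close>
  differ by a multiple of \<open>\<mu>\<close>, whose image vanishes at \<open>y\<close>, so this is well defined.
\<close>

lemma extend_hom_min_poly:
  assumes F: "subfld F" and \<phi>: "fhom F \<phi>"
    and \<mu>: "\<mu> \<in> polys_over F" "\<mu> \<noteq> 0" "poly \<mu> x = 0"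
    and min: "\<And>q. q \<in> polys_over F \<Longrightarrow> poly q x = 0 \<Longrightarrow> \<exists>s \<in> polys_over F. q = \<mu> * s"
    and y: "poly (map_poly \<phi> \<mu>) y = 0"
  shows "\<exists>\<psi>. fhom (adjoin F {x}) \<psi> \<and> (\<forall>a \<in> F. \<psi> a = \<phi> a) \<and> \<psi> x = y"
proof -
  note cl = polys_over_closed[OF F] and m = map_poly_fhom[OF \<phi> F] and h = fhomD[OF \<phi> F]
  have R: "adjoin F {x} = {poly q x |q. q \<in> polys_over F}" by (rule adjoin_simple[OF F \<mu>])
  define \<psi> where "\<psi> z = poly (map_poly \<phi> (SOME q. q \<in> polys_over F \<and> poly q x = z)) y" for z
  have \<psi>: "\<psi> (poly q x) = poly (map_poly \<phi> q) y" if q: "q \<in> polys_over F" for q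
  proof -
    define q' where "q' = (SOME q'. q' \<in> polys_over F \<and> poly q' x = poly q x)"
    have q': "q' \<in> polys_over F \<and> poly q' x = poly q x"
      unfolding q'_def by (rule someI[of _ q]) (use q in auto)
    hence "q' - q \<in> polys_over F" "poly (q' - q) x = 0" using q cl by auto
    then obtain s where s: "s \<in> polys_over F" "q' - q = \<mu> * s" using min by blast
    have "map_poly \<phi> q' - map_poly \<phi> q = map_poly \<phi> \<mu> * map_poly \<phi> s"
      using q q' s(1) \<mu>(1) by (simp add: m(2)[symmetric] m(3)[symmetric] s(2))
    hence "poly (map_poly \<phi> q' - map_poly \<phi> q) y = 0" using y by simp
    thus ?thesis by (simp add: \<psi>_def q'_def)
  qed
  have const: "\<psi> a = \<phi> a" if "a \<in> F" for a
    using \<psi>[OF cl(8)[OF that, of 0]] by (simp add: monom_0 map_poly_pCons h)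
  have "\<psi> x = y"
    using \<psi>[OF cl(9)[OF cl(2) subfldD(1)[OF F]]] by (simp add: one_pCons map_poly_pCons h)
  moreover have "fhom (adjoin F {x}) \<psi>"
    unfolding fhom_def
  proof (intro conjI ballI)
    show "\<psi> 1 = 1" using const[OF subfldD(2)[OF F]] h by simp
    fix u v assume "u \<in> adjoin F {x}" "v \<in> adjoin F {x}"
    then obtain a b where ab: "a \<in> polys_over F" "b \<in> polys_over F" "u = poly a x" "v = poly b x"
      unfolding R by blast
    show "\<psi> (u + v) = \<psi> u + \<psi> v" using ab \<psi>[OF cl(3)[OF ab(1,2)]] \<psi> m(1) by simp
    show "\<psi> (u * v) = \<psi> u * \<psi> v" using ab \<psi>[OF cl(5)[OF ab(1,2)]] \<psi> m(3) by simp
  qed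
  ultimately show ?thesis using const by blast
qed

text \<open>
  The elements of \<open>Z\<close> are adjoined one at a time; the minimal polynomial of the next one divides \<open>p\<close>,
  so its image has a root. The hypothesis on divisors says that the image of \<open>p\<close> splits. It
  covers two kinds of target: an algebraically closed field, and the field of Laurent series, where
  only this one polynomial is known to split.
\<close>

lemma extend_hom:
  assumes "finite Z" and F: "subfld F" and \<phi>: "fhom F \<phi>"
    and p: "p \<in> polys_over F" "p \<noteq> 0" "\<And>z. z \<in> Z \<Longrightarrow> poly p z = 0"
    and roots: "\<And>u. u dvd map_poly \<phi> p \<Longrightarrow> degree u > 0 \<Longrightarrow> \<exists>y. poly u y = 0"
  shows "\<exists>\<psi>. fhom (adjoin F Z) \<psi> \<and> (\<forall>a \<in> F. \<psi> a = \<phi> a)"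
  using assms(1) p(3)
proof (induction Z rule: finite_induct)
  case empty
  thus ?case using \<phi> adjoin_empty[OF F] by auto
next
  case (insert z Z)
  let ?E = "adjoin F Z"
  obtain \<psi> where \<psi>: "fhom ?E \<psi>" "\<forall>a \<in> F. \<psi> a = \<phi> a" using insert by auto
  have E: "subfld ?E" by (rule subfld_adjoin)
  have pE: "p \<in> polys_over ?E" using p(1) adjoin_base polys_over_mono by blast
  have pz: "poly p z = 0" using insert by auto
  obtain \<mu> where \<mu>: "\<mu> \<in> polys_over ?E" "lead_coeff \<mu> = 1" "poly \<mu> z = 0"
    and min: "\<And>q. q \<in> polys_over ?E \<Longrightarrow> poly q z = 0 \<Longrightarrow> \<exists>s \<in> polys_over ?E. q = \<mu> * s"
    using min_poly_exists[OF E pE p(2) pz] by blast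
  have \<mu>0: "\<mu> \<noteq> 0" using \<mu>(2) by auto
  have "degree \<mu> > 0"
  proof (rule ccontr)
    assume "\<not> degree \<mu> > 0"
    then obtain c where "\<mu> = [:c:]" by (metis degree_eq_zeroE gr0I)
    thus False using \<mu>(2,3) by simp
  qed
  hence deg: "degree (map_poly \<psi> \<mu>) > 0" using degree_map_poly_fhom[OF \<psi>(1) E \<mu>(1)] by simp
  obtain s where s: "s \<in> polys_over ?E" "p = \<mu> * s" using min[OF pE pz] by blast
  have "map_poly \<phi> p = map_poly \<psi> p"
    using \<psi>(2) p(1) fhomD(4)[OF \<phi> F] fhomD(4)[OF \<psi>(1) E]
    by (intro poly_eqI) (simp add: coeff_map_poly polys_over_coeff)
  hence "map_poly \<psi> \<mu> dvd map_poly \<phi> p" using map_poly_fhom(3)[OF \<psi>(1) E \<mu>(1) s(1)] s(2) by simp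
  from roots[OF this deg] obtain y where y: "poly (map_poly \<psi> \<mu>) y = 0" by blast
  obtain \<chi> where "fhom (adjoin ?E {z}) \<chi>" "\<forall>a \<in> ?E. \<chi> a = \<psi> a"
    using extend_hom_min_poly[OF E \<psi>(1) \<mu>(1) \<mu>0 \<mu>(3) min y] by blast
  moreover have "adjoin ?E {z} = adjoin F (insert z Z)" by (simp add: adjoin_adjoin)
  ultimately show ?case using \<psi>(2) adjoin_base[of F Z] by (metis subsetD)
qed

lemma fhom_image_subset:
  assumes \<psi>: "fhom (adjoin F Z) \<psi>" and L: "subfld L" and "\<psi> ` F \<subseteq> L" "\<psi> ` Z \<subseteq> L"
  shows "\<psi> ` adjoin F Z \<subseteq> L"
proof -
  let ?S = "{x \<in> adjoin F Z. \<psi> x \<in> L}"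
  have "subfld ?S"
    unfolding subfld_def using subfldD[OF subfld_adjoin[of F Z]] subfldD[OF L] fhomD[OF \<psi> subfld_adjoin]
    by auto
  hence "adjoin F Z \<subseteq> ?S"
    using assms(3,4) adjoin_base[of F Z] adjoin_gens[of Z F] by (intro adjoin_least) auto
  thus ?thesis by auto
qed

lemma fhom_eq_on_adjoin:
  assumes "fhom (adjoin F Z) \<psi>" "fhom (adjoin F Z) \<chi>" "\<And>x. x \<in> F \<union> Z \<Longrightarrow> \<psi> x = \<chi> x" "x \<in> adjoin F Z"
  shows "\<psi> x = \<chi> x"
proof -
  let ?S = "{x \<in> adjoin F Z. \<psi> x = \<chi> x}"
  have "subfld ?S"
    unfolding subfld_def using subfldD[OF subfld_adjoin[of F Z]]
      fhomD[OF assms(1) subfld_adjoin] fhomD[OF assms(2) subfld_adjoin] by auto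
  hence "adjoin F Z \<subseteq> ?S"
    using assms(3) adjoin_base[of F Z] adjoin_gens[of Z F] by (intro adjoin_least) auto
  thus ?thesis using assms(4) by auto
qed


section \<open>Polynomials with prescribed simple roots\<close>

definition roots_poly :: "'a :: field set \<Rightarrow> 'a poly" where
  "roots_poly W = (\<Prod>w\<in>W. [:- w, 1:])"

lemma degree_roots_poly: "degree (roots_poly W) = card W"
  unfolding roots_poly_def
  by (induction W rule: infinite_finite_induct) (auto simp: degree_mult_eq simp del: mult_pCons_left)

lemma roots_poly_nonzero [simp]: "roots_poly W \<noteq> 0"
  unfolding roots_poly_def by (induction W rule: infinite_finite_induct) (auto simp del: mult_pCons_left)

lemma lead_coeff_roots_poly: "lead_coeff (roots_poly W) = 1"
  unfolding roots_poly_def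
  by (induction W rule: infinite_finite_induct) (auto simp: lead_coeff_mult simp del: mult_pCons_left)

lemma poly_roots_poly: "finite W \<Longrightarrow> poly (roots_poly W) x = 0 \<longleftrightarrow> x \<in> W"
  unfolding roots_poly_def by (auto simp: poly_prod)

lemma roots_poly_insert: "finite W \<Longrightarrow> w \<notin> W \<Longrightarrow> roots_poly (insert w W) = [:- w, 1:] * roots_poly W"
  unfolding roots_poly_def by simp

lemma roots_poly_over: "subfld F \<Longrightarrow> W \<subseteq> F \<Longrightarrow> roots_poly W \<in> polys_over F"
  unfolding roots_poly_def
  by (rule polys_over_prod) (auto simp: subfldD intro!: polys_over_closed subfldD)

lemma roots_poly_dvd:
  assumes "finite W" "\<And>w. w \<in> W \<Longrightarrow> poly p w = 0"
  shows "roots_poly W dvd p"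
  using assms
proof (induction W arbitrary: p rule: finite_induct)
  case (insert w W)
  then obtain r where r: "p = [:- w, 1:] * r" by (metis dvdE insertI1 poly_eq_0_iff_dvd)
  have "poly r v = 0" if "v \<in> W" for v
    using insert.prems[of v] that insert.hyps r by auto
  hence "roots_poly W dvd r" by (rule insert.IH)
  thus ?case using insert.hyps r by (simp add: roots_poly_insert mult_dvd_mono del: mult_pCons_left)
qed (simp add: roots_poly_def)

lemma roots_poly_unique:
  assumes "finite W" "\<And>w. w \<in> W \<Longrightarrow> poly p w = 0" "lead_coeff p = 1" "degree p = card W"
  shows "p = roots_poly W"
proof -
  obtain s where s: "p = roots_poly W * s" using roots_poly_dvd[OF assms(1,2)] by blast
  have "s \<noteq> 0" using s assms(3) by auto
  hence "degree s = 0" using s assms(4) by (simp add: degree_mult_eq degree_roots_poly)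
  then obtain c where "s = [:c:]" by (metis degree_eq_zeroE)
  moreover have "lead_coeff s = 1" using s assms(3) by (simp add: lead_coeff_mult lead_coeff_roots_poly)
  ultimately show ?thesis using s by simp
qed

lemma pderiv_roots_poly_nonzero:
  assumes "finite W" "w \<in> W"
  shows "poly (pderiv (roots_poly W)) w \<noteq> 0"
proof -
  have "roots_poly W = [:- w, 1:] * roots_poly (W - {w})"
    using assms roots_poly_insert[of "W - {w}" w] by (simp add: insert_absorb)
  hence "poly (pderiv (roots_poly W)) w = poly (roots_poly (W - {w})) w"
    by (simp add: pderiv_mult pderiv_pCons del: mult_pCons_left)
  thus ?thesis using assms by (simp add: poly_roots_poly)
qed

text \<open>
  If no root of the product is a root of \<open>u\<close>, every linear factor divides the cofactor and can be
  cancelled, until \<open>u\<close> divides 1.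
\<close>

lemma split_roots_poly_divisor_has_root:
  assumes "finite W" "u dvd roots_poly W" "degree u > 0"
  shows "\<exists>y. poly u y = 0"
  using assms
proof (induction W arbitrary: u rule: finite_induct)
  case empty
  thus ?case by (metis degree_1 dvd_imp_degree_le leD one_neq_zero prod.empty roots_poly_def)
next
  case (insert w W)
  obtain s where s: "roots_poly (insert w W) = u * s" using insert.prems by blast
  have "poly u w * poly s w = 0"
    using poly_roots_poly[of "insert w W" w] insert.hyps by (simp add: s)
  moreover {
    assume "poly s w = 0"
    then obtain s' where s': "s = [:- w, 1:] * s'" by (metis dvdE poly_eq_0_iff_dvd)
    have "[:- w, 1:] * roots_poly W = [:- w, 1:] * (u * s')"
      using s unfolding s' roots_poly_insert[OF insert.hyps(1,2)] by (simp only: mult.left_commute)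
    hence "roots_poly W = u * s'" by (subst (asm) mult_cancel_left) auto
    hence ?case using insert.IH insert.prems by auto
  }
  ultimately show ?case by auto
qed

lemma map_poly_roots_poly:
  assumes "fhom F \<phi>" "subfld F" "finite W" "W \<subseteq> F" "inj_on \<phi> W"
  shows "map_poly \<phi> (roots_poly W) = roots_poly (\<phi> ` W)"
  using assms(3-5)
proof (induction W rule: finite_induct)
  case empty
  show ?case using fhomD[OF assms(1,2)] by (simp add: roots_poly_def)
next
  case (insert w W)
  have "[:- w, 1:] \<in> polys_over F" "roots_poly W \<in> polys_over F"
    using insert assms(2) roots_poly_over[of F "{w}"] roots_poly_over[of F W]
    by (auto simp: roots_poly_def)
  from map_poly_fhom(3)[OF assms(1,2) this]
  have "map_poly \<phi> (roots_poly (insert w W)) = map_poly \<phi> [:- w, 1:] * map_poly \<phi> (roots_poly W)"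
    using insert.hyps by (simp add: roots_poly_insert del: mult_pCons_left)
  also have "map_poly \<phi> [:- w, 1:] = [:- \<phi> w, 1:]"
    using insert.prems by (simp add: map_poly_pCons fhomD[OF assms(1,2)])
  finally show ?case using insert
    by (simp add: roots_poly_insert inj_on_insert del: mult_pCons_left)
qed

text \<open>
  Divide \<open>p\<close> by the product over its distinct roots. A root of the quotient would be a multiple
  root of \<open>p\<close>, so the quotient is constant.
\<close>

lemma alg_closed_separable:
  fixes p :: "'a :: alg_closed_field poly"
  assumes p0: "p \<noteq> 0" and sep: "\<And>x. poly p x = 0 \<Longrightarrow> poly (pderiv p) x \<noteq> 0"
  shows "finite {x. poly p x = 0}" "card {x. poly p x = 0} = degree p"
proof -
  let ?R = "{x. poly p x = 0}"
  show fin: "finite ?R" using p0 by (rule poly_roots_finite)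
  obtain s where s: "p = roots_poly ?R * s" using roots_poly_dvd[OF fin, of p] by blast
  have "degree s = 0"
  proof (rule ccontr)
    assume "degree s \<noteq> 0"
    then obtain x where x: "poly s x = 0" using alg_closed_imp_poly_has_root[of s] by auto
    have px: "poly p x = 0" using x arg_cong[OF s, of "\<lambda>u. poly u x"] by simp
    hence rx: "poly (roots_poly ?R) x = 0" using fin by (simp add: poly_roots_poly)
    have "pderiv p = roots_poly ?R * pderiv s + s * pderiv (roots_poly ?R)"
      using s by (metis pderiv_mult add.commute mult.commute)
    hence "poly (pderiv p) x = 0" using x rx by simp
    thus False using sep px by blast
  qed
  moreover have "s \<noteq> 0" using s p0 by auto
  ultimately show "card ?R = degree p"
    using arg_cong[OF s, of degree] by (simp add: degree_mult_eq degree_roots_poly)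
qed


section \<open>The Frobenius map of a finite field\<close>

lemma finite_field_power_card:
  fixes a :: "'q :: {field, finite}"
  shows "a ^ CARD('q) = a"
proof (cases "a = 0")
  case False
  have "bij_betw ((*) a) (UNIV - {0}) (UNIV - {0})"
    by (rule bij_betw_byWitness[of _ "\<lambda>x. x / a"]) (use False in auto)
  from prod.reindex_bij_betw[OF this, of id]
  have "a ^ (CARD('q) - 1) * (\<Prod>x\<in>UNIV - {0}. x) = (\<Prod>x\<in>UNIV - {0 :: 'q}. x)"
    by (simp add: prod.distrib)
  hence "a ^ (CARD('q) - 1) = 1" by simp
  moreover have "CARD('q) > 0" by simp
  ultimately show ?thesis by (metis mult.right_neutral power_minus_mult mult.left_neutral)
qed simp

lemma card_finite_field_gt_1: "CARD('q :: {field, finite}) > 1"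
proof -
  have "card {0, 1 :: 'q} \<le> CARD('q)" by (rule card_mono) auto
  thus ?thesis by simp
qed

lemma of_nat_card_finite_field: "of_nat CARD('q) = (0 :: 'q :: {field, finite})"
proof -
  have "bij (\<lambda>a :: 'q. a + 1)"
    by (rule bij_betw_byWitness[of _ "\<lambda>x. x - 1"]) auto
  from sum.reindex_bij_betw[OF this, of id] show ?thesis by (simp add: sum.distrib)
qed

abbreviation frob :: "'q :: {field, finite} alg_closure \<Rightarrow> 'q alg_closure" where
  "frob x \<equiv> x ^ CARD('q)"

lemma frob_to_ac [simp]: "frob (to_ac a) = to_ac (a :: 'q :: {field, finite})"
  by (metis finite_field_power_card to_ac_power)

text \<open>
  Both sides are monic of degree \<open>q\<close> in \<open>x\<close> and vanish on the \<open>q\<close> elements of the finite field.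
\<close>

lemma frob_minus_id:
  fixes x :: "'q :: {field, finite} alg_closure"
  shows "frob x - x = (\<Prod>a\<in>range to_ac. x - a)"
proof -
  let ?P = "monom 1 CARD('q) - [:0, 1 :: 'q alg_closure:]"
  let ?R = "range (to_ac :: 'q \<Rightarrow> _)"
  have card: "card ?R = CARD('q)" by (rule card_image) (rule inj_to_ac)
  have coeff: "coeff ?P CARD('q) = 1"
    using card_finite_field_gt_1[where ?'q = 'q] by (auto simp: coeff_pCons split: nat.split)
  have "degree ?P \<le> CARD('q)"
    using card_finite_field_gt_1[where ?'q = 'q]
    by (intro degree_diff_le) (auto simp: degree_monom_eq)
  hence deg: "degree ?P = CARD('q)" using coeff by (intro antisym le_degree) auto
  have "?P = roots_poly ?R"
    using coeff deg card by (intro roots_poly_unique) (auto simp: poly_monom simp del: to_ac_power)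
  from arg_cong[OF this, of "\<lambda>p. poly p x"] show ?thesis
    by (simp add: poly_monom roots_poly_def poly_prod)
qed

lemma frob_fixed:
  assumes "frob x = (x :: 'q :: {field, finite} alg_closure)"
  shows "x \<in> range to_ac"
proof -
  have "(\<Prod>a\<in>range to_ac. x - a) = 0" using frob_minus_id[of x] assms by simp
  thus ?thesis by (auto simp: prod_zero_iff)
qed

text \<open>
  By the product formula for \<open>frob x - x\<close>, translation by an element \<open>b\<close> of the finite field gives
  \<open>frob (x + b) = frob x + frob b\<close>. For fixed \<open>x\<close>, the difference of the two
  sides is a polynomial in \<open>y\<close> of degree less than \<open>q\<close>, and it has these \<open>q\<close> roots.
\<close>

lemma frob_add:
  fixes x y :: "'q :: {field, finite} alg_closure"
  shows "frob (x + y) = frob x + frob y"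
proof -
  let ?R = "range (to_ac :: 'q \<Rightarrow> _)"
  have translate: "frob (x + b) = frob x + frob b" if b: "b \<in> ?R" for b
  proof -
    have "bij_betw (\<lambda>a. a - b) ?R ?R"
      using b by (intro bij_betw_byWitness[of _ "\<lambda>a. a + b"])
        (auto simp flip: to_ac_add to_ac_diff)
    from prod.reindex_bij_betw[OF this, of "\<lambda>a. x - a"]
    have "(\<Prod>a\<in>?R. x + b - a) = (\<Prod>a\<in>?R. x - a)" by (simp add: algebra_simps)
    moreover have "frob b = b" using b by auto
    ultimately show ?thesis using frob_minus_id[of "x + b"] frob_minus_id[of x]
      by (simp add: algebra_simps)
  qed
  \<comment> \<open>the defect of additivity as a polynomial in \<open>y\<close>\<close>
  define h where "h = [:x, 1:] ^ CARD('q) - [:frob x:] - monom 1 CARD('q)"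
  have poly_h: "poly h z = frob (x + z) - frob x - frob z" for z
    by (simp add: h_def poly_monom)
  have "h = 0"
  proof (rule ccontr)
    assume h0: "h \<noteq> 0"
    have lp: "degree ([:x, 1:] ^ CARD('q)) = CARD('q)" "coeff ([:x, 1:] ^ CARD('q)) CARD('q) = 1"
      using lead_coeff_power[of "[:x, 1:]" "CARD('q)"] unfolding degree_linear_power by auto
    have "degree h \<le> CARD('q)" unfolding h_def
      by (intro degree_diff_le) (auto simp: lp degree_monom_eq)
    moreover have "coeff h CARD('q) = 0"
      using lp card_finite_field_gt_1[where ?'q = 'q]
      by (auto simp: h_def coeff_pCons split: nat.split)
    ultimately have "degree h < CARD('q)" using h0
      by (metis leading_coeff_0_iff le_neq_implies_less)
    moreover have "card ?R \<le> card {z. poly h z = 0}"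
      using h0 translate by (intro card_mono poly_roots_finite) (auto simp: poly_h simp del: to_ac_power)
    moreover have "card {z. poly h z = 0} \<le> degree h" using h0 by (rule card_poly_roots_bound)
    ultimately show False using card_image[OF inj_to_ac] by (metis leD le_trans)
  qed
  thus ?thesis using poly_h[of y] by (simp add: algebra_simps)
qed

lemma fhom_frob: "fhom UNIV (frob :: 'q :: {field, finite} alg_closure \<Rightarrow> _)"
  unfolding fhom_def by (simp add: frob_add power_mult_distrib)

lemma subfld_UNIV: "subfld UNIV"
  by (simp add: subfld_def)

lemma frob_inj: "inj (frob :: 'q :: {field, finite} alg_closure \<Rightarrow> _)"
  by (rule fhom_inj_on[OF fhom_frob subfld_UNIV])

text \<open>
  Frobenius permutes \<open>W\<close>, so it fixes the coefficients of the product, and its fixed points are the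
  elements of the finite field.
\<close>

lemma frob_stable_roots_poly:
  fixes W :: "'q :: {field, finite} alg_closure set"
  assumes "finite W" "frob ` W \<subseteq> W"
  obtains f :: "'q poly" where "map_poly to_ac f = roots_poly W"
proof -
  have inj: "inj_on frob W" using frob_inj by (rule inj_on_subset) auto
  have "frob ` W = W" using assms inj by (simp add: endo_inj_surj)
  hence "map_poly frob (roots_poly W) = roots_poly W"
    using map_poly_roots_poly[OF fhom_frob subfld_UNIV assms(1) _ inj] by simp
  hence "frob (coeff (roots_poly W) i) = coeff (roots_poly W) i" for i
    by (metis coeff_map_poly power_0_left card_finite_field_gt_1 not_one_less_zero)
  hence c: "coeff (roots_poly W) i \<in> range to_ac" for i by (rule frob_fixed)
  have "map_poly to_ac (map_poly of_ac (roots_poly W)) = roots_poly W"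
    by (rule poly_eqI) (simp add: coeff_map_poly to_ac_of_ac[OF c] of_ac_eqI)
  thus ?thesis by (rule that)
qed

text \<open>
  The polynomial \<open>X\<^sup>N - X\<close> with \<open>N = q\<^sup>d\<close> has derivative \<open>-1\<close>, so its roots are simple.
\<close>

lemma card_frob_power_fixed:
  fixes d :: nat
  assumes "d > 0"
  defines "P \<equiv> {x :: 'q :: {field, finite} alg_closure. x ^ (CARD('q) ^ d) = x}"
  shows "finite P" "card P = CARD('q) ^ d"
proof -
  let ?N = "CARD('q) ^ d"
  let ?p = "monom 1 ?N - [:0, 1 :: 'q alg_closure:]"
  have N1: "?N > 1" by (rule one_less_power[OF card_finite_field_gt_1 assms(1)])
  have coeff: "coeff ?p ?N = 1" using N1 assms(1) by (auto simp: coeff_pCons split: nat.split)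
  have deg: "degree ?p = ?N"
    using coeff N1 assms(1) by (intro antisym le_degree degree_diff_le) (auto simp: degree_monom_eq)
  have p0: "?p \<noteq> 0" using coeff by (metis coeff_0 zero_neq_one)
  have "(of_nat CARD('q) :: 'q alg_closure) = 0"
    using arg_cong[OF of_nat_card_finite_field[where ?'q = 'q], of to_ac] by simp
  hence "(of_nat ?N :: 'q alg_closure) = 0" using assms(1) by simp
  hence "pderiv ?p = [:- 1:]"
    using assms(1) by (simp add: pderiv_diff pderiv_monom pderiv_pCons zero_power)
  hence sep: "poly (pderiv ?p) x \<noteq> 0" for x by simp
  have P: "P = {x. poly ?p x = 0}" by (simp add: P_def poly_monom)
  show "finite P" "card P = ?N"
    using alg_closed_separable[OF p0 sep] deg unfolding P by simp_all
qed

text \<open>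
  Counting: the elements of period less than \<open>d\<close> number at most \<open>q + q\<^sup>2 + \<dots>\<close> up to exponent
  \<open>d - 1\<close>, which is less than \<open>q\<^sup>d\<close>.
\<close>

lemma exact_frob_period_exists:
  assumes "d > 0"
  obtains \<omega> :: "'q :: {field, finite} alg_closure" where "\<omega> ^ (CARD('q) ^ d) = \<omega>"
    "\<And>e. 0 < e \<Longrightarrow> e < d \<Longrightarrow> \<omega> ^ (CARD('q) ^ e) \<noteq> \<omega>" "\<omega> \<noteq> 0"
proof (cases "d = 1")
  case True
  thus ?thesis using that[of 1] by auto
next
  case False
  let ?P = "\<lambda>e. {x :: 'q alg_closure. x ^ (CARD('q) ^ e) = x}"
  let ?q = "CARD('q)"
  have q: "?q \<ge> 2" using card_finite_field_gt_1[where ?'q = 'q] by simp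
  have geom: "(\<Sum>e\<in>{1..<n}. ?q ^ e) < ?q ^ n" for n
  proof (induction n)
    case (Suc n)
    show ?case
    proof (cases "n = 0")
      case False
      hence "(\<Sum>e\<in>{1..<Suc n}. ?q ^ e) = (\<Sum>e\<in>{1..<n}. ?q ^ e) + ?q ^ n" by simp
      also have "\<dots> < 2 * ?q ^ n" using Suc by simp
      also have "\<dots> \<le> ?q ^ Suc n" using q by simp
      finally show ?thesis .
    qed (use q in auto)
  qed simp
  have "card (\<Union>e\<in>{1..<d}. ?P e) \<le> (\<Sum>e\<in>{1..<d}. card (?P e))" by (rule card_UN_le) simp
  also have "\<dots> = (\<Sum>e\<in>{1..<d}. ?q ^ e)" by (intro sum.cong card_frob_power_fixed) auto
  also have "\<dots> < card (?P d)" using geom[of d] card_frob_power_fixed(2)[OF assms, where ?'q = 'q] by simp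
  finally have lt: "card (\<Union>e\<in>{1..<d}. ?P e) < card (?P d)" .
  have "finite (\<Union>e\<in>{1..<d}. ?P e)"
    using card_frob_power_fixed(1)[where ?'q = 'q] by fastforce
  hence "\<not> ?P d \<subseteq> (\<Union>e\<in>{1..<d}. ?P e)" using card_mono[of "\<Union>e\<in>{1..<d}. ?P e" "?P d"] lt by linarith
  then obtain \<omega> where \<omega>: "\<omega> \<in> ?P d" "\<And>e. e \<in> {1..<d} \<Longrightarrow> \<omega> \<notin> ?P e" by blast
  have "\<omega> \<noteq> 0"
    using \<omega>(2)[of 1] False assms by (auto simp: power_0_left)
  thus ?thesis using that[of \<omega>] \<omega> by auto
qed

lemma frob_orbit_exists:
  assumes "d > 0"
  obtains W :: "'q :: {field, finite} alg_closure set" where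
    "finite W" "card W = d" "frob ` W \<subseteq> W" "0 \<notin> W"
    "\<And>x. x \<in> W \<Longrightarrow> x ^ (CARD('q) ^ d) = x"
    "\<And>x y. x \<in> W \<Longrightarrow> y \<in> W \<Longrightarrow> \<exists>n. x ^ (CARD('q) ^ n) = y"
proof -
  let ?q = "CARD('q)"
  obtain \<omega> :: "'q alg_closure" where \<omega>: "\<omega> ^ (?q ^ d) = \<omega>"
    "\<And>e. 0 < e \<Longrightarrow> e < d \<Longrightarrow> \<omega> ^ (?q ^ e) \<noteq> \<omega>" "\<omega> \<noteq> 0"
    using exact_frob_period_exists[OF assms] by metis
  have pw: "(x ^ (?q ^ i)) ^ (?q ^ j) = x ^ (?q ^ (i + j))" for x :: "'q alg_closure" and i j
    by (simp add: power_mult power_add)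
  have injp: "x = y" if "x ^ (?q ^ i) = y ^ (?q ^ i)" for x y :: "'q alg_closure" and i
    using that
  proof (induction i)
    case (Suc i)
    hence "frob (x ^ (?q ^ i)) = frob (y ^ (?q ^ i))" by (simp add: power_mult[symmetric] ac_simps)
    thus ?case using Suc.IH frob_inj by (auto dest: injD)
  qed simp
  define W where "W = (\<lambda>i. \<omega> ^ (?q ^ i)) ` {..<d}"
  have inj: "inj_on (\<lambda>i. \<omega> ^ (?q ^ i)) {..<d}"
  proof (rule linorder_inj_onI')
    fix i j assume ij: "i \<in> {..<d}" "j \<in> {..<d}" "i < j"
    show "\<omega> ^ (?q ^ i) \<noteq> \<omega> ^ (?q ^ j)"
    proof
      assume eq: "\<omega> ^ (?q ^ i) = \<omega> ^ (?q ^ j)"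
      have "\<omega> ^ (?q ^ j) = (\<omega> ^ (?q ^ (j - i))) ^ (?q ^ i)" using ij by (simp add: pw)
      hence "\<omega> ^ (?q ^ i) = (\<omega> ^ (?q ^ (j - i))) ^ (?q ^ i)" by (rule trans[OF eq])
      hence eq': "\<omega> ^ (?q ^ (j - i)) = \<omega>" by (rule injp[THEN sym])
      have "0 < j - i" "j - i < d" using ij by auto
      hence "\<omega> ^ (?q ^ (j - i)) \<noteq> \<omega>" by (rule \<omega>(2))
      thus False using eq' by contradiction
    qed
  qed
  have per: "\<omega> ^ (?q ^ (k * d + i)) = \<omega> ^ (?q ^ i)" for k i
    by (induction k) (simp_all add: \<omega>(1) pw[symmetric] add.assoc)
  have mem: "\<omega> ^ (?q ^ i) \<in> W" for i
    using per[of "i div d" "i mod d"] assms unfolding W_def by (auto intro!: image_eqI[of _ _ "i mod d"])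
  have fr: "frob (\<omega> ^ (?q ^ i)) = \<omega> ^ (?q ^ Suc i)" for i using pw[of \<omega> i 1] by simp
  show ?thesis
  proof (rule that[of W])
    show "finite W" by (simp add: W_def)
    show "card W = d" unfolding W_def using card_image[OF inj] by simp
    show "0 \<notin> W" using \<omega>(3) by (auto simp: W_def)
    have "frob (\<omega> ^ (?q ^ i)) \<in> W" for i by (subst fr) (rule mem)
    thus "frob ` W \<subseteq> W" by (auto simp: W_def)
    show "x ^ (?q ^ d) = x" if "x \<in> W" for x
    proof -
      obtain i where "x = \<omega> ^ (?q ^ i)" using \<open>x \<in> W\<close> by (auto simp: W_def)
      thus ?thesis using per[of 1 i] pw[of \<omega> i d] by (simp add: add.commute)
    qed
    show "\<exists>n. x ^ (?q ^ n) = y" if xy: "x \<in> W" "y \<in> W" for x y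
    proof -
      obtain i j where ij: "x = \<omega> ^ (?q ^ i)" "y = \<omega> ^ (?q ^ j)" "i < d" using xy by (auto simp: W_def)
      have "x ^ (?q ^ (d - i + j)) = \<omega> ^ (?q ^ (1 * d + j))"
        unfolding ij pw using ij(3) by (simp add: add.assoc)
      thus ?thesis unfolding per ij(2) by blast
    qed
  qed
qed


section \<open>Hensel's lemma for power series\<close>

lemma poly_taylor_second_order:
  fixes p :: "'a :: idom poly"
  shows "\<exists>r. poly p (x + h) = poly p x + h * poly (pderiv p) x + h ^ 2 * r"
proof (induction p)
  case (pCons a p)
  then obtain r where r: "poly p (x + h) = poly p x + h * poly (pderiv p) x + h ^ 2 * r" by blast
  have "poly (pCons a p) (x + h) = a + (x + h) * (poly p x + h * poly (pderiv p) x + h ^ 2 * r)"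
    by (simp only: poly_pCons r)
  also have "\<dots> = poly (pCons a p) x + h * poly (pderiv (pCons a p)) x +
      h ^ 2 * (poly (pderiv p) x + (x + h) * r)"
    by (simp add: pderiv_pCons algebra_simps power2_eq_square)
  finally show ?case by blast
qed simp

lemma fps_X_power_dvdI:
  assumes "\<And>i. i < k \<Longrightarrow> fps_nth u i = 0"
  shows "fps_X ^ k dvd (u :: 'a :: comm_ring_1 fps)"
proof
  show "u = fps_X ^ k * fps_shift k u"
    using assms by (intro fps_ext) (auto simp: fps_X_power_mult_nth)
qed

lemma fps_X_power_dvdD: "fps_X ^ k dvd (u :: 'a :: comm_ring_1 fps) \<Longrightarrow> i < k \<Longrightarrow> fps_nth u i = 0"
  by (auto simp: fps_X_power_mult_nth elim!: dvdE)

lemma fps_nth_0_poly: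
  fixes p :: "'a :: comm_ring_1 fps poly"
  shows "fps_nth (poly p s) 0 = poly (map_poly (\<lambda>u. fps_nth u 0) p) (fps_nth s 0)"
  by (induction p) (auto simp: map_poly_pCons)

lemma map_poly_fps_nth_0_pderiv:
  fixes p :: "'a :: field fps poly"
  shows "map_poly (\<lambda>u. fps_nth u 0) (pderiv p) = pderiv (map_poly (\<lambda>u. fps_nth u 0) p)"
  by (rule poly_eqI) (simp add: coeff_map_poly coeff_pderiv del: of_nat_Suc)

text \<open>
  Newton iteration from the constant series \<open>w\<close>. By the second-order Taylor formula each step
  gains at least one correct coefficient, and the derivative stays a unit because its constant term
  does. The limit is taken coefficientwise.
\<close>

lemma hensel_fps:
  fixes g :: "'a :: field fps poly"
  assumes root: "poly (map_poly (\<lambda>u. fps_nth u 0) g) w = 0"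
    and simple: "poly (pderiv (map_poly (\<lambda>u. fps_nth u 0) g)) w \<noteq> 0"
  obtains s where "fps_nth s 0 = w" "poly g s = 0"
proof -
  define step where "step s = - (poly g s * inverse (poly (pderiv g) s))" for s
  define S where "S n = ((\<lambda>s. s + step s) ^^ n) (fps_const w)" for n
  have S0: "S 0 = fps_const w" and SS: "S (Suc n) = S n + step (S n)" for n
    by (simp_all add: S_def)
  have inv: "fps_nth (S n) 0 = w \<and> fps_X ^ Suc n dvd poly g (S n)" for n
  proof (induction n)
    case 0
    show ?case
      unfolding S0 by (intro conjI fps_X_power_dvdI) (auto simp: fps_nth_0_poly root)
  next
    case (Suc n)
    let ?h = "step (S n)"
    have h: "fps_X ^ Suc n dvd ?h" using Suc unfolding step_def by simp
    have const: "fps_nth (S (Suc n)) 0 = w" using Suc fps_X_power_dvdD[OF h, of 0] by (simp add: SS)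
    have "fps_nth (poly (pderiv g) (S n)) 0 \<noteq> 0"
      using Suc simple by (simp add: fps_nth_0_poly map_poly_fps_nth_0_pderiv)
    hence "inverse (poly (pderiv g) (S n)) * poly (pderiv g) (S n) = 1" by (rule inverse_mult_eq_1)
    hence cancel: "poly g (S n) + ?h * poly (pderiv g) (S n) = 0"
      unfolding step_def by (simp add: mult.assoc)
    obtain r where "poly g (S n + ?h) = poly g (S n) + ?h * poly (pderiv g) (S n) + ?h ^ 2 * r"
      using poly_taylor_second_order by blast
    hence "poly g (S (Suc n)) = ?h ^ 2 * r" using cancel by (simp add: SS)
    moreover have "fps_X ^ Suc (Suc n) dvd ?h ^ 2"
    proof (rule dvd_trans)
      show "(fps_X :: 'a fps) ^ Suc (Suc n) dvd fps_X ^ (Suc n * 2)" by (rule le_imp_power_dvd) simp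
      show "fps_X ^ (Suc n * 2) dvd ?h ^ 2" using dvd_power_same[OF h, of 2] by (simp only: power_mult)
    qed
    ultimately have "fps_X ^ Suc (Suc n) dvd poly g (S (Suc n))" by simp
    thus ?case using const by blast
  qed
  have stable: "fps_nth (S (n + k)) i = fps_nth (S n) i" if "i \<le> n" for n k i
  proof (induction k)
    case (Suc k)
    have "fps_X ^ Suc (n + k) dvd step (S (n + k))" using inv[of "n + k"] unfolding step_def by simp
    hence "fps_nth (step (S (n + k))) i = 0" by (rule fps_X_power_dvdD) (use that in simp)
    thus ?case using Suc by (simp add: SS)
  qed simp
  \<comment> \<open>the coefficient of index \<open>n\<close> no longer changes after step \<open>n\<close>\<close>
  define s where "s = Abs_fps (\<lambda>n. fps_nth (S n) n)"
  have close: "fps_X ^ Suc n dvd s - S n" for n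
  proof (rule fps_X_power_dvdI)
    fix i assume "i < Suc n"
    thus "fps_nth (s - S n) i = 0" using stable[of i i "n - i"] by (simp add: s_def)
  qed
  have dvd: "fps_X ^ Suc n dvd poly g s" for n
  proof -
    obtain r where "poly g (S n + (s - S n)) =
        poly g (S n) + (s - S n) * poly (pderiv g) (S n) + (s - S n) ^ 2 * r"
      using poly_taylor_second_order by blast
    hence "poly g s = poly g (S n) + (s - S n) * (poly (pderiv g) (S n) + (s - S n) * r)"
      by (simp add: algebra_simps power2_eq_square)
    moreover have "fps_X ^ Suc n dvd poly g (S n) + (s - S n) * (poly (pderiv g) (S n) + (s - S n) * r)"
      using inv[of n] close[of n] by (intro dvd_add dvd_mult2) auto
    ultimately show ?thesis by simp
  qed
  have "fps_nth (poly g s) n = 0" for n by (rule fps_X_power_dvdD[OF dvd lessI])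
  hence "poly g s = 0" by (intro fps_ext) simp
  moreover have "fps_nth s 0 = w" using inv[of 0] by (simp add: s_def)
  ultimately show ?thesis using that by blast
qed


section \<open>Expanding rational functions at a rational place\<close>

lemma fhom_to_ac: "fhom UNIV to_ac"
  by (simp add: fhom_def)

lemma polys_over_UNIV: "p \<in> polys_over UNIV"
  by (simp add: polys_over_def)

text \<open>
  The expansion of a polynomial at the place \<open>t = c\<close>: the series variable is the local parameter
  \<open>t - c\<close>.
\<close>

definition expand_at :: "'q :: field \<Rightarrow> 'q poly \<Rightarrow> 'q alg_closure fps" where
  "expand_at c p = fps_of_poly (map_poly to_ac (pcompose p [:c, 1:]))"

lemma expand_at_simps:
  "expand_at c 0 = 0" "expand_at c 1 = 1"
  "expand_at c (p + r) = expand_at c p + expand_at c r"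
  "expand_at c (p * r) = expand_at c p * expand_at c r"
  by (simp_all add: expand_at_def pcompose_1 pcompose_add pcompose_mult fps_of_poly_add fps_of_poly_mult
      map_poly_fhom[OF fhom_to_ac subfld_UNIV polys_over_UNIV polys_over_UNIV])

lemma expand_at_eq_0_iff: "expand_at c p = 0 \<longleftrightarrow> p = 0"
proof
  assume "expand_at c p = 0"
  hence "map_poly to_ac (pcompose p [:c, 1:]) = 0"
    unfolding expand_at_def by (metis fps_of_poly_0 fps_of_poly_eq_iff)
  hence "pcompose p [:c, 1:] = 0" by (simp add: map_poly_eq_0_iff)
  thus "p = 0" by (rule pcompose_eq_0) simp
qed (simp add: expand_at_simps)

lemma expand_at_nth_0: "fps_nth (expand_at c p) 0 = to_ac (poly p c)"
proof -
  have "coeff (pcompose p [:c, 1:]) 0 = poly p c"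
    by (metis poly_0_coeff_0 poly_pcompose poly_pCons mult_zero_left add.right_neutral)
  thus ?thesis by (simp add: expand_at_def coeff_map_poly)
qed

lemma expand_at_nth: "fps_nth (expand_at c p) n \<in> range to_ac"
  by (simp add: expand_at_def coeff_map_poly)

text \<open>
  The universal property of the field of fractions, for an injective ring homomorphism to a field.
\<close>

lemma fract_hom_exists:
  fixes h :: "'r :: idom \<Rightarrow> 'b :: field"
  assumes one: "h 1 = 1" and add: "\<And>a b. h (a + b) = h a + h b"
    and mult: "\<And>a b. h (a * b) = h a * h b" and inj: "\<And>a. h a = 0 \<longleftrightarrow> a = 0"
  obtains \<iota> where "fhom UNIV \<iota>" "\<And>a. \<iota> (to_fract a) = h a"
proof -
  define \<iota> where "\<iota> x = (let p = (SOME p. snd p \<noteq> 0 \<and> x = Fract (fst p) (snd p)) in h (fst p) / h (snd p))" for x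
  have \<iota>: "\<iota> (Fract a b) = h a / h b" if b: "b \<noteq> 0" for a b
  proof -
    define p where "p = (SOME p. snd p \<noteq> 0 \<and> Fract a b = Fract (fst p) (snd p))"
    have p: "snd p \<noteq> 0 \<and> Fract a b = Fract (fst p) (snd p)"
      unfolding p_def by (rule someI[of _ "(a, b)"]) (use b in auto)
    hence "a * snd p = fst p * b" using b eq_fract(1)[of b "snd p" a "fst p"] by blast
    hence "h a * h (snd p) = h (fst p) * h b" by (metis mult)
    hence "h a / h b = h (fst p) / h (snd p)" using p b inj by (simp add: frac_eq_eq)
    thus ?thesis by (simp add: \<iota>_def p_def Let_def)
  qed
  have "fhom UNIV \<iota>"
    unfolding fhom_def
  proof (intro conjI ballI)
    show "\<iota> 1 = 1" by (simp add: One_fract_def \<iota> one)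
    fix x y :: "'r fract"
    obtain a b where x: "x = Fract a b" "b \<noteq> 0" by (cases x) auto
    obtain c d where y: "y = Fract c d" "d \<noteq> 0" by (cases y) auto
    show "\<iota> (x + y) = \<iota> x + \<iota> y" using x y inj by (simp add: \<iota> add mult field_simps)
    show "\<iota> (x * y) = \<iota> x * \<iota> y" using x y by (simp add: \<iota> mult)
  qed
  moreover have "\<iota> (to_fract a) = h a" for a by (simp add: to_fract_def \<iota> one)
  ultimately show ?thesis by (rule that)
qed


section \<open>The Frobenius automorphism of Laurent series\<close>

text \<open>
  Frobenius acts on the coefficients and fixes the series variable. Hence it fixes the expansions of
  rational functions over the finite field, which are the elements of the base field inside the
  Laurent series.
\<close>

definition fls_frob :: "'q :: {field, finite} alg_closure fls \<Rightarrow> 'q alg_closure fls" where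
  "fls_frob x = Abs_fls (\<lambda>n. frob (fls_nth x n))"

lemma fls_frob_nth: "fls_nth (fls_frob x) n = frob (fls_nth x n)"
proof -
  have "\<forall>\<^sub>\<infinity>n. frob (fls_nth x (- int n)) = 0"
    using MOST_fls_neg_nth_eq_0[of x] by (rule MOST_mono) simp
  thus ?thesis by (simp add: fls_frob_def)
qed

lemma fls_subdegree_frob: "fls_subdegree (fls_frob x) = fls_subdegree x"
proof (cases "x = 0")
  case True
  hence "fls_frob x = 0" by (intro fls_eqI) (simp add: fls_frob_nth)
  thus ?thesis using True by simp
next
  case False
  thus ?thesis by (intro fls_subdegree_eqI) (simp_all add: fls_frob_nth)
qed

lemma fhom_fls_frob: "fhom UNIV (fls_frob :: 'q :: {field, finite} alg_closure fls \<Rightarrow> _)"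
  unfolding fhom_def
proof (intro conjI ballI)
  show "fls_frob 1 = 1" by (rule fls_eqI) (simp add: fls_frob_nth)
  fix x y :: "'q alg_closure fls"
  show "fls_frob (x + y) = fls_frob x + fls_frob y"
    by (rule fls_eqI) (simp add: fls_frob_nth frob_add)
  show "fls_frob (x * y) = fls_frob x * fls_frob y"
    by (rule fls_eqI) (simp add: fls_frob_nth fls_times_nth(2) fls_subdegree_frob
        fhom_sum[OF fhom_frob subfld_UNIV] power_mult_distrib)
qed


section \<open>Frobenius elements at rational places\<close>

lemma fhom_of_nat: "fhom F \<phi> \<Longrightarrow> subfld F \<Longrightarrow> of_nat n \<in> F \<and> \<phi> (of_nat n) = of_nat n"
  by (induction n) (auto simp: fhomD subfldD)

lemma map_poly_pderiv_fhom:
  assumes "fhom F \<phi>" "subfld F" "p \<in> polys_over F"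
  shows "map_poly \<phi> (pderiv p) = pderiv (map_poly \<phi> p)" "pderiv p \<in> polys_over F"
  using fhom_of_nat[OF assms(1,2)] polys_over_coeff[OF assms(3)] subfldD(4)[OF assms(2)]
  by (auto simp: poly_eq_iff coeff_map_poly coeff_pderiv fhomD[OF assms(1,2)] polys_over_def
      simp del: of_nat_Suc)

lemma subfld_image:
  assumes "fhom F \<phi>" "subfld F"
  shows "subfld (\<phi> ` F)"
  unfolding subfld_def
  using fhomD[OF assms] subfldD[OF assms(2)]
  by (auto simp: image_iff intro!: exI) (metis subfldD[OF assms(2)] fhomD[OF assms])+

text \<open>
  An endomorphism of the image of \<open>\<theta>\<close> is transported to \<open>L\<close> along the embedding \<open>\<theta>\<close>.
\<close>

lemma fhom_inv_into_comp:
  assumes \<theta>: "fhom L \<theta>" and L: "subfld L" and \<chi>: "fhom L \<chi>" and sub: "\<chi> ` L \<subseteq> \<theta> ` L"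
  shows "fhom L (\<lambda>x. inv_into L \<theta> (\<chi> x))"
proof -
  note inj = fhom_inj_on[OF \<theta> L]
  let ?\<tau> = "\<lambda>x. inv_into L \<theta> (\<chi> x)"
  have \<tau>L: "?\<tau> x \<in> L" "\<theta> (?\<tau> x) = \<chi> x" if "x \<in> L" for x
  proof -
    have "\<chi> x \<in> \<theta> ` L" using sub that by blast
    thus "?\<tau> x \<in> L" "\<theta> (?\<tau> x) = \<chi> x" by (auto intro: inv_into_into f_inv_into_f)
  qed
  have eq: "y = z" if "y \<in> L" "z \<in> L" "\<theta> y = \<theta> z" for y z using inj that by (auto dest: inj_onD)
  show ?thesis
    unfolding fhom_def
  proof (intro conjI ballI)
    show "?\<tau> 1 = 1"
      using \<tau>L[OF subfldD(2)[OF L]]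
      by (intro eq) (simp_all add: subfldD[OF L] fhomD(1)[OF \<theta> L] fhomD(1)[OF \<chi> L])
    fix x y assume xy: "x \<in> L" "y \<in> L"
    show "?\<tau> (x + y) = ?\<tau> x + ?\<tau> y" "?\<tau> (x * y) = ?\<tau> x * ?\<tau> y"
      using xy \<tau>L[OF subfldD(3)[OF L xy]] \<tau>L[OF subfldD(4)[OF L xy]] \<tau>L[OF xy(1)] \<tau>L[OF xy(2)]
      by (auto intro!: eq simp: subfldD[OF L] fhomD[OF \<theta> L] fhomD[OF \<chi> L])
  qed
qed

lemma degree_map_poly_lead:
  assumes "h 0 = 0" "h (lead_coeff p) \<noteq> 0"
  shows "degree (map_poly h p) = degree p"
proof (rule antisym)
  show "degree (map_poly h p) \<le> degree p"
    by (rule degree_le) (simp add: coeff_map_poly assms(1) coeff_eq_0)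
  show "degree p \<le> degree (map_poly h p)"
    by (rule le_degree) (simp add: coeff_map_poly assms)
qed

lemma subfld_range_to_ac: "subfld (range to_ac)"
  using subfld_image[OF fhom_to_ac subfld_UNIV] by simp

text \<open>
  This is Dedekind's theorem on reduction modulo a prime, for a rational place \<open>t = c\<close> at which \<open>f\<close>
  has simple roots. By Hensel's lemma \<open>f\<close> splits in the Laurent series field, its roots there being
  labelled by their constant terms in \<open>W\<close>. So the splitting field embeds in the Laurent series
  field, and the image of the embedding is generated by these roots. The Frobenius map on
  coefficients permutes the roots and fixes rational functions, so it restricts to an automorphism of
  the image, hence of the splitting field. On constant terms it acts as \<open>x \<mapsto> x\<^sup>q\<close>, so \<open>\<kappa>\<close>, the constant
  term of the image of a root, identifies its action on \<open>Z\<close> with Frobenius on \<open>W\<close>.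
\<close>

lemma frobenius_at_place:
  fixes f :: "'q :: {field, finite} poly poly" and c :: 'q
  assumes lc: "lead_coeff f = 1" and fin: "finite W" and stable: "frob ` W \<subseteq> W"
    and red: "map_poly (\<lambda>p. to_ac (poly p c)) f = roots_poly W"
  defines "Z \<equiv> {z. poly (map_poly (\<lambda>p. to_ac (to_fract p)) f) z = 0}"
  shows "finite Z" "card Z = degree f"
    "\<exists>\<kappa> \<tau>. bij_betw \<kappa> Z W \<and> fhom (adjoin (range to_ac) Z) \<tau> \<and> (\<forall>a. \<tau> (to_ac a) = to_ac a) \<and>
       (\<forall>z \<in> Z. \<tau> z \<in> Z \<and> \<kappa> (\<tau> z) = frob (\<kappa> z))"
proof -
  let ?K = "range (to_ac :: 'q poly fract \<Rightarrow> _)"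
  define fL where "fL = map_poly (\<lambda>p. to_ac (to_fract p)) f"
  define h where "h p = fps_to_fls (expand_at c p)" for p
  define g where "g = map_poly (expand_at c) f"
  define G where "G = map_poly h f"
  have h: "h 1 = 1" "h (a + b) = h a + h b" "h (a * b) = h a * h b" "h a = 0 \<longleftrightarrow> a = 0" for a b
    by (simp_all add: h_def expand_at_simps expand_at_eq_0_iff fls_times_fps_to_fls)
  obtain \<iota> where \<iota>: "fhom UNIV \<iota>" "\<And>a. \<iota> (to_fract a) = h a"
    using fract_hom_exists[of h, OF h] by blast
  have g0: "map_poly (\<lambda>u. fps_nth u 0) g = roots_poly W"
    unfolding g_def red[symmetric]
    by (rule poly_eqI) (simp add: coeff_map_poly expand_at_simps expand_at_nth_0)
  have Gg: "poly G (fps_to_fls s) = fps_to_fls (poly g s)" for s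
    unfolding G_def g_def h_def
    by (induction f) (auto simp: map_poly_pCons fls_times_fps_to_fls expand_at_simps)
  have "degree (roots_poly W) = degree f" unfolding red[symmetric]
    by (rule degree_map_poly_lead) (use lc in auto)
  hence degf: "degree f = card W" by (simp add: degree_roots_poly)
  have degG: "degree G = degree f" unfolding G_def by (rule degree_map_poly) (simp add: h lc)
  have lcG: "lead_coeff G = 1" unfolding degG by (simp add: G_def coeff_map_poly h lc)
  have degfL: "degree fL = degree f" unfolding fL_def by (rule degree_map_poly) (simp add: lc)
  have lcfL: "lead_coeff fL = 1" unfolding degfL by (simp add: fL_def coeff_map_poly lc)
  have fL0: "fL \<noteq> 0" using lcfL by auto
  have fLK: "fL \<in> polys_over ?K" by (simp add: polys_over_def fL_def coeff_map_poly)
  have Z: "Z = {z. poly fL z = 0}" by (simp add: Z_def fL_def)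
  show finZ: "finite Z" unfolding Z using fL0 by (rule poly_roots_finite)
  have "\<exists>s. fps_nth s 0 = w \<and> poly g s = 0" if "w \<in> W" for w
    using hensel_fps[of g w] fin that
    by (metis g0 poly_roots_poly pderiv_roots_poly_nonzero)
  then obtain S where S: "\<And>w. w \<in> W \<Longrightarrow> fps_nth (S w) 0 = w" "\<And>w. w \<in> W \<Longrightarrow> poly g (S w) = 0"
    by metis
  define S' where "S' w = fps_to_fls (S w)" for w
  have S'0: "fls_nth (S' w) 0 = w" if "w \<in> W" for w using S(1)[OF that] by (simp add: S'_def)
  have injS': "inj_on S' W" by (rule inj_on_inverseI[of _ "\<lambda>x. fls_nth x 0"]) (rule S'0)
  have GS': "G = roots_poly (S' ` W)"
  proof (rule roots_poly_unique)
    show "degree G = card (S' ` W)" by (simp add: degG degf card_image[OF injS'])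
    show "poly G y = 0" if "y \<in> S' ` W" for y using that S(2) by (auto simp: S'_def Gg)
  qed (use fin lcG in auto)
  have rootG: "poly G y = 0 \<longleftrightarrow> y \<in> S' ` W" for y unfolding GS' by (rule poly_roots_poly) (simp add: fin)
  \<comment> \<open>the splitting field embeds into the Laurent series, because \<open>G\<close> splits there\<close>
  define \<phi> where "\<phi> x = \<iota> (of_ac x)" for x
  have \<phi>_to_ac: "\<phi> (to_ac a) = \<iota> a" for a by (simp add: \<phi>_def)
  note \<iota>h = fhomD[OF \<iota>(1) subfld_UNIV]
  have \<phi>: "fhom ?K \<phi>"
    unfolding fhom_def
    by (auto simp: \<phi>_to_ac \<iota>h simp flip: to_ac_add to_ac_mult) (metis \<phi>_to_ac \<iota>h(1) to_ac_1)
  have \<phi>fL: "map_poly \<phi> fL = G"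
    unfolding fL_def G_def by (rule poly_eqI) (simp add: coeff_map_poly \<phi>_to_ac \<iota> \<iota>h(4) fhomD(4)[OF \<phi> subfld_range_to_ac] h)
  have "\<exists>y. poly u y = 0" if "u dvd map_poly \<phi> fL" "degree u > 0" for u
    using split_roots_poly_divisor_has_root[of "S' ` W" u] that fin unfolding \<phi>fL GS' by blast
  then obtain \<theta> where \<theta>: "fhom (adjoin ?K Z) \<theta>" "\<forall>a \<in> ?K. \<theta> a = \<phi> a"
    using extend_hom[OF finZ subfld_range_to_ac \<phi> fLK fL0] unfolding Z by blast
  define L where "L = adjoin ?K Z"
  have L: "subfld L" unfolding L_def by (rule subfld_adjoin)
  have \<theta>L: "fhom L \<theta>" using \<theta> by (simp add: L_def)
  have ZL: "z \<in> L" if "z \<in> Z" for z using that adjoin_gens unfolding L_def by blast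
  have KL: "?K \<subseteq> L" unfolding L_def by (rule adjoin_base)
  have inj: "inj_on \<theta> L" by (rule fhom_inj_on[OF \<theta>L L])
  have map\<theta>: "map_poly \<theta> p = map_poly \<phi> p" if "p \<in> polys_over ?K" for p
  proof (rule poly_eqI)
    fix i
    have "\<theta> (coeff p i) = \<phi> (coeff p i)" using \<theta>(2) polys_over_coeff[OF that] by (rule bspec)
    thus "coeff (map_poly \<theta> p) i = coeff (map_poly \<phi> p) i"
      by (simp add: coeff_map_poly fhomD(4)[OF \<theta>L L] fhomD(4)[OF \<phi> subfld_range_to_ac])
  qed
  have \<theta>poly: "\<theta> (poly p z) = poly (map_poly \<phi> p) (\<theta> z)" if "p \<in> polys_over ?K" "z \<in> Z" for p z
    using fhom_poly[OF \<theta>L L polys_over_mono[OF KL that(1)] ZL[OF that(2)]] map\<theta>[OF that(1)] by simp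
  have \<theta>Z: "\<theta> z \<in> S' ` W" if z: "z \<in> Z" for z
  proof -
    have "poly fL z = 0" using z by (simp add: Z)
    hence "poly G (\<theta> z) = 0" using \<theta>poly[OF fLK z] fhomD(4)[OF \<theta>L L] \<phi>fL by simp
    thus ?thesis by (simp add: rootG)
  qed
  show cardZ: "card Z = degree f"
  proof -
    have "poly (pderiv fL) z \<noteq> 0" if "poly fL z = 0" for z
    proof
      assume 0: "poly (pderiv fL) z = 0"
      have z: "z \<in> Z" using that by (simp add: Z)
      have "poly (pderiv G) (\<theta> z) = 0"
        using \<theta>poly[OF map_poly_pderiv_fhom(2)[OF \<phi> subfld_range_to_ac fLK] z]
          map_poly_pderiv_fhom(1)[OF \<phi> subfld_range_to_ac fLK] 0 fhomD(4)[OF \<theta>L L] \<phi>fL by simp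
      thus False using pderiv_roots_poly_nonzero[of "S' ` W" "\<theta> z"] \<theta>Z[OF z] fin GS' by simp
    qed
    thus ?thesis using alg_closed_separable(2)[OF fL0] degfL unfolding Z by simp
  qed
  define \<kappa> where "\<kappa> z = fls_nth (\<theta> z) 0" for z
  have \<kappa>: "\<kappa> z \<in> W" "\<theta> z = S' (\<kappa> z)" if z: "z \<in> Z" for z
    using \<theta>Z[OF z] S'0 by (auto simp: \<kappa>_def)
  have "inj_on \<kappa> Z"
    using \<kappa>(2) inj ZL by (intro inj_onI) (metis inj_onD)
  moreover from this have "\<kappa> ` Z = W"
    using \<kappa>(1) cardZ degf fin by (intro card_subset_eq) (auto simp: card_image)
  ultimately have bij: "bij_betw \<kappa> Z W" by (simp add: bij_betw_def)
  have S'Z: "S' w \<in> \<theta> ` Z" if "w \<in> W" for w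
    using bij \<kappa>(2) that unfolding bij_betw_def by auto
  \<comment> \<open>Frobenius permutes the generators \<open>\<theta> ` Z\<close> of the image and fixes the base field\<close>
  note \<Phi>h = fhomD[OF fhom_fls_frob subfld_UNIV]
  have \<Phi>h': "fls_frob (h a) = h a" for a
  proof (rule fls_eqI)
    fix n
    have "frob (fps_nth (expand_at c a) k) = fps_nth (expand_at c a) k" for k
      using expand_at_nth[of c a k] by auto
    thus "fls_nth (fls_frob (h a)) n = fls_nth (h a) n" by (simp add: fls_frob_nth h_def)
  qed
  have \<Phi>\<iota>: "fls_frob (\<iota> x) = \<iota> x" for x
  proof (cases x)
    case (Fract a b)
    hence "x = to_fract a * inverse (to_fract b)" by (simp add: to_fract_def)
    thus ?thesis by (simp add: \<iota>(2) \<iota>h(3,6) \<Phi>h(3,6) \<Phi>h')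
  qed
  have \<Phi>G: "map_poly fls_frob G = G"
    unfolding G_def by (rule poly_eqI) (simp add: coeff_map_poly \<Phi>h' \<Phi>h(4) h)
  have \<Phi>S': "fls_frob y \<in> S' ` W" if "y \<in> S' ` W" for y
    using fhom_poly[OF fhom_fls_frob subfld_UNIV polys_over_UNIV[of G] UNIV_I[of y]] that
    by (simp add: rootG[symmetric] \<Phi>G \<Phi>h(4))
  have comp: "fhom L (\<lambda>x. fls_frob (\<theta> x))"
    unfolding fhom_def by (simp add: fhomD[OF \<theta>L L] \<Phi>h)
  have \<Phi>K: "fls_frob (\<theta> (to_ac a)) = \<theta> (to_ac a)" for a using \<theta>(2) \<Phi>\<iota> \<phi>_to_ac by simp
  have \<Phi>Z: "\<exists>z' \<in> Z. fls_frob (\<theta> z) = \<theta> z'" if z: "z \<in> Z" for z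
  proof -
    obtain w where "w \<in> W" "fls_frob (\<theta> z) = S' w" using \<Phi>S'[OF \<theta>Z[OF z]] by blast
    thus ?thesis using S'Z[of w] by auto
  qed
  have "(\<lambda>x. fls_frob (\<theta> x)) ` L \<subseteq> \<theta> ` L"
    unfolding L_def
  proof (rule fhom_image_subset)
    show "fhom (adjoin ?K Z) (\<lambda>x. fls_frob (\<theta> x))" using comp by (simp add: L_def)
    show "subfld (\<theta> ` adjoin ?K Z)" using subfld_image[OF \<theta>L L] by (simp add: L_def)
    show "(\<lambda>x. fls_frob (\<theta> x)) ` ?K \<subseteq> \<theta> ` adjoin ?K Z" using \<Phi>K KL unfolding L_def by auto
    show "(\<lambda>x. fls_frob (\<theta> x)) ` Z \<subseteq> \<theta> ` adjoin ?K Z"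
      using \<Phi>Z ZL unfolding L_def by (auto simp: image_iff)
  qed
  from fhom_inv_into_comp[OF \<theta>L L comp this]
  have "fhom L (\<lambda>x. inv_into L \<theta> (fls_frob (\<theta> x)))" .
  moreover have "inv_into L \<theta> (fls_frob (\<theta> (to_ac a))) = to_ac a" for a
  proof -
    have "to_ac a \<in> L" using KL by blast
    thus ?thesis using \<Phi>K inv_into_f_f[OF inj] by simp
  qed
  moreover have "inv_into L \<theta> (fls_frob (\<theta> z)) \<in> Z \<and>
      \<kappa> (inv_into L \<theta> (fls_frob (\<theta> z))) = frob (\<kappa> z)" if z: "z \<in> Z" for z
  proof -
    obtain z' where z': "z' \<in> Z" "fls_frob (\<theta> z) = \<theta> z'" using \<Phi>Z[OF z] by blast
    hence "inv_into L \<theta> (fls_frob (\<theta> z)) = z'" using inv_into_f_f[OF inj] ZL by simp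
    moreover have "\<kappa> z' = frob (\<kappa> z)" unfolding \<kappa>_def z'(2)[symmetric] by (rule fls_frob_nth)
    ultimately show ?thesis using z'(1) by simp
  qed
  ultimately show "\<exists>\<kappa> \<tau>. bij_betw \<kappa> Z W \<and> fhom (adjoin ?K Z) \<tau> \<and> (\<forall>a. \<tau> (to_ac a) = to_ac a) \<and>
       (\<forall>z \<in> Z. \<tau> z \<in> Z \<and> \<kappa> (\<tau> z) = frob (\<kappa> z))"
    using bij unfolding L_def by blast
qed


section \<open>Permutations of the roots realised by automorphisms\<close>

definition galois_perms :: "'k :: field alg_closure set \<Rightarrow> ('k alg_closure \<Rightarrow> 'k alg_closure) set" where
  "galois_perms Z = {\<pi>. \<pi> permutes Z \<and>
     (\<exists>\<tau>. fhom (adjoin (range to_ac) Z) \<tau> \<and> (\<forall>a. \<tau> (to_ac a) = to_ac a) \<and> (\<forall>z \<in> Z. \<tau> z = \<pi> z))}"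

lemma id_in_galois_perms: "id \<in> galois_perms Z"
  unfolding galois_perms_def by (auto simp: permutes_id fhom_def intro!: exI[of _ id])

lemma galois_perms_comp:
  assumes "\<pi> \<in> galois_perms Z" "\<rho> \<in> galois_perms Z"
  shows "\<pi> \<circ> \<rho> \<in> galois_perms Z"
proof -
  let ?L = "adjoin (range to_ac) Z"
  obtain \<sigma> where \<sigma>: "fhom ?L \<sigma>" "\<forall>a. \<sigma> (to_ac a) = to_ac a" "\<forall>z \<in> Z. \<sigma> z = \<pi> z" and \<pi>: "\<pi> permutes Z"
    using assms(1) unfolding galois_perms_def by blast
  obtain \<tau> where \<tau>: "fhom ?L \<tau>" "\<forall>a. \<tau> (to_ac a) = to_ac a" "\<forall>z \<in> Z. \<tau> z = \<rho> z" and \<rho>: "\<rho> permutes Z"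
    using assms(2) unfolding galois_perms_def by blast
  note base = adjoin_base[of "range to_ac" Z] and gens = adjoin_gens[of Z "range to_ac"]
  have \<rho>Z: "\<rho> z \<in> Z" if "z \<in> Z" for z using permutes_in_image[OF \<rho>] that by blast
  have "\<tau> ` ?L \<subseteq> ?L"
    using \<tau> \<rho>Z base gens by (intro fhom_image_subset subfld_adjoin) auto
  hence "\<tau> x \<in> ?L" if "x \<in> ?L" for x using that by blast
  hence "fhom ?L (\<sigma> \<circ> \<tau>)"
    unfolding fhom_def by (auto simp: fhomD[OF \<sigma>(1) subfld_adjoin] fhomD[OF \<tau>(1) subfld_adjoin])
  moreover have "\<forall>z\<in>Z. (\<sigma> \<circ> \<tau>) z = (\<pi> \<circ> \<rho>) z" using \<sigma>(3) \<tau>(3) \<rho>Z by simp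
  ultimately show ?thesis
    unfolding galois_perms_def using \<sigma>(2) \<tau>(2) permutes_compose[OF \<rho> \<pi>] by (auto intro!: exI[of _ "\<sigma> \<circ> \<tau>"])
qed

lemma galois_perm_of_hom:
  assumes "finite Z" and \<tau>: "fhom (adjoin (range to_ac) Z) \<tau>" "\<And>a. \<tau> (to_ac a) = to_ac a"
    and stable: "\<And>z. z \<in> Z \<Longrightarrow> \<tau> z \<in> Z"
  shows "(\<lambda>x. if x \<in> Z then \<tau> x else x) \<in> galois_perms Z"
proof -
  have "inj_on \<tau> Z"
    using fhom_inj_on[OF \<tau>(1) subfld_adjoin] adjoin_gens by (rule inj_on_subset)
  hence "bij_betw \<tau> Z Z"
    using endo_inj_surj[OF assms(1), of \<tau>] stable by (auto simp: bij_betw_def)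
  hence "bij_betw (\<lambda>x. if x \<in> Z then \<tau> x else x) Z Z" by (simp cong: bij_betw_cong)
  hence "(\<lambda>x. if x \<in> Z then \<tau> x else x) permutes Z" by (rule bij_imp_permutes) simp
  thus ?thesis unfolding galois_perms_def using \<tau> by auto
qed

text \<open>
  The minimal polynomial of \<open>z\<close> divides a polynomial with simple roots and is not linear, so it has a
  root \<open>y \<noteq> z\<close>. The homomorphism \<open>z \<mapsto> y\<close> extends to the splitting field.
\<close>

lemma irrational_root_moved:
  fixes Z :: "'k :: field alg_closure set"
  assumes fin: "finite Z" and over: "roots_poly Z \<in> polys_over (range to_ac)"
    and z: "z \<in> Z" "z \<notin> range to_ac"
  shows "\<exists>\<pi> \<in> galois_perms Z. \<pi> z \<noteq> z"
proof -
  let ?K = "range (to_ac :: 'k \<Rightarrow> _)" and ?f = "roots_poly Z"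
  note K = subfld_range_to_ac
  have fz: "poly ?f z = 0" using fin z(1) by (simp add: poly_roots_poly)
  obtain \<mu> where \<mu>: "\<mu> \<in> polys_over ?K" "lead_coeff \<mu> = 1" "poly \<mu> z = 0"
    and min: "\<And>q. q \<in> polys_over ?K \<Longrightarrow> poly q z = 0 \<Longrightarrow> \<exists>s \<in> polys_over ?K. q = \<mu> * s"
    using min_poly_exists[OF K over roots_poly_nonzero fz] by blast
  obtain s where s: "?f = \<mu> * s" using min[OF over fz] by blast
  obtain \<mu>' where \<mu>': "\<mu> = [:- z, 1:] * \<mu>'" using \<mu>(3) by (metis dvdE poly_eq_0_iff_dvd)
  have "degree \<mu>' \<noteq> 0"
  proof
    assume "degree \<mu>' = 0"
    then obtain c where c: "\<mu>' = [:c:]" by (metis degree_eq_zeroE)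
    hence "c = 1" using \<mu>(2) by (auto simp: \<mu>' split: if_splits)
    hence "coeff \<mu> 0 = - z" by (simp add: \<mu>' c)
    hence "- z \<in> ?K" using polys_over_coeff[OF \<mu>(1), of 0] by simp
    hence "- (- z) \<in> ?K" by (rule subfldD(5)[OF K])
    thus False using z(2) by simp
  qed
  then obtain y where y: "poly \<mu>' y = 0" using alg_closed_imp_poly_has_root[of \<mu>'] by auto
  have \<mu>y: "poly \<mu> y = 0" using y by (simp add: \<mu>')
  have "poly \<mu>' z \<noteq> 0"
  proof
    assume "poly \<mu>' z = 0"
    moreover have "?f = [:- z, 1:] * (\<mu>' * s)" unfolding s \<mu>' by (rule mult.assoc)
    hence "pderiv ?f = pderiv ([:- z, 1:] * (\<mu>' * s))" by simp
    hence "poly (pderiv ?f) z = poly (\<mu>' * s) z"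
      by (simp add: pderiv_mult pderiv_pCons del: mult_pCons_left)
    ultimately show False using pderiv_roots_poly_nonzero[OF fin z(1)] by simp
  qed
  hence yz: "y \<noteq> z" using y by auto
  have "fhom ?K id" by (simp add: fhom_def)
  moreover have "\<mu> \<noteq> 0" using \<mu>(2) by auto
  ultimately obtain \<psi> where \<psi>: "fhom (adjoin ?K {z}) \<psi>" "\<forall>a \<in> ?K. \<psi> a = id a" "\<psi> z = y"
    using extend_hom_min_poly[OF K, of id \<mu> z y] \<mu> min \<mu>y by auto
  let ?E = "adjoin ?K {z}"
  have "?f \<in> polys_over ?E" using over adjoin_base by (blast intro: polys_over_mono)
  hence "\<exists>\<chi>. fhom (adjoin ?E Z) \<chi> \<and> (\<forall>a \<in> ?E. \<chi> a = \<psi> a)"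
    using alg_closed_imp_poly_has_root poly_roots_poly[OF fin]
    by (intro extend_hom[OF fin subfld_adjoin \<psi>(1), of ?f]) auto
  moreover have "adjoin ?E Z = adjoin ?K Z" using z(1) by (simp add: adjoin_adjoin insert_absorb)
  ultimately obtain \<chi> where \<chi>: "fhom (adjoin ?K Z) \<chi>" "\<forall>a \<in> ?E. \<chi> a = \<psi> a" by auto
  have \<chi>K: "\<chi> a = a" if "a \<in> ?K" for a
    using \<chi>(2) \<psi>(2) that adjoin_base[of ?K "{z}"] by (metis id_apply subsetD)
  have \<chi>0: "\<chi> 0 = 0" by (rule fhomD(4)[OF \<chi>(1) subfld_adjoin])
  have "map_poly \<chi> ?f = ?f"
    by (rule poly_eqI) (simp add: coeff_map_poly \<chi>0 \<chi>K polys_over_coeff[OF over])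
  hence "\<chi> x \<in> Z" if x: "x \<in> Z" for x
  proof -
    have "x \<in> adjoin ?K Z" using x adjoin_gens by blast
    from fhom_poly[OF \<chi>(1) subfld_adjoin polys_over_mono[OF adjoin_base over] this]
    have "poly ?f (\<chi> x) = \<chi> (poly ?f x)" using \<open>map_poly \<chi> ?f = ?f\<close> by simp
    also have "\<dots> = 0" using x fin by (metis poly_roots_poly \<chi>0)
    finally show ?thesis by (simp add: poly_roots_poly fin)
  qed
  hence "(\<lambda>x. if x \<in> Z then \<chi> x else x) \<in> galois_perms Z"
    using \<chi>K by (intro galois_perm_of_hom fin \<chi>(1)) auto
  moreover have "\<chi> z = y" using \<chi>(2) \<psi>(3) adjoin_gens[of "{z}" ?K] by auto
  ultimately show ?thesis using z(1) yz by (intro bexI) auto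
qed


section \<open>A criterion for the full symmetric group\<close>

text \<open>
  Conjugation moves transpositions around. Unless \<open>r\<close> is already an end of the given transposition,
  a power of \<open>\<sigma>\<close> followed by the inverse of \<open>s\<close> takes \<open>a\<close> to \<open>r\<close>. Since \<open>\<sigma>\<close> fixes \<open>r\<close> and is transitive on the
  rest, its powers then produce all transpositions involving \<open>r\<close>, and these generate the
  symmetric group.
\<close>

lemma transposition_and_cycle_generate:
  assumes fin: "finite Z" and perm: "\<And>\<pi>. \<pi> \<in> S \<Longrightarrow> \<pi> permutes Z" and id: "id \<in> S"
    and comp: "\<And>\<pi> \<rho>. \<pi> \<in> S \<Longrightarrow> \<rho> \<in> S \<Longrightarrow> \<pi> \<circ> \<rho> \<in> S"
    and \<sigma>: "\<sigma> \<in> S" "r \<in> Z" "\<sigma> r = r"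
    and cycle: "\<And>x y. x \<in> Z - {r} \<Longrightarrow> y \<in> Z - {r} \<Longrightarrow> \<exists>n. (\<sigma> ^^ n) x = y"
    and swap: "Transposition.transpose a b \<in> S" "a \<in> Z" "b \<in> Z" "a \<noteq> b"
    and moved: "s \<in> S" "s r \<noteq> r"
    and \<pi>: "\<pi> permutes Z"
  shows "\<pi> \<in> S"
proof -
  have pow: "\<rho> ^^ n \<in> S" if "\<rho> \<in> S" for \<rho> n
  proof (induction n)
    case 0
    show ?case unfolding funpow.simps by (rule id)
  next
    case (Suc n)
    show ?case unfolding funpow.simps by (rule comp[OF that Suc])
  qed
  have inv: "inv_into UNIV \<rho> \<in> S" if \<rho>: "\<rho> \<in> S" for \<rho>
  proof -
    have "permutation \<rho>" using perm[OF \<rho>] fin permutation_permutes by blast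
    then obtain n where n: "\<rho> ^^ n = id" "n > 0" by (rule permutation_is_nilpotent)
    obtain k where k: "n = Suc k" using n(2) by (cases n) auto
    have "\<rho> ^^ k = (inv_into UNIV \<rho> \<circ> \<rho>) \<circ> \<rho> ^^ k"
      by (simp only: inv_o_cancel[OF permutes_inj[OF perm[OF \<rho>]]] id_o)
    also have "\<dots> = inv_into UNIV \<rho> \<circ> \<rho> ^^ n" by (simp only: k funpow.simps comp_assoc)
    also have "\<dots> = inv_into UNIV \<rho>" by (simp only: n(1) o_id)
    finally show ?thesis using pow[OF \<rho>, of k] by (simp only:)
  qed
  have conj: "Transposition.transpose (\<rho> x) (\<rho> y) \<in> S"
    if "\<rho> \<in> S" "Transposition.transpose x y \<in> S" for \<rho> x y
  proof -
    have bij: "bij \<rho>" using permutes_bij[OF perm[OF that(1)]] .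
    have "\<rho> \<circ> Transposition.transpose x y \<circ> inv_into UNIV \<rho> = Transposition.transpose (\<rho> x) (\<rho> y)"
    proof
      fix u
      obtain v where v: "u = \<rho> v" using bij_is_surj[OF bij] by (rule surjE)
      have "inj \<rho>" using bij by (rule bij_is_inj)
      thus "(\<rho> \<circ> Transposition.transpose x y \<circ> inv_into UNIV \<rho>) u = Transposition.transpose (\<rho> x) (\<rho> y) u"
        unfolding v by (auto simp: Transposition.transpose_def inj_eq)
    qed
    thus ?thesis using comp[OF comp[OF that] inv[OF that(1)]] by simp
  qed
  have mem: "\<rho> x \<in> Z \<longleftrightarrow> x \<in> Z" if "\<rho> \<in> S" for \<rho> x using permutes_in_image[OF perm[OF that]] .
  \<comment> \<open>a power of \<open>\<sigma>\<close> takes \<open>a\<close> to \<open>s r\<close>, which the inverse of \<open>s\<close> takes to \<open>r\<close>\<close>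
  have "\<exists>b' \<in> Z - {r}. Transposition.transpose r b' \<in> S"
  proof (cases "a = r \<or> b = r")
    case True
    thus ?thesis using swap by (auto simp: transpose_commute)
  next
    case False
    have "s r \<in> Z - {r}" using moved \<sigma>(2) mem by auto
    then obtain n where n: "(\<sigma> ^^ n) a = s r" using cycle[of a "s r"] swap False by blast
    define \<rho> where "\<rho> = inv_into UNIV s \<circ> \<sigma> ^^ n"
    have \<rho>: "\<rho> \<in> S" unfolding \<rho>_def using inv moved(1) pow[OF \<sigma>(1)] comp by blast
    have \<rho>a: "\<rho> a = r"
      using n permutes_inj[OF perm[OF moved(1)]] by (simp add: \<rho>_def)
    moreover have "\<rho> b \<noteq> \<rho> a" using permutes_inj[OF perm[OF \<rho>]] swap(4) by (auto dest: injD)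
    ultimately show ?thesis using conj[OF \<rho> swap(1)] mem[OF \<rho>] swap(3) by auto
  qed
  then obtain b' where b': "b' \<in> Z - {r}" "Transposition.transpose r b' \<in> S" by blast
  have star: "Transposition.transpose r y \<in> S" if y: "y \<in> Z - {r}" for y
  proof -
    obtain n where n: "(\<sigma> ^^ n) b' = y" using cycle[OF b'(1) y] by blast
    have "(\<sigma> ^^ n) r = r" by (induction n) (auto simp: \<sigma>(3))
    thus ?thesis using conj[OF pow[OF \<sigma>(1)] b'(2), of n] n by simp
  qed
  have all: "Transposition.transpose x y \<in> S" if xy: "x \<in> Z" "y \<in> Z" "x \<noteq> y" for x y
  proof -
    consider "x = r" | "y = r" | "x \<noteq> r" "y \<noteq> r" by blast
    thus ?thesis
    proof cases
      case 1
      thus ?thesis using star[of y] xy by simp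
    next
      case 2
      thus ?thesis using star[of x] xy by (subst transpose_commute) simp
    next
      case 3
      have "Transposition.transpose r x \<in> S" "Transposition.transpose r y \<in> S"
        using star xy 3 by auto
      from conj[OF this] show ?thesis using xy 3 by (simp add: transpose_apply_other)
    qed
  qed
  show ?thesis
    using \<pi> fin
  proof (induction \<pi> rule: permutes_induct)
    case id
    show ?case by (rule \<open>id \<in> S\<close>)
  next
    case (swap x y p)
    show ?case by (rule comp[OF all[OF swap(1,2,3)] swap.IH])
  qed
qed


section \<open>A polynomial without rational roots\<close>

lemma to_fract_power: "to_fract (x ^ n) = to_fract x ^ n"
  by (induction n) auto

text \<open>
  Compare degrees. Let \<open>x = a / b\<close> with \<open>A = degree a\<close> and \<open>B = degree b\<close>, and clear denominators. If
  \<open>A \<ge> B + 2\<close>, the term of exponent \<open>m\<close> dominates all those of exponent strictly between 0 and \<open>m\<close>, so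
  its degree \<open>m * A\<close> must equal the degree \<open>2 * m + 1 + m * B\<close> of the constant term; this is
  impossible modulo \<open>m\<close>. If \<open>A \<le> B + 1\<close>, the constant term dominates all the others.
\<close>

lemma no_rational_root:
  fixes f :: "'q :: field poly poly"
  assumes deg: "degree f = m" and m: "m \<ge> 2" and lc: "lead_coeff f = 1"
    and low: "\<And>i. 0 < i \<Longrightarrow> i < m \<Longrightarrow> degree (coeff f i) \<le> 1" and const: "degree (coeff f 0) = 2 * m + 1"
  shows "poly (map_poly to_fract f) x \<noteq> 0"
proof
  assume root: "poly (map_poly to_fract f) x = 0"
  obtain a b where x: "x = Fract a b" and b: "b \<noteq> 0" by (cases x) auto
  have xab: "x * to_fract b = to_fract a" using b by (simp add: x to_fract_def eq_fract)
  define T where "T i = coeff f i * a ^ i * b ^ (m - i)" for i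
  have degm: "degree (map_poly to_fract f) = m"
    using deg by (subst degree_map_poly_lead) (use lc in auto)
  have "to_fract (\<Sum>i\<le>m. T i) = (\<Sum>i\<le>m. to_fract (coeff f i) * x ^ i) * to_fract b ^ m"
    unfolding to_fract_sum sum_distrib_right
  proof (rule sum.cong)
    fix i assume "i \<in> {..m}"
    hence "to_fract b ^ m = to_fract b ^ i * to_fract b ^ (m - i)" by (simp flip: power_add)
    thus "to_fract (T i) = to_fract (coeff f i) * x ^ i * to_fract b ^ m"
      by (simp add: T_def to_fract_power power_mult_distrib ac_simps flip: xab)
  qed simp
  also have "(\<Sum>i\<le>m. to_fract (coeff f i) * x ^ i) = 0"
    using root unfolding poly_altdef degm by (simp add: coeff_map_poly)
  finally have sum0: "(\<Sum>i\<le>m. T i) = 0" by (simp only: to_fract_eq_0_iff mult_zero_left)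
  define A B where "A = degree a" and "B = degree b"
  have c0: "coeff f 0 \<noteq> 0" using const by auto
  have T0: "degree (T 0) = 2 * m + 1 + m * B" "T 0 \<noteq> 0"
    using b c0 const by (auto simp: T_def degree_mult_eq degree_power_eq B_def)
  have Tm: "degree (T m) = m * A"
    using lc deg by (cases "a = 0") (auto simp: T_def degree_power_eq A_def power_0_left)
  have mid: "degree (T i) \<le> 1 + i * A + (m - i) * B" if "0 < i" "i < m" for i
  proof -
    have "degree (T i) \<le> degree (coeff f i) + degree (a ^ i) + degree (b ^ (m - i))"
      unfolding T_def by (intro order_trans[OF degree_mult_le] add_mono order.refl)
    also have "\<dots> \<le> 1 + i * A + (m - i) * B"
      using low[OF that] degree_power_le[of a i] degree_power_le[of b "m - i"]
      by (intro add_mono) (auto simp: A_def B_def mult.commute)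
    finally show ?thesis .
  qed
  define U where "U = (\<Sum>i\<in>{0<..<m}. T i)"
  have "{..m} = insert 0 (insert m {0<..<m})" using m by auto
  hence split: "T 0 + T m + U = 0" using sum0 m by (simp add: U_def add.assoc)
  show False
  proof (cases "A \<ge> B + 2")
    case True
    have "degree (T i) < m * A" if i: "0 < i" "i < m" for i
    proof -
      define d where "d = m - i"
      have d: "d \<ge> 1" "m = i + d" using i by (auto simp: d_def)
      have "d * (B + 2) \<le> d * A" using True by (rule mult_le_mono2)
      hence "d * B + 2 * d \<le> d * A" by (simp add: algebra_simps)
      moreover have "i * A + d * A = m * A" by (simp add: d(2) add_mult_distrib)
      ultimately show ?thesis using mid[OF i] d(1) unfolding d_def[symmetric] by linarith
    qed
    hence U: "degree U < m * A" unfolding U_def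
      using m True by (intro degree_sum_less) auto
    have "m * A \<noteq> 2 * m + 1 + m * B"
    proof
      assume eq: "m * A = 2 * m + 1 + m * B"
      obtain d where "A = B + d" using True by (metis le_add1 le_trans nat_le_iff_add)
      hence "m * d = m * 2 + 1" using eq by (simp add: algebra_simps)
      hence "m dvd m * 2 + 1" by (metis dvd_triv_left)
      hence "m dvd 1" by (metis dvd_add_right_iff dvd_triv_left)
      thus False using m by simp
    qed
    then consider "m * A < 2 * m + 1 + m * B" | "2 * m + 1 + m * B < m * A" by linarith
    thus False
    proof cases
      case 1
      have "T 0 = - (T m + U)" using split by (simp add: algebra_simps add_eq_0_iff)
      hence "degree (T 0) = degree (T m + U)" by (simp only: degree_minus)
      also have "\<dots> \<le> m * A" using U Tm by (intro degree_add_le) auto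
      finally show False using 1 T0 by simp
    next
      case 2
      have "T m = - (T 0 + U)" using split by (simp add: algebra_simps add_eq_0_iff)
      hence "degree (T m) = degree (T 0 + U)" by (simp only: degree_minus)
      also have "\<dots> < m * A" using U T0 2 by (intro degree_add_less) auto
      finally show False using Tm by simp
    qed
  next
    case False
    have step: "degree (T i) \<le> m + 1 + m * B" if "0 < i" "i \<le> m" for i
    proof -
      have "i * A \<le> i * (B + 1)" using False by (intro mult_le_mono2) simp
      moreover have "i * B + (m - i) * B = m * B" using that by (simp flip: add_mult_distrib)
      ultimately have le: "i * A + (m - i) * B \<le> i + m * B" by (simp add: algebra_simps)
      show ?thesis
      proof (cases "i = m")
        case True
        thus ?thesis using le Tm by simp
      next
        case False
        thus ?thesis using le mid[of i] that by simp
      qed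
    qed
    have "degree U \<le> m + 1 + m * B" unfolding U_def using step by (intro degree_sum_le) auto
    hence "degree (T m + U) \<le> m + 1 + m * B" using step[of m] m by (intro degree_add_le) auto
    moreover have "T 0 = - (T m + U)" using split by (simp add: algebra_simps add_eq_0_iff)
    hence "degree (T 0) = degree (T m + U)" by (simp only: degree_minus)
    ultimately show False using T0 m by simp
  qed
qed


section \<open>A polynomial over the rational function field with full symmetric group\<close>

text \<open>
  For odd \<open>k\<close> a single orbit will do. For even \<open>k > 0\<close> an orbit of odd length \<open>k - 1\<close> is completed by
  the fixed point 0.
\<close>

lemma odd_frob_stable_set_exists:
  obtains V :: "'q :: {field, finite} alg_closure set" and N where "finite V" "card V = k" "frob ` V \<subseteq> V"
    "odd N" "\<And>x. x \<in> V \<Longrightarrow> x ^ (CARD('q) ^ N) = x"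
proof -
  consider "k = 0" | "odd k" | "even k" "k \<noteq> 0" by blast
  thus thesis
  proof cases
    case 1
    thus ?thesis using that[of "{}" 1] by simp
  next
    case 2
    hence "k > 0" by (rule odd_pos)
    then obtain W :: "'q alg_closure set" where "finite W" "card W = k" "frob ` W \<subseteq> W"
      "\<And>x. x \<in> W \<Longrightarrow> x ^ (CARD('q) ^ k) = x"
      using frob_orbit_exists[of k, where ?'q = 'q] by metis
    thus ?thesis using that[of W k] 2 by blast
  next
    case 3
    hence k: "k \<ge> 2" by presburger
    hence "k - 1 > 0" by simp
    then obtain W :: "'q alg_closure set" where W: "finite W" "card W = k - 1" "frob ` W \<subseteq> W" "0 \<notin> W"
      "\<And>x. x \<in> W \<Longrightarrow> x ^ (CARD('q) ^ (k - 1)) = x"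
      using frob_orbit_exists[of "k - 1", where ?'q = 'q] by metis
    show ?thesis
    proof (rule that[of "insert 0 W" "k - 1"])
      show "card (insert 0 W) = k" using W k by simp
      show "frob ` insert 0 W \<subseteq> insert 0 W" using W(3) by auto
    qed (use W 3 in auto)
  qed
qed

lemma funpow_frob_equivariant:
  fixes \<kappa> :: "'a \<Rightarrow> 'q :: {field, finite} alg_closure"
  assumes "\<And>z. z \<in> Z \<Longrightarrow> \<sigma> z \<in> Z \<and> \<kappa> (\<sigma> z) = frob (\<kappa> z)" "z \<in> Z"
  shows "(\<sigma> ^^ n) z \<in> Z \<and> \<kappa> ((\<sigma> ^^ n) z) = \<kappa> z ^ (CARD('q) ^ n)"
proof (induction n)
  case (Suc n)
  thus ?case using assms(1)[of "(\<sigma> ^^ n) z"] by (simp add: power_mult[symmetric] ac_simps)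
qed (use assms(2) in simp)

lemma frobenius_perm_at_place:
  fixes f :: "'q :: {field, finite} poly poly" and c :: 'q
  assumes lc: "lead_coeff f = 1" and fin: "finite W" and stable: "frob ` W \<subseteq> W"
    and red: "map_poly (\<lambda>p. to_ac (poly p c)) f = roots_poly W"
  defines "Z \<equiv> {z. poly (map_poly (\<lambda>p. to_ac (to_fract p)) f) z = 0}"
  obtains \<kappa> \<sigma> where "finite Z" "card Z = degree f" "bij_betw \<kappa> Z W" "\<sigma> \<in> galois_perms Z"
    "\<And>z. z \<in> Z \<Longrightarrow> \<sigma> z \<in> Z \<and> \<kappa> (\<sigma> z) = frob (\<kappa> z)"
proof -
  note F = frobenius_at_place[OF lc fin stable red, folded Z_def]
  obtain \<kappa> \<tau> where \<kappa>: "bij_betw \<kappa> Z W" and \<tau>: "fhom (adjoin (range to_ac) Z) \<tau>"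
    "\<And>a. \<tau> (to_ac a) = to_ac a" "\<And>z. z \<in> Z \<Longrightarrow> \<tau> z \<in> Z \<and> \<kappa> (\<tau> z) = frob (\<kappa> z)"
    using F(3) by blast
  have "(\<lambda>x. if x \<in> Z then \<tau> x else x) \<in> galois_perms Z"
    using \<tau> by (intro galois_perm_of_hom F(1)) auto
  thus ?thesis using \<tau>(3) by (intro that[OF F(1,2) \<kappa>]) auto
qed

text \<open>
  Interpolate \<open>f0\<close> and \<open>f1\<close> linearly in \<open>t\<close> and add \<open>t\<^sup>N (t - 1)\<close> with \<open>N = 2 * m\<close> to the constant
  coefficient. The added term vanishes at 0 and 1, and it gives the constant coefficient the degree
  that excludes rational roots.
\<close>

lemma interpolating_polynomial:
  fixes f0 f1 :: "'q :: field poly"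
  assumes m: "m \<ge> 2" and f0: "degree f0 = m" "lead_coeff f0 = 1" and f1: "degree f1 = m" "lead_coeff f1 = 1"
  obtains f :: "'q poly poly" where "degree f = m" "lead_coeff f = 1"
    "map_poly (\<lambda>p. poly p 0) f = f0" "map_poly (\<lambda>p. poly p 1) f = f1"
    "\<And>x. poly (map_poly to_fract f) x \<noteq> 0"
proof -
  define e :: "'q poly" where "e = monom 1 (2 * m + 1) - monom 1 (2 * m)"
  have e: "poly e 0 = 0" "poly e 1 = 0" using m by (simp_all add: e_def poly_monom)
  have "degree (monom (1 :: 'q) (2 * m)) < degree (monom (1 :: 'q) (2 * m + 1))"
    by (simp add: degree_monom_eq)
  hence dege: "degree e = 2 * m + 1"
    unfolding e_def using degree_add_eq_left[of "- monom 1 (2 * m)" "monom (1 :: 'q) (2 * m + 1)"]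
    by (simp add: degree_monom_eq)
  define c where "c i = [:coeff f0 i, coeff f1 i - coeff f0 i:] + (if i = 0 then e else 0)" for i
  have c0: "c i = 0" if "i > m" for i using that f0 f1 by (simp add: c_def coeff_eq_0)
  hence "\<forall>\<^sub>\<infinity>i. c i = 0" unfolding MOST_nat by blast
  hence nth: "coeff (Abs_poly c) i = c i" for i by (simp add: Abs_poly_inverse)
  define f where "f = Abs_poly c"
  have cm: "c m = 1" using m f0 f1 by (simp add: c_def one_pCons)
  have deg: "degree f = m"
  proof (rule antisym)
    show "degree f \<le> m" by (rule degree_le) (simp add: f_def nth c0)
    show "m \<le> degree f" by (rule le_degree) (simp add: f_def nth cm)
  qed
  have lc: "lead_coeff f = 1" unfolding deg by (simp add: f_def nth cm)
  have ev: "map_poly (\<lambda>p. poly p 0) f = f0" "map_poly (\<lambda>p. poly p 1) f = f1"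
    by (rule poly_eqI, simp add: coeff_map_poly f_def nth c_def e)+
  have "poly (map_poly to_fract f) x \<noteq> 0" for x
  proof (rule no_rational_root[OF deg m lc])
    show "degree (coeff f i) \<le> 1" if "0 < i" "i < m" for i
      using that by (simp add: f_def nth c_def)
    have "degree (e + [:coeff f0 0, coeff f1 0 - coeff f0 0:]) = degree e"
      by (rule degree_add_eq_left) (use m in \<open>simp add: dege\<close>)
    thus "degree (coeff f 0) = 2 * m + 1" by (simp add: f_def nth c_def dege add.commute)
  qed
  with deg lc ev show ?thesis by (rule that)
qed

text \<open>
  For \<open>m \<ge> 2\<close>, the polynomial is prescribed at \<open>t = 0\<close> and \<open>t = 1\<close>. At 0 its roots are 0 and one Frobenius orbit of
  length \<open>m - 1\<close>, which gives a permutation with one fixed root that is transitive on the others. At 1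
  there is one Frobenius orbit of length 2 and all other orbits have odd length; an odd power of this
  Frobenius element is a transposition. As there are no rational roots, the fixed root of the first
  permutation is moved by some automorphism. These three facts force the full symmetric group.
\<close>

theorem symmetric_galois_group_exists:
  assumes "m \<ge> 1"
  obtains Z :: "'q :: {field, finite} poly fract alg_closure set" where
    "finite Z" "card Z = m" "roots_poly Z \<in> polys_over (range to_ac)"
    "\<And>\<pi>. \<pi> permutes Z \<Longrightarrow> \<pi> \<in> galois_perms Z"
proof (cases "m = 1")
  case True
  show ?thesis
  proof (rule that[of "{0}"])
    show "roots_poly {0 :: 'q poly fract alg_closure} \<in> polys_over (range to_ac)"
      using subfldD(1)[OF subfld_range_to_ac] by (intro roots_poly_over subfld_range_to_ac) auto
    show "\<pi> \<in> galois_perms {0}" if "\<pi> permutes {0}" for \<pi> :: "'q poly fract alg_closure \<Rightarrow> _"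
      using that id_in_galois_perms by (simp add: permutes_sing)
  qed (use True in auto)
next
  case False
  hence m: "m \<ge> 2" using assms by simp
  let ?q = "CARD('q)"
  have q0: "?q > 0" by simp
  \<comment> \<open>the roots at \<open>t = 0\<close>: one fixed by Frobenius, and one orbit of length \<open>m - 1\<close>\<close>
  obtain W :: "'q alg_closure set" where W: "finite W" "card W = m - 1" "frob ` W \<subseteq> W" "0 \<notin> W"
    "\<And>x y. x \<in> W \<Longrightarrow> y \<in> W \<Longrightarrow> \<exists>n. x ^ (?q ^ n) = y"
    using frob_orbit_exists[of "m - 1", where ?'q = 'q] m by (metis One_nat_def Suc_1 Suc_le_lessD zero_less_diff)
  define W0 where "W0 = insert 0 W"
  have W0: "finite W0" "card W0 = m" "frob ` W0 \<subseteq> W0" using W m by (auto simp: W0_def)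
  \<comment> \<open>the roots at \<open>t = 1\<close>: an orbit of length 2, and a set on which \<open>N\<close>-fold Frobenius is trivial\<close>
  obtain w :: "'q alg_closure" where w: "w ^ (?q ^ 2) = w" "frob w \<noteq> w"
    using exact_frob_period_exists[of 2, where ?'q = 'q] by (metis power_one_right less_numeral_extra(1) one_less_numeral_iff pos2 semiring_norm(76))
  obtain V :: "'q alg_closure set" and N where V: "finite V" "card V = m - 2" "frob ` V \<subseteq> V" "odd N"
    "\<And>x. x \<in> V \<Longrightarrow> x ^ (?q ^ N) = x"
    using odd_frob_stable_set_exists[where ?'q = 'q and k = "m - 2"] by blast
  have ffw: "frob (frob w) = w" using w(1) by (simp add: power2_eq_square power_mult)
  have wpow: "w ^ (?q ^ N) = frob w" "(frob w) ^ (?q ^ N) = w"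
  proof -
    have even: "x ^ (?q ^ (2 * j)) = x" if "x ^ (?q ^ 2) = x" for x :: "'q alg_closure" and j
    proof (induction j)
      case (Suc j)
      have "x ^ (?q ^ (2 * Suc j)) = (x ^ (?q ^ 2)) ^ (?q ^ (2 * j))"
        by (simp only: mult_Suc_right power_add power_mult)
      thus ?case using that Suc by (simp only:)
    qed simp
    obtain j where j: "N = 2 * j + 1" using V(4) by (rule oddE)
    show 1: "w ^ (?q ^ N) = frob w" using even[OF w(1), of j] by (simp add: j power_mult mult.commute[of ?q])
    have "(frob w) ^ (?q ^ N) = frob (w ^ (?q ^ N))" by (simp flip: power_mult add: mult.commute)
    thus "(frob w) ^ (?q ^ N) = w" using 1 ffw by simp
  qed
  have wV: "w \<notin> V" "frob w \<notin> V" using V(5) wpow w(2) by metis+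
  define W1 where "W1 = {w, frob w} \<union> V"
  have W1: "finite W1" "card W1 = m" "frob ` W1 \<subseteq> W1"
    using V m wV w(2) ffw by (auto simp: W1_def card_insert_if)
  obtain f0 :: "'q poly" where f0: "map_poly to_ac f0 = roots_poly W0"
    using frob_stable_roots_poly[OF W0(1,3)] by blast
  obtain f1 :: "'q poly" where f1: "map_poly to_ac f1 = roots_poly W1"
    using frob_stable_roots_poly[OF W1(1,3)] by blast
  have monic: "degree g = card Y \<and> lead_coeff g = 1" if "map_poly to_ac g = roots_poly Y" for g :: "'q poly" and Y
  proof -
    have "degree (map_poly to_ac g) = degree g" by (rule degree_map_poly) simp
    hence deg: "degree g = card Y" using that by (simp add: degree_roots_poly)
    have "to_ac (coeff g (card Y)) = coeff (roots_poly Y) (card Y)" by (simp add: coeff_map_poly flip: that)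
    thus ?thesis using lead_coeff_roots_poly[of Y] deg by (simp add: degree_roots_poly)
  qed
  obtain f :: "'q poly poly" where f: "degree f = m" "lead_coeff f = 1"
    "map_poly (\<lambda>p. poly p 0) f = f0" "map_poly (\<lambda>p. poly p 1) f = f1"
    and irr: "\<And>x. poly (map_poly to_fract f) x \<noteq> 0"
    using interpolating_polynomial[OF m, of f0 f1] monic[OF f0] monic[OF f1] W0 W1 by metis
  have red0: "map_poly (\<lambda>p. to_ac (poly p 0)) f = roots_poly W0"
    unfolding f0[symmetric] f(3)[symmetric] by (rule poly_eqI) (simp add: coeff_map_poly)
  have red1: "map_poly (\<lambda>p. to_ac (poly p 1)) f = roots_poly W1"
    unfolding f1[symmetric] f(4)[symmetric] by (rule poly_eqI) (simp add: coeff_map_poly)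
  define fL where "fL = map_poly (\<lambda>p. to_ac (to_fract p)) f"
  define Z where "Z = {z. poly fL z = 0}"
  obtain \<kappa> \<sigma> where \<sigma>: "finite Z" "card Z = degree f" "bij_betw \<kappa> Z W0" "\<sigma> \<in> galois_perms Z"
    "\<And>z. z \<in> Z \<Longrightarrow> \<sigma> z \<in> Z \<and> \<kappa> (\<sigma> z) = frob (\<kappa> z)"
    using frobenius_perm_at_place[OF f(2) W0(1,3) red0] unfolding Z_def fL_def by blast
  obtain \<kappa>' \<sigma>' where \<sigma>': "bij_betw \<kappa>' Z W1" "\<sigma>' \<in> galois_perms Z"
    "\<And>z. z \<in> Z \<Longrightarrow> \<sigma>' z \<in> Z \<and> \<kappa>' (\<sigma>' z) = frob (\<kappa>' z)"
    using frobenius_perm_at_place[OF f(2) W1(1,3) red1] unfolding Z_def fL_def by blast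
  have degfL: "degree fL = m" unfolding fL_def using f by (subst degree_map_poly_lead) auto
  have "lead_coeff fL = 1" unfolding degfL using f by (simp add: fL_def coeff_map_poly)
  hence fLZ: "fL = roots_poly Z"
    using \<sigma>(1,2) f(1) degfL by (intro roots_poly_unique) (auto simp: Z_def)
  have over: "roots_poly Z \<in> polys_over (range to_ac)"
    unfolding fLZ[symmetric] by (simp add: fL_def polys_over_def coeff_map_poly)
  have norat: "z \<notin> range to_ac" if "z \<in> Z" for z
  proof
    assume "z \<in> range to_ac"
    then obtain x where x: "z = to_ac x" by blast
    have "fL = map_poly to_ac (map_poly to_fract f)"
      unfolding fL_def by (rule poly_eqI) (simp add: coeff_map_poly)
    hence "poly fL z = to_ac (poly (map_poly to_fract f) x)"
      using fhom_poly[OF fhom_to_ac subfld_UNIV polys_over_UNIV UNIV_I] x by metis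
    thus False using that irr by (simp add: Z_def)
  qed
  have it: "(\<sigma> ^^ n) z \<in> Z \<and> \<kappa> ((\<sigma> ^^ n) z) = \<kappa> z ^ (?q ^ n)" if "z \<in> Z" for z n
    using \<sigma>(5) that by (rule funpow_frob_equivariant)
  have it': "(\<sigma>' ^^ n) z \<in> Z \<and> \<kappa>' ((\<sigma>' ^^ n) z) = \<kappa>' z ^ (?q ^ n)" if "z \<in> Z" for z n
    using \<sigma>'(3) that by (rule funpow_frob_equivariant)
  have inj: "x = y" if "x \<in> Z" "y \<in> Z" "\<kappa> x = \<kappa> y" for x y
    using \<sigma>(3) that unfolding bij_betw_def by (auto dest: inj_onD)
  have inj': "x = y" if "x \<in> Z" "y \<in> Z" "\<kappa>' x = \<kappa>' y" for x y
    using \<sigma>'(1) that unfolding bij_betw_def by (auto dest: inj_onD)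
  have permD: "\<pi> permutes Z" if "\<pi> \<in> galois_perms Z" for \<pi> using that by (simp add: galois_perms_def)
  have "0 \<in> \<kappa> ` Z" using \<sigma>(3) by (simp add: bij_betw_def W0_def)
  then obtain r where r: "r \<in> Z" "\<kappa> r = 0" by auto
  have \<sigma>r: "\<sigma> r = r" using \<sigma>(5)[OF r(1)] r by (intro inj) auto
  have \<kappa>W: "\<kappa> x \<in> W" if "x \<in> Z - {r}" for x
    using \<sigma>(3) inj[of x r] that r by (auto simp: bij_betw_def W0_def)
  have cycle: "\<exists>n. (\<sigma> ^^ n) x = y" if xy: "x \<in> Z - {r}" "y \<in> Z - {r}" for x y
  proof -
    obtain n where "\<kappa> x ^ (?q ^ n) = \<kappa> y" using W(5)[OF \<kappa>W \<kappa>W] xy by blast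
    thus ?thesis using it[of x n] xy by (intro exI[of _ n] inj) auto
  qed
  have "w \<in> \<kappa>' ` Z" "frob w \<in> \<kappa>' ` Z" using \<sigma>'(1) by (auto simp: bij_betw_def W1_def)
  then obtain a b where ab: "a \<in> Z" "\<kappa>' a = w" "b \<in> Z" "\<kappa>' b = frob w" by (auto simp: image_iff)
  have abne: "a \<noteq> b" using ab w(2) by auto
  have "\<sigma>' ^^ N = Transposition.transpose a b"
  proof
    fix x
    consider "x \<notin> Z" | "x = a" | "x = b" | "x \<in> Z" "x \<noteq> a" "x \<noteq> b" by blast
    thus "(\<sigma>' ^^ N) x = Transposition.transpose a b x"
    proof cases
      case 1
      have "\<sigma>' x = x" using permD[OF \<sigma>'(2)] 1 by (rule permutes_not_in)
      hence "(\<sigma>' ^^ N) x = x" by (induction N) auto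
      thus ?thesis using 1 ab by (auto simp: Transposition.transpose_def)
    next
      case 2
      have "(\<sigma>' ^^ N) a = b" using it'[OF ab(1), of N] ab wpow by (intro inj') auto
      thus ?thesis using 2 by simp
    next
      case 3
      have "(\<sigma>' ^^ N) b = a" using it'[OF ab(3), of N] ab wpow by (intro inj') auto
      thus ?thesis using 3 by simp
    next
      case 4
      have "\<kappa>' x \<in> W1" using \<sigma>'(1) 4 by (auto simp: bij_betw_def)
      moreover have "\<kappa>' x \<noteq> w" "\<kappa>' x \<noteq> frob w" using inj' 4 ab by metis+
      ultimately have "\<kappa>' x \<in> V" by (simp add: W1_def)
      hence "(\<sigma>' ^^ N) x = x" using it'[OF 4(1), of N] V(5) 4 by (intro inj') auto
      thus ?thesis using 4 by (simp add: transpose_apply_other)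
    qed
  qed
  moreover have "\<sigma>' ^^ n \<in> galois_perms Z" for n
    by (induction n) (simp_all only: funpow.simps id_in_galois_perms galois_perms_comp \<sigma>'(2))
  ultimately have swap: "Transposition.transpose a b \<in> galois_perms Z" by metis
  obtain s where s: "s \<in> galois_perms Z" "s r \<noteq> r"
    using irrational_root_moved[OF \<sigma>(1) over r(1) norat[OF r(1)]] by blast
  have "\<pi> \<in> galois_perms Z" if "\<pi> permutes Z" for \<pi>
    by (rule transposition_and_cycle_generate[OF \<sigma>(1) permD id_in_galois_perms galois_perms_comp
          \<sigma>(4) r(1) \<sigma>r cycle swap ab(1,3) abne s that])
  thus ?thesis using \<sigma>(1,2) f(1) over by (intro that) auto
qed


section \<open>The degree of the splitting field\<close>

lemma vector_space_to_ac: "vector_space (\<lambda>(c :: 'k :: field) x. to_ac c * x)"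
  by unfold_locales (auto simp: algebra_simps)

text \<open>
  After the roots in \<open>Y\<close> have been adjoined, the next root is annihilated by the product over the roots
  outside \<open>Y\<close>, which has degree \<open>card Z - card Y\<close> and coefficients in the field already
  constructed. Multiplying a spanning set by the powers of the root below that degree gives the next
  spanning set, and the degrees multiply up to the factorial.
\<close>

lemma splitting_field_dim:
  fixes Z :: "'k :: field alg_closure set"
  assumes fin: "finite Z" and over: "roots_poly Z \<in> polys_over (range to_ac)"
  obtains B where "finite B" "card B \<le> fact (card Z)"
    "adjoin (range to_ac) Z \<subseteq> module.span (\<lambda>(c :: 'k) x. to_ac c * x) B"
proof -
  interpret V: vector_space "\<lambda>(c :: 'k) x. to_ac c * x" by (rule vector_space_to_ac)
  let ?K = "range (to_ac :: 'k \<Rightarrow> _)"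
  have shift: "x * y \<in> V.span ((\<lambda>b. b * y) ` B)" if "x \<in> V.span B" for x y B
    using that
  proof (rule V.span_induct)
    show "V.subspace {x. x * y \<in> V.span ((\<lambda>b. b * y) ` B)}"
      unfolding V.subspace_def mem_Collect_eq
    proof (intro conjI ballI allI impI)
      show "0 * y \<in> V.span ((\<lambda>b. b * y) ` B)" by (simp add: V.span_zero)
      show "(u + v) * y \<in> V.span ((\<lambda>b. b * y) ` B)"
        if "u \<in> {x. x * y \<in> V.span ((\<lambda>b. b * y) ` B)}" "v \<in> {x. x * y \<in> V.span ((\<lambda>b. b * y) ` B)}" for u v
        using that by (simp add: distrib_right V.span_add)
      show "to_ac c * u * y \<in> V.span ((\<lambda>b. b * y) ` B)"
        if "u \<in> {x. x * y \<in> V.span ((\<lambda>b. b * y) ` B)}" for c u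
        using that V.span_scale[of "u * y" _ c] by (simp add: mult.assoc)
    qed
    show "b * y \<in> V.span ((\<lambda>b. b * y) ` B)" if "b \<in> B" for b
      using that by (intro V.span_base) auto
  qed
  have "\<exists>B. finite B \<and> card B * fact (card Z - card Y) \<le> fact (card Z) \<and> adjoin ?K Y \<subseteq> V.span B"
    if "Y \<subseteq> Z" for Y
    using finite_subset[OF that fin] that
  proof (induction Y rule: finite_induct)
    case empty
    have "x \<in> V.span {1}" if "x \<in> ?K" for x
      using that V.span_scale[OF V.span_base[of 1 "{1}"]] by force
    thus ?case using adjoin_empty[OF subfld_range_to_ac] by (intro exI[of _ "{1}"]) auto
  next
    case (insert y Y)
    let ?E = "adjoin ?K Y"
    obtain B where B: "finite B" "card B * fact (card Z - card Y) \<le> (fact (card Z) :: nat)" "?E \<subseteq> V.span B"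
      using insert by blast
    have E: "subfld ?E" by (rule subfld_adjoin)
    have finZY: "finite (Z - Y)" using fin by simp
    have "roots_poly Z = roots_poly Y * roots_poly (Z - Y)"
      unfolding roots_poly_def using prod.subset_diff[of Y Z] insert.prems fin by (simp add: mult.commute)
    moreover have "roots_poly Z \<in> polys_over ?E" using over adjoin_base polys_over_mono by blast
    moreover have "roots_poly Y \<in> polys_over ?E" by (intro roots_poly_over E adjoin_gens)
    ultimately have p: "roots_poly (Z - Y) \<in> polys_over ?E"
      using polys_over_cofactor[OF E _ roots_poly_nonzero] by metis
    have yroot: "poly (roots_poly (Z - Y)) y = 0"
      using insert.hyps insert.prems finZY by (simp add: poly_roots_poly)
    define d where "d = card Z - card Y"
    have cardZY: "card (Z - Y) = d" unfolding d_def using insert by (intro card_Diff_subset) auto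
    have "card (insert y Y) \<le> card Z" using insert.prems fin by (intro card_mono)
    hence d: "d \<ge> 1" "card Z - card (insert y Y) = d - 1"
      using insert.hyps by (auto simp: d_def)
    define B' where "B' = (\<lambda>(b, i). b * y ^ i) ` (B \<times> {..<d})"
    have "card B' \<le> card (B \<times> {..<d})" unfolding B'_def using B(1) by (intro card_image_le) auto
    hence cardB': "card B' \<le> card B * d" by (simp add: card_cartesian_product)
    have "card B' * fact (d - 1) \<le> card B * d * fact (d - 1)" using cardB' by (rule mult_le_mono1)
    also have "\<dots> = card B * fact d" using d(1) by (simp add: fact_reduce)
    also have "\<dots> \<le> fact (card Z)" using B(2) by (simp add: d_def)
    finally have bound: "card B' * fact (card Z - card (insert y Y)) \<le> fact (card Z)" using d(2) by simp
    have "x \<in> V.span B'" if x: "x \<in> adjoin ?E {y}" for x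
    proof -
      obtain q where q: "q \<in> polys_over ?E" "x = poly q y"
        using x adjoin_simple[OF E p roots_poly_nonzero yroot] by blast
      obtain s r where sr: "s \<in> polys_over ?E" "r \<in> polys_over ?E" "q = roots_poly (Z - Y) * s + r"
        "r = 0 \<or> degree r < degree (roots_poly (Z - Y))"
        using polys_over_division[OF E p roots_poly_nonzero q(1)] by blast
      have "x = poly r y" using q(2) sr(3) yroot by simp
      also have "\<dots> = (\<Sum>i\<le>degree r. coeff r i * y ^ i)" by (rule poly_altdef)
      also have "\<dots> \<in> V.span B'"
      proof (rule V.span_sum)
        fix i assume i: "i \<in> {..degree r}"
        show "coeff r i * y ^ i \<in> V.span B'"
        proof (cases "r = 0")
          case True
          thus ?thesis by (simp add: V.span_zero)
        next
          case False
          hence "i < d" using i sr(4) by (simp add: degree_roots_poly cardZY)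
          hence "(\<lambda>b. b * y ^ i) ` B \<subseteq> B'" by (auto simp: B'_def)
          moreover have "coeff r i \<in> V.span B" using B(3) polys_over_coeff[OF sr(2)] by blast
          ultimately show ?thesis using shift V.span_mono by blast
        qed
      qed
      finally show ?thesis .
    qed
    moreover have "adjoin ?E {y} = adjoin ?K (insert y Y)" by (simp add: adjoin_adjoin)
    moreover have "finite B'" unfolding B'_def using B(1) by auto
    ultimately show ?case using bound by blast
  qed
  from this[of Z] show ?thesis using that by auto
qed

lemma min_poly_irreducible:
  fixes x :: "'k :: field alg_closure"
  obtains P :: "'k poly" where "Factorial_Ring.irreducible P" "lead_coeff P = 1" "degree P > 0"
    "poly (map_poly to_ac P) x = 0" "\<And>q. poly (map_poly to_ac q) x = 0 \<Longrightarrow> P dvd q"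
proof -
  note hom = map_poly_fhom[OF fhom_to_ac subfld_UNIV polys_over_UNIV polys_over_UNIV]
  obtain p0 :: "'k poly" where p0: "p0 \<noteq> 0" "poly (map_poly to_ac p0) x = 0"
    by (rule alg_closure_algebraic)
  have p0K: "map_poly to_ac p0 \<in> polys_over (range to_ac)" "map_poly to_ac p0 \<noteq> 0"
    using p0(1) by (auto simp: polys_over_def coeff_map_poly map_poly_eq_0_iff)
  obtain \<mu> where \<mu>: "\<mu> \<in> polys_over (range (to_ac :: 'k \<Rightarrow> _))" "lead_coeff \<mu> = 1" "poly \<mu> x = 0"
    and min: "\<And>q. q \<in> polys_over (range to_ac) \<Longrightarrow> poly q x = 0 \<Longrightarrow> \<exists>s \<in> polys_over (range to_ac). q = \<mu> * s"
    using min_poly_exists[OF subfld_range_to_ac p0K p0(2)] by blast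
  have lift: "\<exists>P. map_poly to_ac P = p" if "p \<in> polys_over (range (to_ac :: 'k \<Rightarrow> _))" for p
  proof (rule exI)
    have "of_ac 0 = (0 :: 'k)" by (rule of_ac_eqI) simp
    thus "map_poly to_ac (map_poly of_ac p) = p"
      by (intro poly_eqI) (simp add: coeff_map_poly to_ac_of_ac[OF polys_over_coeff[OF that]])
  qed
  obtain P where P: "map_poly to_ac P = \<mu>" using lift[OF \<mu>(1)] by blast
  have inj: "p = q" if "map_poly to_ac p = map_poly to_ac q" for p q :: "'k poly"
  proof (rule poly_eqI)
    show "coeff p n = coeff q n" for n
      using arg_cong[OF that, of "\<lambda>r. coeff r n"] by (simp add: coeff_map_poly)
  qed
  have dvd: "P dvd q" if q: "poly (map_poly to_ac q) x = 0" for q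
  proof -
    have "map_poly to_ac q \<in> polys_over (range to_ac)" by (simp add: polys_over_def coeff_map_poly)
    from min[OF this q] obtain s where
      s: "s \<in> polys_over (range (to_ac :: 'k \<Rightarrow> _))" "map_poly to_ac q = \<mu> * s" by blast
    obtain S where "map_poly to_ac S = s" using lift[OF s(1)] by blast
    hence "q = P * S" using s(2) P by (intro inj) (simp add: hom)
    thus ?thesis by simp
  qed
  have degmap: "degree (map_poly to_ac q) = degree q" for q :: "'k poly" by (rule degree_map_poly) simp
  have "to_ac (lead_coeff P) = lead_coeff \<mu>" unfolding P[symmetric] degmap by (simp add: coeff_map_poly)
  hence lc: "lead_coeff P = 1" using \<mu>(2) by simp
  have P0: "P \<noteq> 0" using lc by auto
  have root: "poly (map_poly to_ac P) x = 0" using P \<mu>(3) by simp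
  have deg: "degree P > 0"
  proof (rule ccontr)
    assume "\<not> degree P > 0"
    then obtain c where "P = [:c:]" by (metis degree_eq_zeroE gr0I)
    thus False using lc root by (simp add: map_poly_pCons)
  qed
  have "Factorial_Ring.irreducible P"
  proof (rule irreducibleI)
    show "P \<noteq> 0" by (rule P0)
    show "\<not> P dvd 1" using deg P0 by (simp add: is_unit_iff_degree)
    fix A B assume AB: "P = A * B"
    have ne: "A \<noteq> 0" "B \<noteq> 0" using P0 AB by auto
    have sum: "degree A + degree B = degree P" using AB ne by (simp add: degree_mult_eq)
    have "poly (map_poly to_ac A) x * poly (map_poly to_ac B) x = 0"
      using root unfolding AB by (simp add: hom)
    hence "P dvd A \<or> P dvd B" using dvd by auto
    hence "degree P \<le> degree A \<or> degree P \<le> degree B" using ne dvd_imp_degree_le by blast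
    hence "degree B = 0 \<or> degree A = 0" using sum by auto
    thus "A dvd 1 \<or> B dvd 1" using ne by (auto simp: is_unit_iff_degree)
  qed
  thus ?thesis using that lc deg root dvd by blast
qed

lemma powers_independent:
  fixes x :: "'k :: field alg_closure"
  assumes "\<And>q :: 'k poly. q \<noteq> 0 \<Longrightarrow> poly (map_poly to_ac q) x = 0 \<Longrightarrow> n \<le> degree q"
  shows "inj_on (\<lambda>i. x ^ i) {..<n}"
    "\<not> module.dependent (\<lambda>(c :: 'k) x. to_ac c * x) ((\<lambda>i. x ^ i) ` {..<n})"
proof -
  interpret V: vector_space "\<lambda>(c :: 'k) x. to_ac c * x" by (rule vector_space_to_ac)
  have zero: "u i = 0" if sum: "(\<Sum>i<n. to_ac (u i) * x ^ i) = 0" and i: "i < n" for u :: "nat \<Rightarrow> 'k" and i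
  proof -
    define q where "q = (\<Sum>i<n. monom (u i) i)"
    have cq: "coeff q j = (if j < n then u j else 0)" for j
      unfolding q_def coeff_sum by (simp add: sum.delta)
    have "degree q < n" using i by (intro degree_lessI) (auto simp: cq)
    have "degree q \<le> n - 1" by (rule degree_le) (use i in \<open>auto simp: cq\<close>)
    hence dq: "degree (map_poly to_ac q) < n"
      using i by (subst degree_map_poly) auto
    have "poly (map_poly to_ac q) x = (\<Sum>i<n. coeff (map_poly to_ac q) i * x ^ i)"
      unfolding poly_altdef using dq by (intro sum.mono_neutral_left) (auto simp: coeff_eq_0)
    also have "\<dots> = 0" using sum by (simp add: coeff_map_poly cq)
    finally have "q = 0" using assms[of q] \<open>degree q < n\<close> by (metis leD)
    thus ?thesis using cq[of i] i by simp
  qed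
  show inj: "inj_on (\<lambda>i. x ^ i) {..<n}"
  proof (rule inj_onI, rule ccontr)
    fix i j assume ij: "i \<in> {..<n}" "j \<in> {..<n}" "x ^ i = x ^ j" "i \<noteq> j"
    define u :: "nat \<Rightarrow> 'k" where "u l = (if l = i then 1 else if l = j then - 1 else 0)" for l
    have "(\<Sum>l<n. to_ac (u l) * x ^ l) = (\<Sum>l\<in>{i, j}. to_ac (u l) * x ^ l)"
      using ij by (intro sum.mono_neutral_right) (auto simp: u_def)
    also have "\<dots> = 0" using ij by (simp add: u_def)
    finally have "u i = 0" using ij by (intro zero) auto
    thus False by (simp add: u_def)
  qed
  show "V.independent ((\<lambda>i. x ^ i) ` {..<n})"
  proof (rule V.independent_if_scalars_zero)
    fix f y assume sum: "(\<Sum>y\<in>(\<lambda>i. x ^ i) ` {..<n}. to_ac (f y) * y) = 0" and "y \<in> (\<lambda>i. x ^ i) ` {..<n}"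
    then obtain i where i: "i < n" "y = x ^ i" by auto
    have "(\<Sum>i<n. to_ac (f (x ^ i)) * x ^ i) = 0" using sum by (simp add: sum.reindex[OF inj])
    thus "f y = 0" unfolding i(2) using i(1) by (rule zero)
  qed simp
qed


section \<open>Splitting fields with full symmetric Galois group\<close>

locale symmetric_splitting =
  fixes Z :: "'k :: field alg_closure set"
  assumes fin: "finite Z"
    and over: "roots_poly Z \<in> polys_over (range to_ac)"
    and full: "\<pi> permutes Z \<Longrightarrow> \<pi> \<in> galois_perms Z"
begin

abbreviation "K \<equiv> range (to_ac :: 'k \<Rightarrow> _)"
abbreviation "L \<equiv> adjoin K Z"

text \<open>
  Any two choices of \<open>\<tau>\<close> agree on the splitting field, which is generated by \<open>Z\<close>.
\<close>

definition act :: "('k alg_closure \<Rightarrow> 'k alg_closure) \<Rightarrow> 'k alg_closure \<Rightarrow> 'k alg_closure" where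
  "act \<pi> = (SOME \<tau>. fhom L \<tau> \<and> (\<forall>a. \<tau> (to_ac a) = to_ac a) \<and> (\<forall>z \<in> Z. \<tau> z = \<pi> z))"

lemma L: "subfld L"
  by (rule subfld_adjoin)

lemma to_ac_in_L: "to_ac a \<in> L"
  by (rule subsetD[OF adjoin_base]) simp

lemma Z_in_L: "z \<in> Z \<Longrightarrow> z \<in> L"
  by (rule subsetD[OF adjoin_gens])

lemma act:
  assumes "\<pi> permutes Z"
  shows "fhom L (act \<pi>)" "act \<pi> (to_ac a) = to_ac a" "z \<in> Z \<Longrightarrow> act \<pi> z = \<pi> z"
proof -
  have "\<exists>\<tau>. fhom L \<tau> \<and> (\<forall>a. \<tau> (to_ac a) = to_ac a) \<and> (\<forall>z \<in> Z. \<tau> z = \<pi> z)"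
    using full[OF assms] by (simp add: galois_perms_def)
  from someI_ex[OF this]
  show "fhom L (act \<pi>)" "act \<pi> (to_ac a) = to_ac a" "z \<in> Z \<Longrightarrow> act \<pi> z = \<pi> z"
    unfolding act_def by blast+
qed

lemma hom_eq_on_L:
  assumes "fhom L \<sigma>" "fhom L \<tau>" "\<And>a. \<sigma> (to_ac a) = to_ac a" "\<And>a. \<tau> (to_ac a) = to_ac a"
    "\<And>z. z \<in> Z \<Longrightarrow> \<sigma> z = \<tau> z" "x \<in> L"
  shows "\<sigma> x = \<tau> x"
  using assms by (intro fhom_eq_on_adjoin[of K Z \<sigma> \<tau> x]) auto

lemma hom_into_L:
  assumes "fhom L \<sigma>" "\<And>a. \<sigma> (to_ac a) = to_ac a" "\<And>z. z \<in> Z \<Longrightarrow> \<sigma> z \<in> Z" "x \<in> L"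
  shows "\<sigma> x \<in> L"
proof -
  have "\<sigma> ` L \<subseteq> L" using assms to_ac_in_L Z_in_L by (intro fhom_image_subset L) auto
  thus ?thesis using assms(4) by blast
qed

lemma act_in_L: "\<pi> permutes Z \<Longrightarrow> x \<in> L \<Longrightarrow> act \<pi> x \<in> L"
  using act by (intro hom_into_L[of "act \<pi>"]) (auto simp: permutes_in_image)

lemma act_comp:
  assumes "\<pi> permutes Z" "\<rho> permutes Z" "x \<in> L"
  shows "act (\<pi> \<circ> \<rho>) x = act \<pi> (act \<rho> x)"
proof (rule hom_eq_on_L[OF _ _ _ _ _ assms(3)])
  note comp = permutes_compose[OF assms(2,1)]
  show "fhom L (act (\<pi> \<circ> \<rho>))" by (rule act[OF comp])
  show "fhom L (\<lambda>x. act \<pi> (act \<rho> x))"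
    unfolding fhom_def
    by (auto simp: fhomD[OF act(1)[OF assms(1)] L] fhomD[OF act(1)[OF assms(2)] L] act_in_L[OF assms(2)])
  show "act (\<pi> \<circ> \<rho>) z = act \<pi> (act \<rho> z)" if "z \<in> Z" for z
    using that by (simp add: act[OF comp] act[OF assms(1)] act[OF assms(2)] permutes_in_image[OF assms(2)])
qed (simp_all only: act(2)[OF assms(1)] act(2)[OF assms(2)] act(2)[OF permutes_compose[OF assms(2,1)]])

lemma act_id: "x \<in> L \<Longrightarrow> act id x = x"
proof (rule hom_eq_on_L[of "act id" "\<lambda>x. x" x])
  show "fhom L (\<lambda>x. x)" by (simp add: fhom_def)
qed (simp_all only: act[OF permutes_id] id_apply)

lemma act_inv:
  assumes "\<pi> permutes Z" "x \<in> L"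
  shows "act (inv_into UNIV \<pi>) (act \<pi> x) = x" "act \<pi> (act (inv_into UNIV \<pi>) x) = x"
  using act_comp[OF permutes_inv[OF assms(1)] assms] act_comp[OF assms(1) permutes_inv[OF assms(1)] assms(2)]
    act_id[OF assms(2)] permutes_inv_o[OF assms(1)] by simp_all

lemma act_poly:
  assumes "\<pi> permutes Z" "x \<in> L"
  shows "act \<pi> (poly (map_poly to_ac q) x) = poly (map_poly to_ac q) (act \<pi> x)"
proof -
  have q: "map_poly to_ac q \<in> polys_over L"
    using to_ac_in_L by (simp add: polys_over_def coeff_map_poly)
  have "map_poly (act \<pi>) (map_poly to_ac q) = map_poly to_ac q"
    by (rule poly_eqI) (simp add: coeff_map_poly act[OF assms(1)] fhomD(4)[OF act(1)[OF assms(1)] L])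
  thus ?thesis using fhom_poly[OF act(1)[OF assms(1)] L q assms(2)] by simp
qed

lemma Gal_carrier:
  "\<sigma> \<in> carrier (Gal L) \<longleftrightarrow>
     \<sigma> \<in> extensional L \<and> bij_betw \<sigma> L L \<and> fhom L \<sigma> \<and> (\<forall>c. \<sigma> (to_ac c) = to_ac c)"
  unfolding Gal_def Bij_def ring_iso_def Ring.ring_hom_def fhom_def ring_of_type_algebra_def
  by (auto simp: bij_betw_def)

lemma hom_maps_roots:
  assumes "fhom L \<sigma>" "\<And>a. \<sigma> (to_ac a) = to_ac a" "z \<in> Z"
  shows "\<sigma> z \<in> Z"
proof -
  have \<sigma>0: "\<sigma> 0 = 0" by (rule fhomD(4)[OF assms(1) L])
  have "\<sigma> (coeff (roots_poly Z) i) = coeff (roots_poly Z) i" for i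
    using polys_over_coeff[OF over, of i] assms(2) by auto
  hence "map_poly \<sigma> (roots_poly Z) = roots_poly Z"
    by (intro poly_eqI) (simp add: coeff_map_poly \<sigma>0)
  hence "poly (roots_poly Z) (\<sigma> z) = \<sigma> (poly (roots_poly Z) z)"
    using fhom_poly[OF assms(1) L polys_over_mono[OF adjoin_base over] Z_in_L[OF assms(3)]] by simp
  also have "poly (roots_poly Z) z = 0" using assms(3) fin by (simp add: poly_roots_poly)
  finally show ?thesis using \<sigma>0 fin by (simp add: poly_roots_poly)
qed

lemma hom_permutes_roots:
  assumes "fhom L \<sigma>" "\<And>a. \<sigma> (to_ac a) = to_ac a"
  shows "(\<lambda>z. if z \<in> Z then \<sigma> z else z) permutes Z"
  using galois_perm_of_hom[OF fin assms hom_maps_roots[OF assms]] by (simp add: galois_perms_def)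

lemma restrict_act_in_Gal:
  assumes "\<pi> permutes Z"
  shows "restrict (act \<pi>) L \<in> carrier (Gal L)"
  unfolding Gal_carrier
proof (intro conjI allI)
  have "bij_betw (act \<pi>) L L"
    by (rule bij_betw_byWitness[of _ "act (inv_into UNIV \<pi>)"])
      (auto simp: act_inv[OF assms] act_in_L[OF assms] act_in_L[OF permutes_inv[OF assms]])
  thus "bij_betw (restrict (act \<pi>) L) L L" by (simp cong: bij_betw_cong)
  show "fhom L (restrict (act \<pi>) L)"
    using act(1)[OF assms] subfldD[OF L] by (auto simp: fhom_def)
  show "restrict (act \<pi>) L (to_ac c) = to_ac c" for c
    using to_ac_in_L act(2)[OF assms] by simp
qed simp

text \<open>
  The isomorphism restricts an automorphism to the roots and transports the resulting permutation to
  \<open>{1..card Z}\<close> by an enumeration \<open>e\<close> of the roots.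
\<close>

theorem Gal_iso_sym_group: "Gal L \<cong> sym_group (card Z)"
proof -
  let ?m = "card Z" and ?I = "{1..card Z}"
  obtain e where e: "bij_betw e Z ?I" using finite_same_card_bij[OF fin, of ?I] by auto
  define f where "f = inv_into Z e"
  have f: "bij_betw f ?I Z" unfolding f_def by (rule bij_betw_inv_into[OF e])
  have fe: "f (e z) = z" if "z \<in> Z" for z using e that by (simp add: f_def bij_betw_def)
  have ef: "e (f i) = i" if "i \<in> ?I" for i
    using e that unfolding f_def bij_betw_def by (auto intro: f_inv_into_f)
  have fI: "f i \<in> Z" if "i \<in> ?I" for i using f that by (auto simp: bij_betw_def)
  have eZ: "e z \<in> ?I" if "z \<in> Z" for z using e that unfolding bij_betw_def by blast
  define \<Psi> where "\<Psi> \<sigma> = (\<lambda>i. if i \<in> ?I then e (\<sigma> (f i)) else i)" for \<sigma>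
  have \<sigma>D: "fhom L \<sigma>" "\<And>c. \<sigma> (to_ac c) = to_ac c" "\<And>z. z \<in> Z \<Longrightarrow> \<sigma> z \<in> Z"
    "\<sigma> \<in> extensional L" "\<sigma> \<in> Bij L"
    if "\<sigma> \<in> carrier (Gal L)" for \<sigma>
  proof -
    have G: "\<sigma> \<in> extensional L \<and> bij_betw \<sigma> L L \<and> fhom L \<sigma> \<and> (\<forall>c. \<sigma> (to_ac c) = to_ac c)"
      by (rule iffD1[OF Gal_carrier that])
    thus hom: "fhom L \<sigma>" and const: "\<And>c. \<sigma> (to_ac c) = to_ac c" and "\<sigma> \<in> extensional L" by blast+
    show "\<And>z. z \<in> Z \<Longrightarrow> \<sigma> z \<in> Z" by (rule hom_maps_roots[OF hom const])
    show "\<sigma> \<in> Bij L" using G by (simp add: Bij_def)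
  qed
  have "\<Psi> \<in> iso (Gal L) (sym_group ?m)"
    unfolding iso_def
  proof (intro CollectI conjI)
    show "\<Psi> \<in> hom (Gal L) (sym_group ?m)"
    proof (rule homI)
      fix \<sigma> assume \<sigma>: "\<sigma> \<in> carrier (Gal L)"
      have "(\<lambda>z. if z \<in> Z then \<sigma> z else z) permutes Z" by (intro hom_permutes_roots \<sigma>D[OF \<sigma>])
      from permutes_bij_inv_into[OF this e]
      have "\<Psi> \<sigma> permutes ?I"
        unfolding \<Psi>_def f_def[symmetric] using fI by (simp cong: if_cong)
      thus "\<Psi> \<sigma> \<in> carrier (sym_group ?m)" by (simp add: sym_group_carrier)
    next
      fix \<sigma> \<tau> assume \<sigma>: "\<sigma> \<in> carrier (Gal L)" and \<tau>: "\<tau> \<in> carrier (Gal L)"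
      have mult: "(\<sigma> \<otimes>\<^bsub>Gal L\<^esub> \<tau>) z = \<sigma> (\<tau> z)" if "z \<in> Z" for z
        using \<sigma>D(5)[OF \<sigma>] \<sigma>D(5)[OF \<tau>] Z_in_L[OF that]
        by (simp add: Gal_def BijGroup_def compose_def)
      show "\<Psi> (\<sigma> \<otimes>\<^bsub>Gal L\<^esub> \<tau>) = \<Psi> \<sigma> \<otimes>\<^bsub>sym_group ?m\<^esub> \<Psi> \<tau>"
      proof
        fix i
        show "\<Psi> (\<sigma> \<otimes>\<^bsub>Gal L\<^esub> \<tau>) i = (\<Psi> \<sigma> \<otimes>\<^bsub>sym_group ?m\<^esub> \<Psi> \<tau>) i"
        proof (cases "i \<in> ?I")
          case True
          have "\<tau> (f i) \<in> Z" using fI[OF True] by (rule \<sigma>D(3)[OF \<tau>])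
          thus ?thesis using True eZ[of "\<tau> (f i)"]
            by (simp add: sym_group_mult \<Psi>_def mult[OF fI[OF True]] fe del: atLeastAtMost_iff)
        next
          case False
          thus ?thesis by (simp add: sym_group_mult \<Psi>_def del: atLeastAtMost_iff)
        qed
      qed
    qed
    show "bij_betw \<Psi> (carrier (Gal L)) (carrier (sym_group ?m))"
      unfolding bij_betw_def
    proof
      show "inj_on \<Psi> (carrier (Gal L))"
      proof (rule inj_onI)
        fix \<sigma> \<tau> assume \<sigma>: "\<sigma> \<in> carrier (Gal L)" and \<tau>: "\<tau> \<in> carrier (Gal L)" and eq: "\<Psi> \<sigma> = \<Psi> \<tau>"
        have "\<sigma> z = \<tau> z" if z: "z \<in> Z" for z
        proof -
          have "e (\<sigma> z) = e (\<tau> z)"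
            using fun_cong[OF eq, of "e z"] eZ[OF z] by (simp add: \<Psi>_def fe[OF z] del: atLeastAtMost_iff)
          thus ?thesis using fe \<sigma>D(3)[OF \<sigma> z] \<sigma>D(3)[OF \<tau> z] by metis
        qed
        hence "\<sigma> x = \<tau> x" if "x \<in> L" for x
          using that by (intro hom_eq_on_L[of \<sigma> \<tau> x] \<sigma>D[OF \<sigma>] \<sigma>D[OF \<tau>])
        thus "\<sigma> = \<tau>" using \<sigma>D(4)[OF \<sigma>] \<sigma>D(4)[OF \<tau>] by (intro extensionalityI)
      qed
      show "\<Psi> ` carrier (Gal L) = carrier (sym_group ?m)"
      proof
        show "\<Psi> ` carrier (Gal L) \<subseteq> carrier (sym_group ?m)"
          using \<open>\<Psi> \<in> hom (Gal L) (sym_group ?m)\<close> by (auto simp: hom_def)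
        show "carrier (sym_group ?m) \<subseteq> \<Psi> ` carrier (Gal L)"
        proof
          fix p assume "p \<in> carrier (sym_group ?m)"
          hence p: "p permutes ?I" by (simp add: sym_group_carrier)
          define \<pi> where "\<pi> = (\<lambda>z. if z \<in> Z then f (p (e z)) else z)"
          have "inv_into ?I f z = e z" if "z \<in> Z" for z
            unfolding f_def using e that by (rule inv_into_inv_into_eq)
          hence \<pi>: "\<pi> permutes Z"
            using permutes_bij_inv_into[OF p f] unfolding \<pi>_def by (simp cong: if_cong)
          have "\<Psi> (restrict (act \<pi>) L) = p"
          proof
            fix i
            show "\<Psi> (restrict (act \<pi>) L) i = p i"
            proof (cases "i \<in> ?I")
              case True
              have "p i \<in> ?I" using permutes_in_image[OF p] True by blast
              have "\<Psi> (restrict (act \<pi>) L) i = e (\<pi> (f i))"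
                using True fI[OF True] by (simp add: \<Psi>_def Z_in_L act(3)[OF \<pi>] del: atLeastAtMost_iff)
              also have "\<pi> (f i) = f (p i)" using fI[OF True] by (simp only: \<pi>_def if_True ef[OF True])
              finally show ?thesis by (simp only: ef[OF \<open>p i \<in> ?I\<close>])
            next
              case False
              thus ?thesis using permutes_not_in[OF p False] by (simp add: \<Psi>_def del: atLeastAtMost_iff)
            qed
          qed
          thus "p \<in> \<Psi> ` carrier (Gal L)" using restrict_act_in_Gal[OF \<pi>] by (metis image_eqI)
        qed
      qed
    qed
  qed
  thus ?thesis by (auto simp: is_iso_def)
qed

end


section \<open>Primitive elements\<close>

text \<open>
  The element \<open>\<gamma>\<close> has trivial stabiliser in the symmetric group, which by Galois theory means that it
  generates \<open>L\<close>.
\<close>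

locale primitive_element = symmetric_splitting Z for Z :: "'k :: field alg_closure set" +
  fixes \<gamma> :: "'k alg_closure"
  assumes \<gamma>: "\<gamma> \<in> L"
    and moved: "\<pi> permutes Z \<Longrightarrow> \<pi> \<noteq> id \<Longrightarrow> act \<pi> \<gamma> \<noteq> \<gamma>"
begin

lemma act_inj: "inj_on (\<lambda>\<pi>. act \<pi> \<gamma>) {\<pi>. \<pi> permutes Z}"
proof (rule inj_onI, clarify)
  fix \<pi> \<rho> assume perm: "\<pi> permutes Z" "\<rho> permutes Z" and eq: "act \<pi> \<gamma> = act \<rho> \<gamma>"
  have "act (inv_into UNIV \<rho> \<circ> \<pi>) \<gamma> = \<gamma>"
    using act_comp[OF permutes_inv[OF perm(2)] perm(1) \<gamma>] act_inv(1)[OF perm(2) \<gamma>] eq by simp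
  hence "inv_into UNIV \<rho> \<circ> \<pi> = id"
    using moved permutes_compose[OF perm(1) permutes_inv[OF perm(2)]] by blast
  hence "\<rho> \<circ> (inv_into UNIV \<rho> \<circ> \<pi>) = \<rho>" by simp
  thus "\<pi> = \<rho>" by (simp add: o_assoc permutes_inv_o[OF perm(2)])
qed

lemma card_conjugates: "card ((\<lambda>\<pi>. act \<pi> \<gamma>) ` {\<pi>. \<pi> permutes Z}) = fact (card Z)"
  using card_image[OF act_inj] card_permutations[OF refl fin] by simp

text \<open>
  The \<open>m!\<close> conjugates of \<open>\<gamma>\<close>, where \<open>m = card Z\<close>, are roots of its minimal polynomial \<open>P\<close>, so
  \<open>degree P \<ge> m!\<close>. The powers of \<open>\<gamma>\<close> below \<open>degree P\<close> are linearly independent in \<open>L\<close>, which is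
  spanned by \<open>m!\<close> elements. So equality holds and these powers form a basis.
\<close>

theorem primitive:
  obtains P :: "'k poly" where "Factorial_Ring.irreducible P" "degree P = fact (card Z)"
    "\<And>\<pi>. \<pi> permutes Z \<Longrightarrow> poly (map_poly to_ac P) (act \<pi> \<gamma>) = 0"
    "\<And>x. x \<in> L \<Longrightarrow> \<exists>q :: 'k poly. degree q < degree P \<and> x = poly (map_poly to_ac q) \<gamma>"
proof -
  interpret V: vector_space "\<lambda>(c :: 'k) x. to_ac c * x" by (rule vector_space_to_ac)
  obtain P :: "'k poly" where P: "Factorial_Ring.irreducible P" "degree P > 0"
    "poly (map_poly to_ac P) \<gamma> = 0" "\<And>q. poly (map_poly to_ac q) \<gamma> = 0 \<Longrightarrow> P dvd q"
    using min_poly_irreducible[of \<gamma>] by metis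
  have roots: "poly (map_poly to_ac P) (act \<pi> \<gamma>) = 0" if "\<pi> permutes Z" for \<pi>
    using act_poly[OF that \<gamma>, of P] P(3) act(2)[OF that, of 0] by simp
  have P0: "map_poly to_ac P \<noteq> 0" using P(2) by (auto simp: map_poly_eq_0_iff)
  have degmap: "degree (map_poly to_ac P) = degree P" by (rule degree_map_poly) simp
  have "fact (card Z) \<le> card {x. poly (map_poly to_ac P) x = 0}"
    unfolding card_conjugates[symmetric]
    using roots by (intro card_mono poly_roots_finite P0) auto
  also have "\<dots> \<le> degree P" using card_poly_roots_bound[OF P0] degmap by simp
  finally have lower: "fact (card Z) \<le> degree P" .
  obtain B where B: "finite B" "card B \<le> fact (card Z)" "L \<subseteq> V.span B"
    by (rule splitting_field_dim[OF fin over])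
  let ?n = "degree P"
  let ?S = "(\<lambda>i. \<gamma> ^ i) ` {..<?n}"
  have min: "?n \<le> degree q" if "q \<noteq> 0" "poly (map_poly to_ac q) \<gamma> = 0" for q :: "'k poly"
    using P(4)[OF that(2)] that(1) by (rule dvd_imp_degree_le)
  have inj: "inj_on (\<lambda>i. \<gamma> ^ i) {..<?n}" and indep: "V.independent ?S"
    using powers_independent[where x = \<gamma> and n = ?n] min by auto
  have cardS: "card ?S = ?n" using card_image[OF inj] by simp
  have SL: "?S \<subseteq> L" using \<gamma> subfld_power[OF L] by auto
  have SB: "?S \<subseteq> V.span B" using SL B(3) by blast
  have "card ?S \<le> card B" using V.independent_span_bound[OF B(1) indep SB] by blast
  hence deg: "?n = fact (card Z)" and cardB: "card B = ?n" using cardS B(2) lower by linarith+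
  have spanB: "V.span B \<subseteq> V.span ?S"
  proof
    fix x assume x: "x \<in> V.span B"
    show "x \<in> V.span ?S"
    proof (rule ccontr)
      assume nx: "x \<notin> V.span ?S"
      hence "x \<notin> ?S" by (rule contrapos_nn) (rule V.span_base)
      have "V.independent (insert x ?S)" using indep nx by (simp add: V.independent_insert del: image_insert)
      moreover have "insert x ?S \<subseteq> V.span B" using x SB by blast
      ultimately have "finite (insert x ?S) \<and> card (insert x ?S) \<le> card B"
        by (rule V.independent_span_bound[OF B(1)])
      moreover have "card (insert x ?S) = Suc (card ?S)" using \<open>x \<notin> ?S\<close> by (intro card_insert_disjoint) auto
      ultimately show False unfolding cardS cardB by simp
    qed
  qed
  have repr: "\<exists>q :: 'k poly. degree q < degree P \<and> x = poly (map_poly to_ac q) \<gamma>" if x: "x \<in> L" for x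
  proof -
    have "x \<in> V.span ?S" using x B(3) spanB by blast
    also have "V.span ?S = range (\<lambda>u. \<Sum>v\<in>?S. to_ac (u v) * v)" by (rule V.span_finite) simp
    finally obtain u where u: "x = (\<Sum>v\<in>?S. to_ac (u v) * v)" by blast
    hence xu: "x = (\<Sum>i<?n. to_ac (u (\<gamma> ^ i)) * \<gamma> ^ i)" by (simp add: sum.reindex[OF inj])
    define q where "q = (\<Sum>i<?n. monom (u (\<gamma> ^ i)) i)"
    have cq: "coeff q j = (if j < ?n then u (\<gamma> ^ j) else 0)" for j
      unfolding q_def coeff_sum by (simp add: sum.delta)
    have "degree q \<le> ?n - 1" by (rule degree_le) (use P(2) in \<open>auto simp: cq\<close>)
    hence dq: "degree q < ?n" using P(2) by simp
    have dmq: "degree (map_poly to_ac q) = degree q" by (rule degree_map_poly) simp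
    have "poly (map_poly to_ac q) \<gamma> = (\<Sum>i<?n. coeff (map_poly to_ac q) i * \<gamma> ^ i)"
      unfolding poly_altdef using dq dmq by (intro sum.mono_neutral_left) (auto simp: coeff_eq_0)
    also have "\<dots> = x" unfolding xu by (rule sum.cong) (simp_all add: coeff_map_poly cq)
    finally show ?thesis using dq by auto
  qed
  show ?thesis using that[OF P(1) deg roots repr] .
qed

text \<open>
  Write \<open>x\<close> as a polynomial \<open>q\<close> of degree less than \<open>m!\<close> in \<open>\<gamma>\<close>. It takes the value \<open>x\<close> at all the \<open>m!\<close>
  conjugates of \<open>\<gamma>\<close>, so it is constant.
\<close>

lemma fixed_in_K:
  assumes x: "x \<in> L" and fixed: "\<And>\<pi>. \<pi> permutes Z \<Longrightarrow> act \<pi> x = x"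
  shows "x \<in> K"
proof -
  obtain P q :: "'k poly" where P: "degree P = fact (card Z)"
    and q: "degree q < degree P" "x = poly (map_poly to_ac q) \<gamma>"
    using primitive x by metis
  have dmq: "degree (map_poly to_ac q) = degree q" by (rule degree_map_poly) simp
  have "map_poly to_ac q = [:x:]"
  proof (rule poly_eqI_degree)
    fix y assume "y \<in> (\<lambda>\<pi>. act \<pi> \<gamma>) ` {\<pi>. \<pi> permutes Z}"
    then obtain \<pi> where \<pi>: "\<pi> permutes Z" "y = act \<pi> \<gamma>" by blast
    have "poly (map_poly to_ac q) y = act \<pi> x" unfolding \<pi>(2) q(2) by (rule act_poly[OF \<pi>(1) \<gamma>, symmetric])
    thus "poly (map_poly to_ac q) y = poly [:x:] y" using fixed[OF \<pi>(1)] by simp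
  qed (use q(1) dmq P card_conjugates in simp_all)
  from arg_cong[OF this, of "\<lambda>p. coeff p 0"] have "x = to_ac (coeff q 0)" by (simp add: coeff_map_poly)
  thus ?thesis by blast
qed

text \<open>
  The coefficients are symmetric in the orbit of \<open>x\<close>, hence fixed by all automorphisms.
\<close>

lemma orbit_poly_over_K:
  assumes x: "x \<in> L"
  shows "roots_poly ((\<lambda>\<pi>. act \<pi> x) ` {\<pi>. \<pi> permutes Z}) \<in> polys_over K"
proof -
  let ?A = "(\<lambda>\<pi>. act \<pi> x) ` {\<pi>. \<pi> permutes Z}"
  have finA: "finite ?A" using finite_permutations[OF fin] by simp
  have AL: "?A \<subseteq> L" using act_in_L x by auto
  have overL: "roots_poly ?A \<in> polys_over L" by (rule roots_poly_over[OF L AL])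
  have "coeff (roots_poly ?A) i \<in> K" for i
  proof (rule fixed_in_K)
    show "coeff (roots_poly ?A) i \<in> L" by (rule polys_over_coeff[OF overL])
    fix \<rho> assume \<rho>: "\<rho> permutes Z"
    have inj: "inj_on (act \<rho>) ?A" using fhom_inj_on[OF act(1)[OF \<rho>] L] AL by (rule inj_on_subset)
    have "act \<rho> ` ?A \<subseteq> ?A"
    proof safe
      fix \<pi> assume \<pi>: "\<pi> permutes Z"
      have "act \<rho> (act \<pi> x) = act (\<rho> \<circ> \<pi>) x" using act_comp[OF \<rho> \<pi> x] by simp
      thus "act \<rho> (act \<pi> x) \<in> ?A" using permutes_compose[OF \<pi> \<rho>] by blast
    qed
    hence "act \<rho> ` ?A = ?A" using finA inj by (simp add: endo_inj_surj)
    hence "map_poly (act \<rho>) (roots_poly ?A) = roots_poly ?A"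
      using map_poly_roots_poly[OF act(1)[OF \<rho>] L finA AL inj] by simp
    thus "act \<rho> (coeff (roots_poly ?A) i) = coeff (roots_poly ?A) i"
      using fhomD(4)[OF act(1)[OF \<rho>] L] by (metis coeff_map_poly)
  qed
  thus ?thesis by (simp add: polys_over_def)
qed

lemma irreducible_dvd_orbit_poly:
  fixes g :: "'k poly"
  assumes g: "Factorial_Ring.irreducible g" and x: "x \<in> L" "poly (map_poly to_ac g) x = 0"
  shows "map_poly to_ac g dvd roots_poly ((\<lambda>\<pi>. act \<pi> x) ` {\<pi>. \<pi> permutes Z})"
proof -
  let ?A = "(\<lambda>\<pi>. act \<pi> x) ` {\<pi>. \<pi> permutes Z}"
  note hom = map_poly_fhom(3)[OF fhom_to_ac subfld_UNIV polys_over_UNIV polys_over_UNIV]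
  obtain P :: "'k poly" where P: "Factorial_Ring.irreducible P"
    "\<And>q. poly (map_poly to_ac q) x = 0 \<Longrightarrow> P dvd q"
    using min_poly_irreducible[of x] by metis
  obtain c where c: "g = P * c" using P(2)[OF x(2)] by blast
  have "c dvd 1" using irreducibleD[OF g c] irreducible_not_unit[OF P(1)] by blast
  hence gP: "g dvd P" using c by (simp add: mult_unit_dvd_iff)
  have "of_ac 0 = (0 :: 'k)" by (rule of_ac_eqI) simp
  hence Q: "map_poly to_ac (map_poly of_ac (roots_poly ?A)) = roots_poly ?A"
    by (intro poly_eqI) (simp add: coeff_map_poly to_ac_of_ac[OF polys_over_coeff[OF orbit_poly_over_K[OF x(1)]]])
  have "x \<in> ?A" using act_id[OF x(1)] permutes_id by (intro image_eqI[of _ _ id]) auto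
  hence "poly (roots_poly ?A) x = 0" using finite_permutations[OF fin] by (simp add: poly_roots_poly)
  hence "P dvd map_poly of_ac (roots_poly ?A)" using P(2) Q by simp
  hence "g dvd map_poly of_ac (roots_poly ?A)" using gP dvd_trans by blast
  then obtain s where "map_poly of_ac (roots_poly ?A) = g * s" by blast
  hence "roots_poly ?A = map_poly to_ac g * map_poly to_ac s" using Q hom by metis
  thus ?thesis by simp
qed

text \<open>
  An irreducible polynomial with a root \<open>x \<in> L\<close> divides the product over the distinct conjugates of \<open>x\<close>.
  This product has simple roots, all of them in \<open>L\<close>.
\<close>

theorem galois_ext_L: "galois_ext L"
proof -
  have "{y. poly (map_poly to_ac g) y = 0} \<subseteq> L \<and> rsquarefree (map_poly to_ac g)"
    if g: "Factorial_Ring.irreducible g" and x: "x \<in> L" "poly (map_poly to_ac g) x = 0" for g :: "'k poly" and x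
  proof
    let ?A = "(\<lambda>\<pi>. act \<pi> x) ` {\<pi>. \<pi> permutes Z}"
    have finA: "finite ?A" using finite_permutations[OF fin] by simp
    have dvd: "map_poly to_ac g dvd roots_poly ?A" by (rule irreducible_dvd_orbit_poly[OF g x])
    have "y \<in> ?A" if "poly (map_poly to_ac g) y = 0" for y
    proof -
      have "poly (roots_poly ?A) y = 0" using dvd that by (metis dvd_trans poly_eq_0_iff_dvd)
      thus ?thesis using finA by (simp add: poly_roots_poly)
    qed
    thus "{y. poly (map_poly to_ac g) y = 0} \<subseteq> L" using act_in_L x(1) by blast
    have g0: "map_poly to_ac g \<noteq> 0" using dvd by auto
    have "order y (map_poly to_ac g) \<le> 1" for y
    proof (rule ccontr)
      assume "\<not> order y (map_poly to_ac g) \<le> 1"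
      hence "[:- y, 1:] ^ 2 dvd map_poly to_ac g" by (simp add: order_divides g0)
      hence "[:- y, 1:] ^ 2 dvd roots_poly ?A" using dvd by (rule dvd_trans)
      then obtain h where h: "roots_poly ?A = [:- y, 1:] * ([:- y, 1:] * h)"
        by (metis dvdE power2_eq_square mult.assoc)
      hence "poly (roots_poly ?A) y = 0" by simp
      hence yA: "y \<in> ?A" using finA by (simp add: poly_roots_poly)
      have "poly (pderiv (roots_poly ?A)) y = 0"
        unfolding h by (simp add: pderiv_mult pderiv_pCons del: mult_pCons_left)
      thus False using pderiv_roots_poly_nonzero[OF finA yA] by blast
    qed
    thus "rsquarefree (map_poly to_ac g)" unfolding rsquarefree_def using g0
      by (metis One_nat_def le_Suc_eq le_zero_eq)
  qed
  thus ?thesis unfolding galois_ext_def normal_ext_def separable_ext_def by blast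
qed

theorem field_adjoin_primitive: "field_adjoin \<gamma> = L"
proof -
  let ?R = "ring_of_type_algebra :: 'k alg_closure ring"
  let ?E = "generate_field ?R (insert \<gamma> K)"
  interpret R: field ?R by (rule field_from_type_algebra)
  have R: "carrier ?R = UNIV" "\<And>x y. x \<otimes>\<^bsub>?R\<^esub> y = x * y" "\<And>x y. x \<oplus>\<^bsub>?R\<^esub> y = x + y"
    "\<one>\<^bsub>?R\<^esub> = 1" "\<zero>\<^bsub>?R\<^esub> = 0" by (simp_all add: ring_of_type_algebra_def)
  have minus: "\<ominus>\<^bsub>?R\<^esub> x = - x" for x
    by (rule R.minus_equality) (simp_all add: R)
  have inv: "inv\<^bsub>?R\<^esub> x = inverse x" if "x \<noteq> 0" for x
    by (rule R.comm_inv_char) (use that in \<open>simp_all add: R\<close>)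
  have "?E \<subseteq> L"
  proof
    fix x assume "x \<in> ?E"
    thus "x \<in> L"
      by (induction rule: generate_field.induct)
        (auto simp: R minus inv subfldD[OF L] \<gamma> to_ac_in_L)
  qed
  moreover have "L \<subseteq> ?E"
  proof
    have "subfld ?E"
      unfolding subfld_def
    proof (intro conjI ballI)
      show K: "0 \<in> ?E" "1 \<in> ?E"
        by (auto intro!: generate_field.incl simp flip: to_ac_0 to_ac_1)
      fix x y assume xy: "x \<in> ?E" "y \<in> ?E"
      show "x + y \<in> ?E" using generate_field.eng_add[OF xy] by (simp add: R)
      show "x * y \<in> ?E" using generate_field.eng_mult[OF xy] by (simp add: R)
      show "- x \<in> ?E" using generate_field.a_inv[OF xy(1)] by (simp add: minus)
      show "inverse x \<in> ?E"
        using generate_field.m_inv[OF xy(1)] xy(1) by (cases "x = 0") (simp_all add: R inv)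
    qed
    fix x assume "x \<in> L"
    then obtain q :: "'k poly" where "x = poly (map_poly to_ac q) \<gamma>" using primitive by metis
    moreover have "map_poly to_ac q \<in> polys_over ?E"
      by (auto simp: polys_over_def coeff_map_poly intro: generate_field.incl)
    moreover have "\<gamma> \<in> ?E" by (rule generate_field.incl) simp
    ultimately show "x \<in> ?E" using poly_in_subfld[OF \<open>subfld ?E\<close>] by blast
  qed
  ultimately show ?thesis by (simp add: field_adjoin_def)
qed

end


section \<open>Generic linear combinations of the roots\<close>

text \<open>
  The hypothesis extends by linearity to all polynomials of degree less than \<open>card Z\<close>. Apply it to the
  one that vanishes on \<open>Z\<close> except at \<open>z\<close>.
\<close>

lemma vandermonde_kernel_trivial:
  fixes Z :: "'a :: field set"
  assumes fin: "finite Z" and u: "\<And>k. k < card Z \<Longrightarrow> (\<Sum>y\<in>Z. u y * y ^ k) = 0" and z: "z \<in> Z"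
  shows "u z = 0"
proof -
  define p where "p = roots_poly (Z - {z})"
  have deg: "degree p < card Z"
    using z fin card_gt_0_iff[of Z] by (auto simp: p_def degree_roots_poly)
  have pz: "poly p y = 0 \<longleftrightarrow> y \<in> Z - {z}" for y unfolding p_def using fin by (intro poly_roots_poly) simp
  have "(\<Sum>y\<in>Z. u y * poly p y) = (\<Sum>y\<in>Z. \<Sum>k\<le>degree p. coeff p k * (u y * y ^ k))"
    by (simp add: poly_altdef sum_distrib_left ac_simps)
  also have "\<dots> = (\<Sum>k\<le>degree p. coeff p k * (\<Sum>y\<in>Z. u y * y ^ k))"
    by (subst sum.swap) (simp add: sum_distrib_left)
  also have "\<dots> = 0" using u deg by (intro sum.neutral) auto
  finally have "(\<Sum>y\<in>Z. u y * poly p y) = 0" .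
  moreover have "(\<Sum>y\<in>Z. u y * poly p y) = (\<Sum>y\<in>{z}. u y * poly p y)"
    using z fin pz by (intro sum.mono_neutral_right) auto
  ultimately show ?thesis using pz[of z] by simp
qed

text \<open>
  Let \<open>p\<close> be the sum of \<open>s\<^sup>k X\<^sup>k\<close> for \<open>k < card Z\<close>. For each \<open>u\<close> the sum in question is then a
  polynomial in \<open>s\<close>; its coefficients are the power sums of \<open>u\<close>, not all of which vanish by the
  Vandermonde argument. An infinite field contains some \<open>s\<close> that is a root of none of these
  finitely many polynomials.
\<close>

lemma generic_polynomial_exists:
  fixes Z :: "'k :: field alg_closure set"
  assumes fin: "finite Z" and inf: "infinite (UNIV :: 'k set)" and finU: "finite U"
    and U: "\<And>u. u \<in> U \<Longrightarrow> \<exists>z \<in> Z. u z \<noteq> 0"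
  shows "\<exists>p :: 'k poly. \<forall>u \<in> U. (\<Sum>z\<in>Z. u z * poly (map_poly to_ac p) z) \<noteq> 0"
proof -
  let ?n = "card Z"
  define Q where "Q u = (\<Sum>k<?n. monom (\<Sum>z\<in>Z. u z * z ^ k) k)" for u
  have coeffQ: "coeff (Q u) k = (\<Sum>z\<in>Z. u z * z ^ k)" if "k < ?n" for u k
    using that by (simp add: Q_def coeff_sum sum.delta)
  have "Q u \<noteq> 0" if u: "u \<in> U" for u
  proof
    assume Q0: "Q u = 0"
    have "(\<Sum>z\<in>Z. u z * z ^ k) = 0" if "k < ?n" for k using coeffQ[OF that, of u] Q0 by simp
    hence "u z = 0" if "z \<in> Z" for z using vandermonde_kernel_trivial[OF fin _ that] by blast
    thus False using U[OF u] by blast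
  qed
  hence "(\<Prod>u\<in>U. Q u) \<noteq> 0" using finU by (simp add: prod_zero_iff)
  hence "finite {x. poly (\<Prod>u\<in>U. Q u) x = 0}" by (rule poly_roots_finite)
  moreover have "infinite (range (to_ac :: 'k \<Rightarrow> _))"
    using inf finite_imageD[OF _ inj_to_ac] by blast
  ultimately have "\<not> range (to_ac :: 'k \<Rightarrow> _) \<subseteq> {x. poly (\<Prod>u\<in>U. Q u) x = 0}"
    using finite_subset by blast
  then obtain s :: 'k where s: "poly (\<Prod>u\<in>U. Q u) (to_ac s) \<noteq> 0" by auto
  define p where "p = (\<Sum>k<?n. monom (s ^ k) k)"
  have coeffp: "coeff p k = (if k < ?n then s ^ k else 0)" for k
    by (simp add: p_def coeff_sum sum.delta)
  have pz: "poly (map_poly to_ac p) z = (\<Sum>k<?n. to_ac s ^ k * z ^ k)" for z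
  proof -
    have "map_poly to_ac p = (\<Sum>k<?n. monom (to_ac s ^ k) k)"
      by (rule poly_eqI) (simp add: coeff_map_poly coeffp coeff_sum sum.delta)
    thus ?thesis by (simp add: poly_sum poly_monom)
  qed
  have "(\<Sum>z\<in>Z. u z * poly (map_poly to_ac p) z) \<noteq> 0" if u: "u \<in> U" for u
  proof -
    have "(\<Sum>z\<in>Z. u z * poly (map_poly to_ac p) z) = (\<Sum>k<?n. \<Sum>z\<in>Z. u z * z ^ k * to_ac s ^ k)"
      unfolding pz sum_distrib_left by (subst sum.swap) (simp add: ac_simps)
    also have "\<dots> = poly (Q u) (to_ac s)"
      by (simp add: Q_def poly_sum poly_monom sum_distrib_right)
    finally show ?thesis using s u finU by (simp add: poly_prod prod_zero_iff)
  qed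
  thus ?thesis by blast
qed

context symmetric_splitting
begin

lemma poly_in_L: "x \<in> L \<Longrightarrow> poly (map_poly to_ac p) x \<in> L"
  using to_ac_in_L by (intro poly_in_subfld[OF L]) (auto simp: polys_over_def coeff_map_poly)

lemma combination_in_L: "(\<Sum>z\<in>Z. to_ac (c z) * poly (map_poly to_ac p) z) \<in> L"
  by (intro subfld_sum[OF L] subfldD(4)[OF L] to_ac_in_L poly_in_L Z_in_L)

text \<open>
  Permuting the roots amounts to permuting the coefficients \<open>c\<close>. This is how the columns of a
  one-factor, which are permutations of one another, become conjugate elements.
\<close>

lemma act_combination:
  assumes \<pi>: "\<pi> permutes Z"
  shows "act \<pi> (\<Sum>z\<in>Z. to_ac (c z) * poly (map_poly to_ac p) z) =
    (\<Sum>z\<in>Z. to_ac (c (inv_into UNIV \<pi> z)) * poly (map_poly to_ac p) z)"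
proof -
  have "act \<pi> (\<Sum>z\<in>Z. to_ac (c z) * poly (map_poly to_ac p) z) =
      (\<Sum>z\<in>Z. act \<pi> (to_ac (c z) * poly (map_poly to_ac p) z))"
    by (intro fhom_sum[OF act(1)[OF \<pi>] L] subfldD(4)[OF L] to_ac_in_L poly_in_L Z_in_L)
  also have "\<dots> = (\<Sum>z\<in>Z. to_ac (c z) * poly (map_poly to_ac p) (\<pi> z))"
    by (intro sum.cong refl)
      (simp add: fhomD(3)[OF act(1)[OF \<pi>] L] to_ac_in_L poly_in_L Z_in_L act[OF \<pi>] act_poly[OF \<pi>])
  also have "\<dots> = (\<Sum>z\<in>Z. to_ac (c (inv_into UNIV \<pi> (\<pi> z))) * poly (map_poly to_ac p) (\<pi> z))"
    by (simp add: permutes_inverses(2)[OF \<pi>])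
  also have "\<dots> = (\<Sum>z\<in>Z. to_ac (c (inv_into UNIV \<pi> z)) * poly (map_poly to_ac p) z)"
    by (rule sum.reindex_bij_betw[OF permutes_imp_bij[OF \<pi>]])
  finally show ?thesis .
qed

text \<open>
  An automorphism \<open>\<pi>\<close> changes the combination by one whose coefficients are differences of values of
  \<open>c\<close>. As \<open>c\<close> is injective, these do not all vanish unless \<open>\<pi> = id\<close>, so a generic polynomial \<open>p\<close> makes
  all these changes nonzero, and the combination itself as well.
\<close>

lemma generic_combination_exists:
  assumes inf: "infinite (UNIV :: 'k set)" and inj: "inj_on c Z" and nonzero: "\<exists>z \<in> Z. c z \<noteq> 0"
  obtains p :: "'k poly" where
    "primitive_element Z (\<Sum>z\<in>Z. to_ac (c z) * poly (map_poly to_ac p) z)"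
    "(\<Sum>z\<in>Z. to_ac (c z) * poly (map_poly to_ac p) z) \<noteq> 0"
proof -
  define u where "u \<pi> z = to_ac (c (inv_into UNIV \<pi> z)) - to_ac (c z)" for \<pi> z
  let ?U = "insert (\<lambda>z. to_ac (c z)) (u ` {\<pi>. \<pi> permutes Z \<and> \<pi> \<noteq> id})"
  have "finite ?U" using finite_permutations[OF fin] by simp
  moreover have "\<exists>z \<in> Z. v z \<noteq> 0" if v: "v \<in> ?U" for v
  proof (cases "v = (\<lambda>z. to_ac (c z))")
    case True
    thus ?thesis using nonzero by simp
  next
    case False
    then obtain \<pi> where \<pi>: "\<pi> permutes Z" "\<pi> \<noteq> id" "v = u \<pi>" using v by blast
    note inv = permutes_inv[OF \<pi>(1)]
    show ?thesis
    proof (rule ccontr)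
      assume "\<not> ?thesis"
      hence "c (inv_into UNIV \<pi> z) = c z" if "z \<in> Z" for z using that \<pi>(3) by (auto simp: u_def)
      hence "inv_into UNIV \<pi> z = z" for z
        using inj permutes_in_image[OF inv] permutes_not_in[OF inv] by (metis inj_onD)
      hence "\<pi> z = z" for z using permutes_inverses(1)[OF \<pi>(1)] by metis
      thus False using \<pi>(2) by auto
    qed
  qed
  ultimately obtain p :: "'k poly" where p: "\<And>v. v \<in> ?U \<Longrightarrow> (\<Sum>z\<in>Z. v z * poly (map_poly to_ac p) z) \<noteq> 0"
    using generic_polynomial_exists[OF fin inf] by meson
  let ?\<gamma> = "\<Sum>z\<in>Z. to_ac (c z) * poly (map_poly to_ac p) z"
  have "primitive_element Z ?\<gamma>"
  proof unfold_locales
    show "?\<gamma> \<in> L" by (rule combination_in_L)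
    fix \<pi> assume \<pi>: "\<pi> permutes Z" "\<pi> \<noteq> id"
    have "act \<pi> ?\<gamma> - ?\<gamma> = (\<Sum>z\<in>Z. u \<pi> z * poly (map_poly to_ac p) z)"
      unfolding act_combination[OF \<pi>(1)] by (simp add: u_def sum_subtractf left_diff_distrib)
    also have "\<dots> \<noteq> 0" using \<pi> by (intro p) blast
    finally show "act \<pi> ?\<gamma> \<noteq> ?\<gamma>" by simp
  qed
  moreover have "?\<gamma> \<noteq> 0" by (rule p) simp
  ultimately show ?thesis by (rule that)
qed

end


section \<open>From one-factors to Galois conjugates\<close>

lemma count_image_le_1_imp:
  assumes "\<And>c. count (image_mset f T) c \<le> 1"
  shows "inj_on f (set_mset T)" "size T = card (set_mset T)"
proof -
  have fibre: "sum (count T) (f -` {c} \<inter> set_mset T) \<le> 1" for c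
    using assms[of c] by (simp add: count_image_mset)
  have le: "count T x \<le> 1" for x
  proof (cases "x \<in># T")
    case True
    hence "count T x \<le> sum (count T) (f -` {f x} \<inter> set_mset T)"
      by (intro member_le_sum) auto
    thus ?thesis using fibre[of "f x"] by linarith
  qed (simp add: not_in_iff)
  show "inj_on f (set_mset T)"
  proof (rule inj_onI, rule ccontr)
    fix x y assume xy: "x \<in># T" "y \<in># T" "f x = f y" "x \<noteq> y"
    have "sum (count T) {x, y} \<le> sum (count T) (f -` {f x} \<inter> set_mset T)"
      using xy by (intro sum_mono2) auto
    moreover have "count T x \<ge> 1" "count T y \<ge> 1" using xy by (simp_all add: Suc_le_eq)
    moreover have "sum (count T) {x, y} = count T x + count T y" using xy by simp
    ultimately show False using fibre[of "f x"] by linarith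
  qed
  have "size T = (\<Sum>x\<in>set_mset T. count T x)" by (rule size_multiset_overloaded_eq)
  also have "\<dots> = (\<Sum>x\<in>set_mset T. 1)"
    by (rule sum.cong) (use le in \<open>auto intro: antisym simp: Suc_le_eq\<close>)
  finally show "size T = card (set_mset T)" by simp
qed

lemma infinite_poly_fract: "infinite (UNIV :: 'q :: field poly fract set)"
proof
  assume fin: "finite (UNIV :: 'q poly fract set)"
  have "inj (\<lambda>n. to_fract (monom (1 :: 'q) n))"
    by (rule injI) (metis degree_monom_eq to_fract_eq_iff zero_neq_one)
  hence "finite (UNIV :: nat set)" using fin by (rule finite_imageD[OF finite_subset[OF subset_UNIV], rotated])
  thus False by simp
qed

theorem theorem7p2:
  fixes n m :: nat
    and a :: "'q :: {field, finite} poly vec"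
    and T :: "'q poly fract vec multiset"
  assumes "n \<ge> 3"
    and "a \<in> carrier_vec n"
    and "coprime_tuple a"
    and "one_factor n (map_vec to_fract a) T"
    and "size T = m"
  shows "\<exists>\<gamma> :: 'q poly fract alg_closure vec.
           \<gamma> \<in> carrier_vec n \<and>
           galois_conjugates (set\<^sub>v \<gamma>) \<and>
           map_vec (\<lambda>p. to_ac (to_fract p)) a \<bullet> \<gamma> = 0 \<and>
           galois_ext (field_adjoin (\<gamma> $ 0)) \<and>
           Gal (field_adjoin (\<gamma> $ 0)) \<cong> sym_group m"
proof -
  have n0: "0 < n" using assms(1) by simp
  have ne: "T \<noteq> {#}" and sol: "\<And>x. x \<in># T \<Longrightarrow> x \<in> carrier_vec n \<and> x \<noteq> 0\<^sub>v n \<and> map_vec to_fract a \<bullet> x = 0"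
    and bal: "\<And>j. j < n \<Longrightarrow> image_mset (\<lambda>x. x $ j) T = image_mset (\<lambda>x. x $ 0) T"
    and one: "\<And>c. count (image_mset (\<lambda>x. x $ 0) T) c \<le> 1"
    using assms(4) n0 unfolding one_factor_def balanced_multiset_def by blast+
  let ?X = "set_mset T"
  have injX: "inj_on (\<lambda>x. x $ j) ?X" if "j < n" for j
    using count_image_le_1_imp(1)[of "\<lambda>x. x $ j" T] bal[OF that] one by simp
  have imX: "(\<lambda>x. x $ j) ` ?X = (\<lambda>x. x $ 0) ` ?X" if "j < n" for j
    using arg_cong[OF bal[OF that], of set_mset] by simp
  have cardX: "card ?X = m" using count_image_le_1_imp(2)[of _ T, OF one] assms(5) by simp
  have "m \<ge> 1" using ne assms(5) by (metis One_nat_def Suc_leI nonempty_has_size)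
  then obtain Z :: "'q poly fract alg_closure set" where Z: "finite Z" "card Z = m"
    "roots_poly Z \<in> polys_over (range to_ac)" "\<And>\<pi>. \<pi> permutes Z \<Longrightarrow> \<pi> \<in> galois_perms Z"
    by (rule symmetric_galois_group_exists) (rule that)
  interpret symmetric_splitting Z using Z(1,3,4) by unfold_locales
  obtain \<xi> where \<xi>: "bij_betw \<xi> Z ?X"
    using finite_same_card_bij[OF Z(1), of ?X] Z(2) cardX by auto
  have \<xi>T: "\<xi> z \<in># T" if "z \<in> Z" for z using \<xi> that by (auto simp: bij_betw_def)
  \<comment> \<open>the roots index the solutions: \<open>d j\<close> is column \<open>j\<close> of the one-factor\<close>
  define d where "d j z = \<xi> z $ j" for j z
  have injd: "inj_on (d j) Z" if "j < n" for j
    using comp_inj_on[of \<xi> Z "\<lambda>x. x $ j"] injX[OF that] \<xi> by (simp add: bij_betw_def d_def[abs_def] comp_def)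
  have imd: "d j ` Z = d 0 ` Z" if "j < n" for j
  proof -
    have "d k ` Z = (\<lambda>x. x $ k) ` ?X" for k
      by (simp add: d_def[abs_def] image_image flip: bij_betw_imp_surj_on[OF \<xi>])
    thus ?thesis using imX[OF that] by simp
  qed
  \<comment> \<open>if the first column were zero, so would be all columns, but solutions are nonzero\<close>
  have "\<exists>z \<in> Z. d 0 z \<noteq> 0"
  proof (rule ccontr)
    assume "\<not> ?thesis"
    hence d0: "d 0 ` Z \<subseteq> {0}" by auto
    obtain x where x: "x \<in># T" using ne by blast
    then obtain z where z: "z \<in> Z" "x = \<xi> z" using \<xi> by (auto simp: bij_betw_def)
    have "d j z = 0" if "j < n" for j using imd[OF that] d0 z(1) by auto
    hence "x = 0\<^sub>v n" using sol[OF x] z by (intro eq_vecI) (auto simp: d_def)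
    thus False using sol[OF x] by blast
  qed
  then obtain p :: "'q poly fract poly" where
    prim: "primitive_element Z (\<Sum>z\<in>Z. to_ac (d 0 z) * poly (map_poly to_ac p) z)" and
    nonzero: "(\<Sum>z\<in>Z. to_ac (d 0 z) * poly (map_poly to_ac p) z) \<noteq> 0"
    using generic_combination_exists[OF infinite_poly_fract injd[OF n0]] by blast
  define \<gamma> where "\<gamma> j = (\<Sum>z\<in>Z. to_ac (d j z) * poly (map_poly to_ac p) z)" for j
  interpret primitive_element Z "\<gamma> 0" using prim by (simp add: \<gamma>_def)
  have conj: "\<exists>\<rho>. \<rho> permutes Z \<and> \<gamma> j = act \<rho> (\<gamma> 0)" if j: "j < n" for j
  proof -
    \<comment> \<open>the permutation that turns the first column of \<open>T\<close> into column \<open>j\<close>\<close>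
    define \<pi> where "\<pi> = (\<lambda>z. if z \<in> Z then inv_into Z (d 0) (d j z) else z)"
    have d0\<pi>: "d 0 (\<pi> z) = d j z" if "z \<in> Z" for z
      using that imd[OF j] by (auto simp: \<pi>_def intro!: f_inv_into_f)
    have "bij_betw (d j) Z (d 0 ` Z)" using injd[OF j] imd[OF j] by (simp add: bij_betw_def)
    moreover have "bij_betw (inv_into Z (d 0)) (d 0 ` Z) Z"
      using injd[OF n0] by (intro bij_betw_inv_into) (simp add: bij_betw_def)
    ultimately have "bij_betw (inv_into Z (d 0) \<circ> d j) Z Z" by (rule bij_betw_trans)
    hence "bij_betw \<pi> Z Z" by (simp add: \<pi>_def cong: bij_betw_cong)
    hence \<pi>: "\<pi> permutes Z" by (rule bij_imp_permutes) (simp add: \<pi>_def)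
    have "act (inv_into UNIV \<pi>) (\<gamma> 0) = \<gamma> j"
      unfolding \<gamma>_def act_combination[OF permutes_inv[OF \<pi>]] permutes_inv_inv[OF \<pi>]
      by (intro sum.cong) (simp_all add: d0\<pi>)
    thus ?thesis using permutes_inv[OF \<pi>] by metis
  qed
  have \<gamma>nz: "\<gamma> j \<noteq> 0" if j: "j < n" for j
  proof
    assume 0: "\<gamma> j = 0"
    obtain \<rho> where \<rho>: "\<rho> permutes Z" "\<gamma> j = act \<rho> (\<gamma> 0)" using conj[OF j] by blast
    have "act \<rho> (\<gamma> 0) = act \<rho> 0" using 0 \<rho>(2) fhomD(4)[OF act(1)[OF \<rho>(1)] L] by simp
    hence "\<gamma> 0 = 0" using fhom_inj_on[OF act(1)[OF \<rho>(1)] L] \<gamma> subfldD(1)[OF L] by (meson inj_onD)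
    thus False using nonzero by (simp add: \<gamma>_def)
  qed
  let ?\<gamma> = "vec n \<gamma>"
  obtain P :: "'q poly fract poly" where P: "Factorial_Ring.irreducible P"
    "\<And>\<pi>. \<pi> permutes Z \<Longrightarrow> poly (map_poly to_ac P) (act \<pi> (\<gamma> 0)) = 0"
    using primitive by metis
  have "galois_conjugates (set\<^sub>v ?\<gamma>)"
    unfolding galois_conjugates_def
  proof (intro exI[of _ P] conjI ballI P(1))
    fix x assume "x \<in> set\<^sub>v ?\<gamma>"
    then obtain j where j: "j < n" "x = \<gamma> j" by (auto simp: vec_set_def)
    show "x \<noteq> 0" using \<gamma>nz j by simp
    show "poly (map_poly to_ac P) x = 0" using conj[OF j(1)] P(2) j(2) by auto
  qed
  moreover have "map_vec (\<lambda>p. to_ac (to_fract p)) a \<bullet> ?\<gamma> = 0"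
  proof -
    have "map_vec (\<lambda>p. to_ac (to_fract p)) a \<bullet> ?\<gamma> =
        (\<Sum>j\<in>{0..<n}. \<Sum>z\<in>Z. to_ac (to_fract (a $ j)) * (to_ac (d j z) * poly (map_poly to_ac p) z))"
      using assms(2) by (simp add: scalar_prod_def \<gamma>_def sum_distrib_left)
    also have "\<dots> = (\<Sum>z\<in>Z. to_ac (\<Sum>j\<in>{0..<n}. to_fract (a $ j) * d j z) * poly (map_poly to_ac p) z)"
      by (subst sum.swap) (simp add: to_ac_sum sum_distrib_right mult.assoc)
    also have "\<dots> = 0"
    proof (rule sum.neutral, rule ballI)
      fix z assume z: "z \<in> Z"
      have "(\<Sum>j\<in>{0..<n}. to_fract (a $ j) * d j z) = map_vec to_fract a \<bullet> \<xi> z"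
        using sol[OF \<xi>T[OF z]] assms(2) by (auto simp: scalar_prod_def d_def intro!: sum.cong)
      thus "to_ac (\<Sum>j\<in>{0..<n}. to_fract (a $ j) * d j z) * poly (map_poly to_ac p) z = 0"
        using sol[OF \<xi>T[OF z]] by simp
    qed
    finally show ?thesis .
  qed
  moreover have "field_adjoin (?\<gamma> $ 0) = L" using field_adjoin_primitive n0 by simp
  ultimately show ?thesis
    using galois_ext_L Gal_iso_sym_group Z(2) by (intro exI[of _ ?\<gamma>]) simp
qed

end
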